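(* Let $I\neq\{0\}$ be an ideal of $B(H)$. Then the following conditions are equivalent. (i) $I$ is am-closed. (ii) $I$ is invariant under substochastic matrices. (ii$'$) $I$ is invariant under orthostochastic matrices. (iii) $I\supset\mathscr L_1$ (the trace class) and $I$ is invariant under block orthostochastic matrices.
   Context: $H$ is a separable infinite-dimensional Hilbert space. $c_0^*$ is the cone of nonincreasing sequences of nonnegative reals converging to $0$ (not a dual space). An ideal is a (proper) two-sided ideal of $B(H)$, hence consists of compact operators; its characteristic set is $\Sigma(I)=\{s(X): X\in I\}\subset c_0^*$, where $s(X)$ is the singular number sequence of $X$ (eigenvalues of $|X|$ in decreasing order, repeated with multiplicity). $I\mapsto\Sigma(I)$ is a bijection onto the hereditary (solid) subcones of $c_0^*$ invariant under all ampliations $\xi\mapsto\langle\xi_1,\dots,\xi_1,\xi_2,\dots,\xi_2,\dots\rangle$ (each entry repeated $m$ times). For $\xi\in c_0^*$, $\xi_a:=\langle\frac1n\sum_{j=1}^n\xi_j\rangle_n$. The ideals ${}_aI$ and $I_a$ are defined by $\Sigma({}_aI)=\{\xi\in c_0^*:\xi_a\in\Sigma(I)\}$ and $\Sigma(I_a)=\{\xi\in c_0^*:\xi=O(\eta_a)\text{ for some }\eta\in\Sigma(I)\}$. The am-closure of $I$ is $I^-:={}_a(I_a)$, and $I$ is am-closed if $I=I^-$. Infinite matrices are indexed by $\mathbb N\times\mathbb N$, $\mathbb N=\{1,2,\dots\}$, and $(P\rho)_i=\sum_jP_{ij}\rho_j$. A matrix with nonnegative entries is substochastic if all its row and column sums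 are at most $1$. An orthogonal matrix is a unitary matrix with real entries; $Q$ is orthostochastic if $Q_{ij}=(U_{ij})^2$ for some orthogonal matrix $U$, and block orthostochastic if $Q_{ij}=(U_{ij})^2$ for a matrix $U$ which is a direct sum of finite orthogonal matrices. If $\xi\in c_0^*$ and $P$ is substochastic then $P\xi$ is a nonnegative sequence converging to $0$; for such a sequence $\rho$, $\rho^*\in c_0^*$ denotes its monotone nonincreasing rearrangement (its $n$-th term is the $n$-th largest value of $\rho$, counted with multiplicity). Given a collection $\mathscr P$ of substochastic matrices, $I$ is invariant under $\mathscr P$ if $(P\xi)^*\in\Sigma(I)$ for every $P\in\mathscr P$ and every $\xi\in\Sigma(I)$. *)

theory Defs
  imports "HOL-Analysis.Analysis"
begin

section \<open>Complex Hilbert spaces and bounded operators\<close>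

class complex_vector = real_vector +
  fixes scaleC :: "complex \<Rightarrow> 'a \<Rightarrow> 'a"  (infixr \<open>*\<^sub>C\<close> 75)
  assumes scaleC_add_right: "c *\<^sub>C (x + y) = c *\<^sub>C x + c *\<^sub>C y"
    and scaleC_add_left: "(c + d) *\<^sub>C x = c *\<^sub>C x + d *\<^sub>C x"
    and scaleC_scaleC: "c *\<^sub>C d *\<^sub>C x = (c * d) *\<^sub>C x"
    and scaleC_of_real: "complex_of_real r *\<^sub>C x = r *\<^sub>R x"

global_interpretation complex_vector:
  vector_space "scaleC :: complex \<Rightarrow> 'a \<Rightarrow> 'a::complex_vector"
proof
  fix x :: 'a
  show "1 *\<^sub>C x = x"
    using scaleC_of_real[of 1 x] by simp
qed (simp_all add: scaleC_add_right scaleC_add_left scaleC_scaleC)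

text \<open>The inner product is linear in its first argument.\<close>

class complex_hilbert_space = complex_vector + banach +
  fixes cinner :: "'a \<Rightarrow> 'a \<Rightarrow> complex"
  assumes cinner_commute: "cinner x y = cnj (cinner y x)"
    and cinner_add_left: "cinner (x + y) z = cinner x z + cinner y z"
    and cinner_scaleC_left: "cinner (c *\<^sub>C x) y = c * cinner x y"
    and cinner_self: "cinner x x = complex_of_real ((norm x)\<^sup>2)"

definition bounded_operators :: "('a::complex_hilbert_space \<Rightarrow> 'a) set" where
  "bounded_operators = {T. bounded_linear T \<and> (\<forall>c x. T (c *\<^sub>C x) = c *\<^sub>C T x)}"

definition compact_operators :: "('a::complex_hilbert_space \<Rightarrow> 'a) set" where
  "compact_operators = {T \<in> bounded_operators. compact (closure (T ` cball 0 1))}"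

definition adjoint_operator ::
    "('a::complex_hilbert_space \<Rightarrow> 'a) \<Rightarrow> ('a \<Rightarrow> 'a)" where
  "adjoint_operator X =
     (THE Y. Y \<in> bounded_operators \<and> (\<forall>x y. cinner (X x) y = cinner x (Y y)))"

definition positive_operator :: "('a::complex_hilbert_space \<Rightarrow> 'a) \<Rightarrow> bool" where
  "positive_operator A \<longleftrightarrow>
     A \<in> bounded_operators \<and> (\<forall>x. cinner (A x) x \<in> \<real>\<^sub>\<ge>\<^sub>0)"

text \<open>The modulus \<open>(X* X)\<^sup>1\<^sup>/\<^sup>2\<close>.\<close>

definition modulus_operator ::
    "('a::complex_hilbert_space \<Rightarrow> 'a) \<Rightarrow> ('a \<Rightarrow> 'a)" where
  "modulus_operator X =
     (THE A. positive_operator A \<and> A \<circ> A = adjoint_operator X \<circ> X)"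

definition operator_ideal :: "('a::complex_hilbert_space \<Rightarrow> 'a) set \<Rightarrow> bool" where
  "operator_ideal I \<longleftrightarrow>
     I \<subseteq> bounded_operators \<and> I \<noteq> bounded_operators \<and>
     (\<lambda>_. 0) \<in> I \<and>
     (\<forall>X\<in>I. \<forall>Y\<in>I. (\<lambda>x. X x + Y x) \<in> I) \<and>
     (\<forall>X\<in>I. \<forall>A\<in>bounded_operators. A \<circ> X \<in> I \<and> X \<circ> A \<in> I)"


section \<open>Sequences and singular numbers\<close>

text \<open>
  All sequences and infinite matrices are indexed from \<open>0\<close>, so \<open>\<xi> n\<close> is the
  \<open>(n + 1)\<close>-st term.
\<close>

definition c0_star :: "(nat \<Rightarrow> real) set" where
  "c0_star = {\<xi>. decseq \<xi> \<and> (\<forall>n. 0 \<le> \<xi> n) \<and> \<xi> \<longlonglongrightarrow> 0}"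

text \<open>
  The nonincreasing null sequence in which every \<open>t > 0\<close> occurs exactly \<open>m t\<close> times.
  The value \<open>0\<close> carries no prescribed multiplicity: zeros occur only as a tail, when the
  total multiplicity of the positive values is finite.
\<close>

definition decreasing_list_of :: "(real \<Rightarrow> nat) \<Rightarrow> (nat \<Rightarrow> real)" where
  "decreasing_list_of m = (THE \<xi>. \<xi> \<in> c0_star \<and> (\<forall>t>0. card {n. \<xi> n = t} = m t))"

definition rearrangement :: "(nat \<Rightarrow> real) \<Rightarrow> (nat \<Rightarrow> real)" where
  "rearrangement \<rho> = decreasing_list_of (\<lambda>t. card {n. \<rho> n = t})"

text \<open>
  Meaningful for compact \<open>X\<close> only; the eigenspaces for \<open>t > 0\<close> are then
  finite-dimensional, so the convention that \<open>dim\<close> is \<open>0\<close> in infinite dimension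
  does not interfere.
\<close>

definition singular_numbers ::
    "('a::complex_hilbert_space \<Rightarrow> 'a) \<Rightarrow> (nat \<Rightarrow> real)" where
  "singular_numbers X = decreasing_list_of
     (\<lambda>t. complex_vector.dim {x. modulus_operator X x = complex_of_real t *\<^sub>C x})"

definition characteristic_set ::
    "('a::complex_hilbert_space \<Rightarrow> 'a) set \<Rightarrow> (nat \<Rightarrow> real) set" where
  "characteristic_set I = singular_numbers ` I"

text \<open>The inverse of the correspondence \<open>I \<mapsto> characteristic_set I\<close>.\<close>

definition ideal_of_characteristic_set ::
    "(nat \<Rightarrow> real) set \<Rightarrow> ('a::complex_hilbert_space \<Rightarrow> 'a) set" where
  "ideal_of_characteristic_set S = {X \<in> compact_operators. singular_numbers X \<in> S}"

definition trace_class :: "('a::complex_hilbert_space \<Rightarrow> 'a) set" where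
  "trace_class = {X \<in> compact_operators. summable (singular_numbers X)}"


section \<open>Arithmetic mean ideals\<close>

definition arith_mean :: "(nat \<Rightarrow> real) \<Rightarrow> (nat \<Rightarrow> real)" where
  "arith_mean \<xi> = (\<lambda>n. (\<Sum>j\<le>n. \<xi> j) / real (n + 1))"

text \<open>The ideal \<open>\<^sub>aI\<close>.\<close>

definition pre_am_ideal ::
    "('a::complex_hilbert_space \<Rightarrow> 'a) set \<Rightarrow> ('a \<Rightarrow> 'a) set" where
  "pre_am_ideal I = ideal_of_characteristic_set
     {\<xi> \<in> c0_star. arith_mean \<xi> \<in> characteristic_set I}"

text \<open>
  The ideal \<open>I\<^sub>a\<close>. The bound is required for all \<open>n\<close>, not just eventually; this
  matters only for \<open>\<eta> = 0\<close>.
\<close>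

definition am_ideal ::
    "('a::complex_hilbert_space \<Rightarrow> 'a) set \<Rightarrow> ('a \<Rightarrow> 'a) set" where
  "am_ideal I = ideal_of_characteristic_set
     {\<xi> \<in> c0_star. \<exists>\<eta>\<in>characteristic_set I. \<exists>C. \<forall>n. \<xi> n \<le> C * arith_mean \<eta> n}"

definition am_closure ::
    "('a::complex_hilbert_space \<Rightarrow> 'a) set \<Rightarrow> ('a \<Rightarrow> 'a) set" where
  "am_closure I = pre_am_ideal (am_ideal I)"

definition am_closed :: "('a::complex_hilbert_space \<Rightarrow> 'a) set \<Rightarrow> bool" where
  "am_closed I \<longleftrightarrow> I = am_closure I"


section \<open>Stochastic matrices\<close>

type_synonym 'b inf_matrix = "nat \<Rightarrow> nat \<Rightarrow> 'b"

definition mat_apply :: "real inf_matrix \<Rightarrow> (nat \<Rightarrow> real) \<Rightarrow> (nat \<Rightarrow> real)" where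
  "mat_apply P \<rho> = (\<lambda>i. \<Sum>j. P i j * \<rho> j)"

definition substochastic :: "real inf_matrix \<Rightarrow> bool" where
  "substochastic P \<longleftrightarrow>
     (\<forall>i j. 0 \<le> P i j) \<and>
     (\<forall>i. summable (\<lambda>j. P i j) \<and> (\<Sum>j. P i j) \<le> 1) \<and>
     (\<forall>j. summable (\<lambda>i. P i j) \<and> (\<Sum>i. P i j) \<le> 1)"

text \<open>
  The restriction of \<open>U\<close> to \<open>A \<times> A\<close> is unitary. For finite \<open>A\<close> the
  \<open>has_sum\<close> conditions are finite sums.
\<close>

definition unitary_on :: "nat set \<Rightarrow> complex inf_matrix \<Rightarrow> bool" where
  "unitary_on A U \<longleftrightarrow>
     (\<forall>i\<in>A. \<forall>j\<in>A.
        ((\<lambda>k. U i k * cnj (U j k)) has_sum (if i = j then 1 else 0)) A \<and>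
        ((\<lambda>k. cnj (U k i) * U k j) has_sum (if i = j then 1 else 0)) A)"

definition orthogonal_on :: "nat set \<Rightarrow> real inf_matrix \<Rightarrow> bool" where
  "orthogonal_on A U \<longleftrightarrow> unitary_on A (\<lambda>i j. complex_of_real (U i j))"

definition orthostochastic :: "real inf_matrix \<Rightarrow> bool" where
  "orthostochastic Q \<longleftrightarrow>
     (\<exists>U. orthogonal_on UNIV U \<and> (\<forall>i j. Q i j = (U i j)\<^sup>2))"

text \<open>The \<open>k\<close>-th block of the direct sum occupies the indices \<open>b k, \<dots>, b (k + 1) - 1\<close>.\<close>

definition direct_sum_of_finite_orthogonal :: "real inf_matrix \<Rightarrow> bool" where
  "direct_sum_of_finite_orthogonal U \<longleftrightarrow>
     (\<exists>b :: nat \<Rightarrow> nat. b 0 = 0 \<and> strict_mono b \<and>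
        (\<forall>k. orthogonal_on {b k..<b (Suc k)} U) \<and>
        (\<forall>k l. k \<noteq> l \<longrightarrow>
           (\<forall>i\<in>{b k..<b (Suc k)}. \<forall>j\<in>{b l..<b (Suc l)}. U i j = 0)))"

definition block_orthostochastic :: "real inf_matrix \<Rightarrow> bool" where
  "block_orthostochastic Q \<longleftrightarrow>
     (\<exists>U. direct_sum_of_finite_orthogonal U \<and> (\<forall>i j. Q i j = (U i j)\<^sup>2))"

definition invariant_under ::
    "('a::complex_hilbert_space \<Rightarrow> 'a) set \<Rightarrow> real inf_matrix set \<Rightarrow> bool" where
  "invariant_under I \<P> \<longleftrightarrow>
     (\<forall>P\<in>\<P>. \<forall>\<xi>\<in>characteristic_set I.
        rearrangement (mat_apply P \<xi>) \<in> characteristic_set I)"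

end

theory Submission
  imports Defs
begin

text \<open>
  Compact operators have Schmidt expansions \<open>\<Sum>n. s n \<langle>\<cdot>, e n\<rangle> f n\<close>, and \<open>s\<close> is then the
  sequence of singular numbers. This reduces everything to a solid cone \<open>S\<close> of sequences that is closed under
  ampliation.

  Substochastic matrices do not increase sums of the largest entries, hence am-closed ideals are
  invariant. Conversely, an orthostochastic matrix with first column \<open>\<xi> / \<Sum>\<xi>\<close> maps a rank one
  sequence to a multiple of the summable sequence \<open>\<xi>\<close>. Now let \<open>\<xi>\<close> be weakly majorized by a nonsummable
  \<open>\<eta> \<in> S\<close>, and choose blocks of indices on which the partial sums of \<open>\<eta>\<close> at least double. Then each
  block of \<open>\<xi>\<close> is weakly majorized by three times \<open>\<eta>\<close> restricted to this block and its predecessor,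
  and Horn's theorem yields a finite orthogonal matrix that realises the domination. Treating even
  and odd blocks separately, \<open>\<xi>\<close> is dominated by means of two block orthostochastic matrices.
\<close>

subsection \<open>Inner products and bounded operators\<close>

text \<open>Singular numbers are defined through descriptions of an adjoint, a square root and a
  list of eigenvalues, none of which is known to exist beforehand. A Schmidt expansion exhibits all
  three at once, so no spectral theorem is invoked. The trace class in condition (iii) has a reason:
  a block orthogonal matrix maps finitely supported sequences to finitely supported ones, so the
  finite rank operators have this invariance without being am-closed. Correspondingly, the doubling
  of partial sums is available for nonsummable \<eta>, and the trace class settles the summable
  case. For nonsummable \<eta> the obstacle is that majorization compares sums from the start: mass
  of \<eta> lying before a block can be spent by \<xi> inside it, so a block of \<xi> need not be
  majorized by the same block of \<eta>. Doubling bounds this earlier mass by that of the preceding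
  block, which is why a window reaches one block back. Overlapping windows are separated by parity,
  and the twofold multiplicity that this causes is absorbed by an ampliation.\<close>

lemma cinner_add_right: "cinner x (y + z) = cinner x y + cinner x z"
  by (metis cinner_commute cinner_add_left complex_cnj_add)

lemma cinner_scaleC_right: "cinner x (c *\<^sub>C y) = cnj c * cinner x y"
  by (metis cinner_commute cinner_scaleC_left complex_cnj_mult)

lemma cinner_scaleR_left: "cinner (r *\<^sub>R x) y = complex_of_real r * cinner x y"
  using cinner_scaleC_left[of "complex_of_real r" x y] by (simp add: scaleC_of_real)

lemma cinner_scaleR_right: "cinner x (r *\<^sub>R y) = complex_of_real r * cinner x y"
  using cinner_scaleC_right[of x "complex_of_real r" y] by (simp add: scaleC_of_real)

lemma cinner_zero_left [simp]: "cinner 0 y = 0"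
  using cinner_scaleR_left[of 0 0 y] by simp

lemma cinner_zero_right [simp]: "cinner x 0 = 0"
  using cinner_scaleR_right[of x 0 0] by simp

lemma cinner_diff_left: "cinner (x - y) z = cinner x z - cinner y z"
  using cinner_add_left[of "x - y" y z] by simp

lemma cinner_diff_right: "cinner x (y - z) = cinner x y - cinner x z"
  using cinner_add_right[of x "y - z" z] by simp

lemma cinner_minus_left: "cinner (- x) z = - cinner x z"
  using cinner_diff_left[of 0 x z] by simp

lemma cinner_sum_left: "cinner (\<Sum>i\<in>A. g i) y = (\<Sum>i\<in>A. cinner (g i) y)"
  by (induction A rule: infinite_finite_induct) (simp_all add: cinner_add_left)

lemma cinner_sum_right: "cinner y (\<Sum>i\<in>A. g i) = (\<Sum>i\<in>A. cinner y (g i))"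
  by (induction A rule: infinite_finite_induct) (simp_all add: cinner_add_right)

lemma cinner_eq_zero_commute: "cinner x y = 0 \<longleftrightarrow> cinner y x = 0"
  by (metis cinner_commute complex_cnj_zero)

lemma Re_cinner_commute: "Re (cinner y x) = Re (cinner x y)"
  using arg_cong[OF cinner_commute[of y x], of Re] by simp

lemma Re_cinner_self: "Re (cinner x x) = (norm x)\<^sup>2"
  by (simp add: cinner_self)

lemma cinner_self_eq_zero: "cinner x x = 0 \<longleftrightarrow> x = 0"
  by (simp add: cinner_self)

text \<open>The class provides only a real normed space; complex homogeneity of the norm has to come
  from \<open>cinner_self\<close>.\<close>

lemma norm_scaleC: "norm (c *\<^sub>C x) = cmod c * norm (x :: 'a::complex_hilbert_space)"
proof -
  have "complex_of_real ((norm (c *\<^sub>C x))\<^sup>2) = c * cnj c * complex_of_real ((norm x)\<^sup>2)"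
    unfolding cinner_self[symmetric] by (simp add: cinner_scaleC_left cinner_scaleC_right)
  also have "\<dots> = complex_of_real ((cmod c * norm x)\<^sup>2)"
    by (simp only: complex_norm_square power_mult_distrib of_real_mult)
  finally have "(norm (c *\<^sub>C x))\<^sup>2 = (cmod c * norm x)\<^sup>2"
    using of_real_eq_iff by blast
  then show ?thesis by (simp add: power2_eq_iff_nonneg)
qed

lemma norm_add_square:
  "(norm (x + y))\<^sup>2 = (norm x)\<^sup>2 + (norm y)\<^sup>2 + 2 * Re (cinner x y)"
  for x :: "'a::complex_hilbert_space"
proof -
  have "(norm (x + y))\<^sup>2 = Re (cinner (x + y) (x + y))"
    by (simp add: Re_cinner_self)
  also have "\<dots> = (norm x)\<^sup>2 + (norm y)\<^sup>2 + 2 * Re (cinner x y)"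
    by (simp add: cinner_add_left cinner_add_right Re_cinner_self Re_cinner_commute[of y x])
  finally show ?thesis .
qed

lemma norm_diff_square:
  "(norm (x - y))\<^sup>2 = (norm x)\<^sup>2 + (norm y)\<^sup>2 - 2 * Re (cinner x y)"
  for x :: "'a::complex_hilbert_space"
proof -
  have "cinner x (- y) = - cinner x y" using cinner_diff_right[of x 0 y] by simp
  then show ?thesis using norm_add_square[of x "- y"] by simp
qed

lemma cinner_cauchy_schwarz: "cmod (cinner x y) \<le> norm x * norm y"
proof (cases "y = 0")
  case False
  define a where "a = cinner x y / complex_of_real ((norm y)\<^sup>2)"
  have ny: "norm y > 0" using False by simp
  have "Re (cinner x (a *\<^sub>C y)) = (cmod (cinner x y))\<^sup>2 / (norm y)\<^sup>2"
  proof -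
    have "cinner x (a *\<^sub>C y) = cinner x y * cnj (cinner x y) / complex_of_real ((norm y)\<^sup>2)"
      by (simp add: a_def cinner_scaleC_right)
    also have "\<dots> = complex_of_real ((cmod (cinner x y))\<^sup>2 / (norm y)\<^sup>2)"
      by (simp add: complex_norm_square[symmetric])
    finally show ?thesis by (metis Re_complex_of_real)
  qed
  moreover have "(norm (a *\<^sub>C y))\<^sup>2 = (cmod (cinner x y))\<^sup>2 / (norm y)\<^sup>2"
    using ny by (simp add: norm_scaleC a_def norm_divide norm_mult power_mult_distrib
        power_divide power2_eq_square)
  ultimately have "(norm (x - a *\<^sub>C y))\<^sup>2 = (norm x)\<^sup>2 - (cmod (cinner x y))\<^sup>2 / (norm y)\<^sup>2"
    by (simp add: norm_diff_square)
  then have "(cmod (cinner x y))\<^sup>2 / (norm y)\<^sup>2 \<le> (norm x)\<^sup>2"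
    using zero_le_power2[of "norm (x - a *\<^sub>C y)"] by linarith
  then have "(cmod (cinner x y))\<^sup>2 \<le> (norm x * norm y)\<^sup>2"
    using ny by (simp add: divide_simps power_mult_distrib)
  then show ?thesis by (rule power2_le_imp_le) simp
qed simp

lemma bounded_linear_cinner_left: "bounded_linear (\<lambda>x. cinner x y)"
proof (rule bounded_linear_intro[where K = "norm y"])
  show "cinner (r *\<^sub>R x) y = r *\<^sub>R cinner x y" for r x
    by (simp add: cinner_scaleR_left scaleR_conv_of_real)
qed (auto simp: cinner_add_left cinner_cauchy_schwarz)

lemma bounded_linear_cinner_right: "bounded_linear (\<lambda>y. cinner x y)"
proof (rule bounded_linear_intro[where K = "norm x"])
  show "cinner x (r *\<^sub>R y) = r *\<^sub>R cinner x y" for r y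
    by (simp add: cinner_scaleR_right scaleR_conv_of_real)
  show "cmod (cinner x y) \<le> norm y * norm x" for y
    using cinner_cauchy_schwarz[of x y] by (simp add: mult.commute)
qed (auto simp: cinner_add_right)

lemma bounded_linear_scaleC: "bounded_linear (\<lambda>x::'a::complex_hilbert_space. c *\<^sub>C x)"
proof (rule bounded_linear_intro[where K = "cmod c"])
  show "c *\<^sub>C (r *\<^sub>R x) = r *\<^sub>R (c *\<^sub>C x)" for r and x :: 'a
    by (simp add: scaleC_of_real[symmetric] scaleC_scaleC mult.commute)
qed (auto simp: scaleC_add_right norm_scaleC mult.commute)

lemma bounded_operatorsD:
  assumes "T \<in> bounded_operators"
  shows "bounded_linear T" "T (c *\<^sub>C x) = c *\<^sub>C T x"
  using assms by (auto simp: bounded_operators_def)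

subsection \<open>Orthogonal families and Schmidt expansions\<close>

text \<open>Norms below \<open>1\<close> are admitted so that vectors belonging to the singular number \<open>0\<close> may vanish.\<close>

definition orth_family :: "(nat \<Rightarrow> 'a::complex_hilbert_space) \<Rightarrow> bool" where
  "orth_family e \<longleftrightarrow> (\<forall>m n. m \<noteq> n \<longrightarrow> cinner (e m) (e n) = 0) \<and> (\<forall>n. norm (e n) \<le> 1)"

lemma orth_familyD:
  assumes "orth_family e"
  shows "m \<noteq> n \<Longrightarrow> cinner (e m) (e n) = 0" "norm (e n) \<le> 1"
  using assms by (auto simp: orth_family_def)

lemma orth_family_cinner:
  assumes "orth_family e"
  shows "cinner (e m) (e n) = (if m = n then complex_of_real ((norm (e n))\<^sup>2) else 0)"
  using assms by (auto simp: orth_family_def cinner_self)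

lemma orth_family_sum_bound:
  assumes "orth_family e" "finite A"
  shows "(norm (\<Sum>n\<in>A. c n *\<^sub>C e n))\<^sup>2 \<le> (\<Sum>n\<in>A. (cmod (c n))\<^sup>2)"
  using \<open>finite A\<close>
proof (induction A rule: finite_induct)
  case (insert m A)
  have "cinner (e m) (e n) = 0" if "n \<in> A" for n
    using insert(2) that orth_familyD(1)[OF assms(1), of m n] by blast
  then have "cinner (c m *\<^sub>C e m) (\<Sum>n\<in>A. c n *\<^sub>C e n) = 0"
    by (auto simp: cinner_sum_right cinner_scaleC_left cinner_scaleC_right intro!: sum.neutral)
  moreover have "(norm (c m *\<^sub>C e m))\<^sup>2 \<le> (cmod (c m))\<^sup>2"
    using orth_familyD(2)[OF assms(1), of m]
    by (intro power_mono) (simp_all add: norm_scaleC mult_left_le)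
  ultimately show ?case using insert by (simp add: norm_add_square add_mono)
qed simp

text \<open>In the expansion of the squared norm of \<open>x - ?v\<close> the cross term removes the
  sum twice, and the squared norm of \<open>?v\<close> restores it at most once; vectors shorter
  than 1 do no harm.\<close>

lemma bessel_finite:
  assumes "orth_family e"
  shows "(\<Sum>n<N. (cmod (cinner x (e n)))\<^sup>2) \<le> (norm x)\<^sup>2"
proof -
  let ?v = "\<Sum>n<N. cinner x (e n) *\<^sub>C e n"
  have "cinner x ?v = (\<Sum>n<N. complex_of_real ((cmod (cinner x (e n)))\<^sup>2))"
    by (simp add: cinner_sum_right cinner_scaleC_right complex_norm_square[symmetric]
        mult.commute[of "cnj _"] del: of_real_power)
  then have "Re (cinner x ?v) = (\<Sum>n<N. (cmod (cinner x (e n)))\<^sup>2)"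
    by simp
  then have "(norm (x - ?v))\<^sup>2 \<le> (norm x)\<^sup>2 - (\<Sum>n<N. (cmod (cinner x (e n)))\<^sup>2)"
    using orth_family_sum_bound[OF assms, of "{..<N}" "\<lambda>n. cinner x (e n)"]
    by (simp add: norm_diff_square)
  then show ?thesis using zero_le_power2[of "norm (x - ?v)"] by linarith
qed

lemma bessel:
  assumes "orth_family e"
  shows "summable (\<lambda>n. (cmod (cinner x (e n)))\<^sup>2)"
    and "(\<Sum>n. (cmod (cinner x (e n)))\<^sup>2) \<le> (norm x)\<^sup>2"
proof -
  show s: "summable (\<lambda>n. (cmod (cinner x (e n)))\<^sup>2)"
    by (rule summableI_nonneg_bounded[OF _ bessel_finite[OF assms]]) simp
  show "(\<Sum>n. (cmod (cinner x (e n)))\<^sup>2) \<le> (norm x)\<^sup>2"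
    by (rule suminf_le_const[OF s bessel_finite[OF assms]])
qed

lemma orth_family_summable:
  assumes "orth_family e" "summable (\<lambda>n. (cmod (c n))\<^sup>2)"
  shows "summable (\<lambda>n. c n *\<^sub>C e n)"
  unfolding summable_Cauchy
proof (intro allI impI)
  fix \<epsilon> :: real assume "\<epsilon> > 0"
  then have "\<epsilon>\<^sup>2 > 0" by simp
  then obtain N where N: "\<And>m n. m \<ge> N \<Longrightarrow> norm (\<Sum>i=m..<n. (cmod (c i))\<^sup>2) < \<epsilon>\<^sup>2"
    using assms(2) unfolding summable_Cauchy by blast
  have "norm (\<Sum>i=m..<n. c i *\<^sub>C e i) < \<epsilon>" if "m \<ge> N" for m n
  proof -
    have "(norm (\<Sum>i=m..<n. c i *\<^sub>C e i))\<^sup>2 \<le> (\<Sum>i=m..<n. (cmod (c i))\<^sup>2)"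
      using orth_family_sum_bound[OF assms(1)] by simp
    also have "\<dots> < \<epsilon>\<^sup>2" using N[OF that, of n] by (simp add: sum_nonneg)
    finally show ?thesis using \<open>\<epsilon> > 0\<close> by (simp add: power_less_imp_less_base)
  qed
  then show "\<exists>N. \<forall>m\<ge>N. \<forall>n. norm (\<Sum>i=m..<n. c i *\<^sub>C e i) < \<epsilon>" by blast
qed

lemma orth_family_suminf_bound:
  assumes "orth_family e" "summable (\<lambda>n. (cmod (c n))\<^sup>2)"
  shows "(norm (\<Sum>n. c n *\<^sub>C e n))\<^sup>2 \<le> (\<Sum>n. (cmod (c n))\<^sup>2)"
proof (rule LIMSEQ_le)
  show "(\<lambda>N. (norm (\<Sum>n<N. c n *\<^sub>C e n))\<^sup>2) \<longlonglongrightarrow> (norm (\<Sum>n. c n *\<^sub>C e n))\<^sup>2"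
    by (intro tendsto_intros summable_LIMSEQ orth_family_summable assms)
  show "(\<lambda>N. \<Sum>n<N. (cmod (c n))\<^sup>2) \<longlonglongrightarrow> (\<Sum>n. (cmod (c n))\<^sup>2)"
    by (intro summable_LIMSEQ assms)
  show "\<exists>N. \<forall>n\<ge>N. (norm (\<Sum>n<n. c n *\<^sub>C e n))\<^sup>2 \<le> (\<Sum>n<n. (cmod (c n))\<^sup>2)"
    using orth_family_sum_bound[OF assms(1)] by auto
qed

text \<open>Neither monotonicity nor signs are asked of \<open>s\<close>: with bounded weights the
  same series also yields projections, contractions between families and inverses on a range, which
  serve as multipliers in the ideal.\<close>

definition schmidt ::
  "(nat \<Rightarrow> real) \<Rightarrow> (nat \<Rightarrow> 'a::complex_hilbert_space) \<Rightarrow> (nat \<Rightarrow> 'a) \<Rightarrow> 'a \<Rightarrow> 'a" where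
  "schmidt s e f x = (\<Sum>n. (complex_of_real (s n) * cinner x (e n)) *\<^sub>C f n)"

lemma schmidt_coeff_summable:
  assumes "orth_family e" "\<forall>n. \<bar>s n\<bar> \<le> M"
  shows "summable (\<lambda>n. (cmod (complex_of_real (s n) * cinner x (e n)))\<^sup>2)"
    and "(\<Sum>n. (cmod (complex_of_real (s n) * cinner x (e n)))\<^sup>2) \<le> (M * norm x)\<^sup>2"
proof -
  have le: "(cmod (complex_of_real (s n) * cinner x (e n)))\<^sup>2
      \<le> M\<^sup>2 * (cmod (cinner x (e n)))\<^sup>2" for n
    using power_mono[OF spec[OF assms(2), of n], of 2]
    by (auto simp: norm_mult power_mult_distrib intro!: mult_right_mono)
  have S: "summable (\<lambda>n. M\<^sup>2 * (cmod (cinner x (e n)))\<^sup>2)"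
    using bessel(1)[OF assms(1)] by (rule summable_mult)
  show sm: "summable (\<lambda>n. (cmod (complex_of_real (s n) * cinner x (e n)))\<^sup>2)"
    by (rule summable_comparison_test'[OF S, of 0]) (use le in auto)
  have "(\<Sum>n. (cmod (complex_of_real (s n) * cinner x (e n)))\<^sup>2)
      \<le> (\<Sum>n. M\<^sup>2 * (cmod (cinner x (e n)))\<^sup>2)"
    by (rule suminf_le[OF le sm S])
  also have "\<dots> = M\<^sup>2 * (\<Sum>n. (cmod (cinner x (e n)))\<^sup>2)"
    by (rule suminf_mult[OF bessel(1)[OF assms(1)]])
  also have "\<dots> \<le> M\<^sup>2 * (norm x)\<^sup>2"
    using bessel(2)[OF assms(1)] by (intro mult_left_mono) auto
  finally show "(\<Sum>n. (cmod (complex_of_real (s n) * cinner x (e n)))\<^sup>2) \<le> (M * norm x)\<^sup>2"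
    by (simp add: power_mult_distrib)
qed

lemma schmidt_summable:
  assumes "orth_family e" "orth_family f" "\<forall>n. \<bar>s n\<bar> \<le> M"
  shows "summable (\<lambda>n. (complex_of_real (s n) * cinner x (e n)) *\<^sub>C f n)"
  by (rule orth_family_summable[OF assms(2) schmidt_coeff_summable(1)[OF assms(1,3)]])

lemma norm_schmidt_le:
  assumes "orth_family e" "orth_family f" "\<forall>n. \<bar>s n\<bar> \<le> M"
  shows "norm (schmidt s e f x) \<le> M * norm x"
proof -
  have "(norm (schmidt s e f x))\<^sup>2 \<le> (M * norm x)\<^sup>2"
    unfolding schmidt_def
    using orth_family_suminf_bound[OF assms(2) schmidt_coeff_summable(1)[OF assms(1,3)], of x]
      schmidt_coeff_summable(2)[OF assms(1,3), of x] by linarith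
  moreover have "0 \<le> M" using spec[OF assms(3), of 0] by linarith
  ultimately show ?thesis by (metis power2_le_imp_le mult_nonneg_nonneg norm_ge_zero)
qed

lemma schmidt_bounded_operator:
  assumes "orth_family e" "orth_family f" "\<forall>n. \<bar>s n\<bar> \<le> M"
  shows "schmidt s e f \<in> bounded_operators"
proof -
  note sm = schmidt_summable[OF assms]
  have add: "schmidt s e f (x + y) = schmidt s e f x + schmidt s e f y" for x y
    unfolding schmidt_def suminf_add[OF sm sm]
    by (simp add: cinner_add_left distrib_left scaleC_add_left)
  have scale: "schmidt s e f (c *\<^sub>C x) = c *\<^sub>C schmidt s e f x" for c x
    unfolding schmidt_def bounded_linear.suminf[OF bounded_linear_scaleC sm]
    by (simp add: cinner_scaleC_left scaleC_scaleC mult.left_commute)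
  have "bounded_linear (schmidt s e f)"
  proof (rule bounded_linear_intro[where K = M])
    show "schmidt s e f (r *\<^sub>R x) = r *\<^sub>R schmidt s e f x" for r x
      using scale[of "complex_of_real r" x] by (simp add: scaleC_of_real)
    show "norm (schmidt s e f x) \<le> norm x * M" for x
      using norm_schmidt_le[OF assms, where x = x] by (simp add: mult.commute)
  qed (rule add)
  then show ?thesis using scale by (simp add: bounded_operators_def)
qed

lemma cinner_schmidt_sums:
  assumes "orth_family e" "orth_family f" "\<forall>n. \<bar>s n\<bar> \<le> M"
  shows "(\<lambda>n. complex_of_real (s n) * cinner x (e n) * cinner (f n) y)
    sums cinner (schmidt s e f x) y"
  using bounded_linear.sums[OF bounded_linear_cinner_left[of y]
      summable_sums[OF schmidt_summable[OF assms, where x = x]]]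
  by (simp add: schmidt_def cinner_scaleC_left)

lemma cinner_schmidt:
  assumes "orth_family e" "orth_family f" "\<forall>n. \<bar>s n\<bar> \<le> M"
  shows "cinner (schmidt s e f x) (f n)
    = complex_of_real (s n * (norm (f n))\<^sup>2) * cinner x (e n)"
proof -
  have "(\<lambda>m. complex_of_real (s m) * cinner x (e m) * cinner (f m) (f n))
      = (\<lambda>m. if m = n then complex_of_real (s n * (norm (f n))\<^sup>2) * cinner x (e n) else 0)"
    using orth_family_cinner[OF assms(2)] by auto
  then have "(\<lambda>m. complex_of_real (s m) * cinner x (e m) * cinner (f m) (f n))
      sums (complex_of_real (s n * (norm (f n))\<^sup>2) * cinner x (e n))"
    using sums_single[of n "\<lambda>_. complex_of_real (s n * (norm (f n))\<^sup>2) * cinner x (e n)"]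
    by (simp only:)
  from sums_unique2[OF cinner_schmidt_sums[OF assms, where x = x and y = "f n"] this]
  show ?thesis .
qed

lemma cinner_schmidt_swap:
  assumes "orth_family e" "orth_family f" "\<forall>n. \<bar>s n\<bar> \<le> M"
  shows "cinner (schmidt s e f x) y = cinner x (schmidt s f e y)"
proof -
  have "(\<lambda>n. cnj (complex_of_real (s n) * cinner y (f n) * cinner (e n) x))
      sums cnj (cinner (schmidt s f e y) x)"
    using cinner_schmidt_sums[OF assms(2,1,3), where x = y and y = x] by (simp add: sums_cnj del: complex_cnj_mult)
  moreover have "cnj (complex_of_real (s n) * cinner y (f n) * cinner (e n) x)
      = complex_of_real (s n) * cinner x (e n) * cinner (f n) y" for n
    using cinner_commute[of x "e n"] cinner_commute[of "f n" y] by simp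
  ultimately have "(\<lambda>n. complex_of_real (s n) * cinner x (e n) * cinner (f n) y)
      sums cnj (cinner (schmidt s f e y) x)"
    by (simp only:)
  from sums_unique2[OF cinner_schmidt_sums[OF assms, where x = x and y = y] this]
  have "cinner (schmidt s e f x) y = cnj (cinner (schmidt s f e y) x)" .
  then show ?thesis using cinner_commute[of x "schmidt s f e y"] by simp
qed

text \<open>Only the diagonal terms survive, by orthogonality of \<open>f\<close>; the factor
  \<open>(norm (f n))\<^sup>2\<close> remains because \<open>f n\<close> may be shorter than
  1.\<close>

lemma schmidt_compose:
  assumes "orth_family e" "orth_family f" "\<forall>n. \<bar>s n\<bar> \<le> M"
  shows "schmidt t f g \<circ> schmidt s e f = schmidt (\<lambda>n. t n * s n * (norm (f n))\<^sup>2) e g"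
proof
  fix x
  show "(schmidt t f g \<circ> schmidt s e f) x = schmidt (\<lambda>n. t n * s n * (norm (f n))\<^sup>2) e g x"
    unfolding o_def schmidt_def[of t f g "schmidt s e f x"] cinner_schmidt[OF assms]
      schmidt_def[of "\<lambda>n. t n * s n * (norm (f n))\<^sup>2" e g x]
    by (simp add: mult.assoc)
qed

lemma bounded_operator_schmidt:
  assumes "X \<in> bounded_operators" "orth_family e" "orth_family f" "\<forall>n. \<bar>s n\<bar> \<le> M"
  shows "X (schmidt s e f x) = (\<Sum>n. (complex_of_real (s n) * cinner x (e n)) *\<^sub>C X (f n))"
  unfolding schmidt_def
    bounded_linear.suminf[OF bounded_operatorsD(1)[OF assms(1)] schmidt_summable[OF assms(2-4)]]
  by (simp add: bounded_operatorsD(2)[OF assms(1)])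

subsection \<open>Decreasing lists\<close>

lemma c0_starD:
  assumes "\<xi> \<in> c0_star"
  shows "decseq \<xi>" "0 \<le> \<xi> n" "\<xi> \<longlonglongrightarrow> 0"
  using assms by (auto simp: c0_star_def)

lemma c0_star_abs_le: "\<xi> \<in> c0_star \<Longrightarrow> \<bar>\<xi> n\<bar> \<le> \<xi> 0"
  using c0_starD[of \<xi>] by (auto simp: decseq_def)

lemma finite_ge_of_tendsto_zero:
  fixes \<rho> :: "nat \<Rightarrow> real"
  assumes "\<rho> \<longlonglongrightarrow> 0" "t > 0"
  shows "finite {n. t \<le> \<rho> n}"
proof -
  have "eventually (\<lambda>n. \<rho> n < t) sequentially"
    using assms by (rule order_tendstoD)
  then have "finite {n. \<not> \<rho> n < t}"
    by (simp add: cofinite_eq_sequentially[symmetric] eventually_cofinite)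
  then show ?thesis by (simp add: not_less)
qed

text \<open>The set \<open>V\<close> may exceed the set of attained values, so that one
  \<open>V\<close> can serve two sequences that are to be compared.\<close>

lemma card_ge_eq_sum_card:
  fixes \<rho> :: "nat \<Rightarrow> real"
  assumes "finite V" "finite {n. u \<le> \<rho> n}" "\<rho> ` {n. u \<le> \<rho> n} \<subseteq> V" "\<And>v. v \<in> V \<Longrightarrow> u \<le> v"
  shows "card {n. u \<le> \<rho> n} = (\<Sum>v\<in>V. card {n. \<rho> n = v})"
proof -
  have "{n. u \<le> \<rho> n} = (\<Union>v\<in>V. {n. \<rho> n = v})" using assms(3,4) by auto
  moreover have "card (\<Union>v\<in>V. {n. \<rho> n = v}) = (\<Sum>v\<in>V. card {n. \<rho> n = v})"
  proof (rule card_UN_disjoint[OF assms(1)])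
    show "\<forall>v\<in>V. finite {n. \<rho> n = v}"
      using assms(4) by (auto intro!: finite_subset[OF _ assms(2)])
  qed auto
  ultimately show ?thesis by simp
qed

text \<open>If \<eta> lies below u = \<xi> n at index n, then \<xi> has at least n + 1 entries that
  are at least u and \<eta> has at most n, while equal multiplicities make these counts agree. Used
  in both directions, this gives uniqueness of the decreasing list.\<close>

lemma c0_star_le_of_card_eq:
  assumes "\<xi> \<in> c0_star" "\<eta> \<in> c0_star"
    and eq: "\<And>t. t > 0 \<Longrightarrow> card {n. \<xi> n = t} = card {n. \<eta> n = t}"
  shows "\<xi> n \<le> \<eta> n"
proof (rule ccontr)
  assume "\<not> \<xi> n \<le> \<eta> n"
  then have less: "\<eta> n < \<xi> n" by simp
  define u where "u = \<xi> n"
  have u: "u > 0" using less c0_starD(2)[OF assms(2), of n] by (simp add: u_def)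
  have fin: "finite {k. u \<le> \<xi> k}" "finite {k. u \<le> \<eta> k}"
    using finite_ge_of_tendsto_zero u c0_starD(3) assms(1,2) by blast+
  define V where "V = \<xi> ` {k. u \<le> \<xi> k} \<union> \<eta> ` {k. u \<le> \<eta> k}"
  have V: "finite V" "\<And>v. v \<in> V \<Longrightarrow> u \<le> v" using fin by (auto simp: V_def)
  have "card {k. u \<le> \<xi> k} = (\<Sum>v\<in>V. card {n. \<xi> n = v})"
    by (rule card_ge_eq_sum_card[OF V(1) fin(1) _ V(2)]) (auto simp: V_def)
  also have "\<dots> = (\<Sum>v\<in>V. card {n. \<eta> n = v})"
    using V(2) u by (intro sum.cong refl eq) force
  also have "\<dots> = card {k. u \<le> \<eta> k}"
    by (rule card_ge_eq_sum_card[OF V(1) fin(2) _ V(2), symmetric]) (auto simp: V_def)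
  finally have "card {k. u \<le> \<xi> k} = card {k. u \<le> \<eta> k}" .
  moreover have "{..n} \<subseteq> {k. u \<le> \<xi> k}"
    using c0_starD(1)[OF assms(1)] by (auto simp: u_def decseq_def)
  then have "card {..n} \<le> card {k. u \<le> \<xi> k}" by (rule card_mono[OF fin(1)])
  moreover have "{k. u \<le> \<eta> k} \<subseteq> {..<n}"
  proof
    fix k assume "k \<in> {k. u \<le> \<eta> k}"
    then have "\<eta> n < \<eta> k" using less by (simp add: u_def)
    then show "k \<in> {..<n}"
      using decseqD[OF c0_starD(1)[OF assms(2)], of n k] by (cases "n \<le> k") auto
  qed
  then have "card {k. u \<le> \<eta> k} \<le> card {..<n}" by (intro card_mono) auto
  ultimately show False by simp
qed

lemma decreasing_list_of_eqI:
  assumes "\<xi> \<in> c0_star" "\<And>t. t > 0 \<Longrightarrow> card {n. \<xi> n = t} = m t"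
  shows "decreasing_list_of m = \<xi>"
  unfolding decreasing_list_of_def
proof (rule the_equality)
  show "\<xi> \<in> c0_star \<and> (\<forall>t>0. card {n. \<xi> n = t} = m t)" using assms by auto
  fix \<eta> assume "\<eta> \<in> c0_star \<and> (\<forall>t>0. card {n. \<eta> n = t} = m t)"
  then show "\<eta> = \<xi>"
    using assms by (intro ext order.antisym c0_star_le_of_card_eq) auto
qed

subsection \<open>Singular numbers of Schmidt expansions\<close>

text \<open>Polarization: the defect \<open>q\<close> is a sesquilinear form that vanishes on the
  diagonal, because there it compares a real number with its conjugate.\<close>

lemma positive_operator_selfadjoint:
  assumes "positive_operator A"
  shows "cinner (A x) y = cinner x (A y)"
proof -
  define q where "q x y = cinner (A x) y - cinner x (A y)" for x y
  have A: "A \<in> bounded_operators" using assms by (simp add: positive_operator_def)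
  have add: "A (x + y) = A x + A y" for x y
    using bounded_operatorsD(1)[OF A] by (simp add: linear_simps)
  have q0: "q x x = 0" for x
  proof -
    have "cinner (A x) x \<in> \<real>\<^sub>\<ge>\<^sub>0" using assms by (simp add: positive_operator_def)
    then have "cnj (cinner (A x) x) = cinner (A x) x"
      by (metis nonneg_Reals_subset_Reals subsetD Reals_cnj_iff)
    then show ?thesis using cinner_commute[of x "A x"] by (simp add: q_def)
  qed
  have "q (x + y) (x + y) = q x y + q y x + (q x x + q y y)"
    by (simp add: q_def add cinner_add_left cinner_add_right)
  then have 1: "q x y + q y x = 0" by (simp add: q0)
  \<comment> \<open>The factor \<i> makes \<open>q\<close> symmetric where the previous relation
    makes it antisymmetric; together they force it to vanish.\<close>
  have "q (x + \<i> *\<^sub>C y) (x + \<i> *\<^sub>C y) = - \<i> * q x y + \<i> * q y x + (q x x + q y y)"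
    by (simp add: q_def add bounded_operatorsD(2)[OF A] cinner_add_left cinner_add_right
        cinner_scaleC_left cinner_scaleC_right algebra_simps)
  then have "\<i> * (q y x - q x y) = 0" by (simp add: q0 algebra_simps)
  then have "q y x = q x y" by simp
  with 1 have "q x y = 0" by simp
  then show ?thesis by (simp add: q_def)
qed

lemma schmidt_at:
  assumes "orth_family e"
  shows "schmidt s e f (e n) = complex_of_real (s n * (norm (e n))\<^sup>2) *\<^sub>C f n"
proof -
  have "(\<lambda>m. (complex_of_real (s m) * cinner (e n) (e m)) *\<^sub>C f m)
      = (\<lambda>m. if m = n then complex_of_real (s n * (norm (e n))\<^sup>2) *\<^sub>C f n else 0)"
    using orth_family_cinner[OF assms] by (auto simp: fun_eq_iff)
  then show ?thesis
    unfolding schmidt_def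
    using sums_unique[OF sums_single[of n "\<lambda>_. complex_of_real (s n * (norm (e n))\<^sup>2) *\<^sub>C f n"]]
    by simp
qed

text \<open>Unit length is demanded only where \<open>s n > 0\<close>. An operator of finite rank
  thus still has sequences indexed by all natural numbers, with \<open>f n\<close> allowed to vanish
  in the tail.\<close>

definition schmidt_system ::
  "(nat \<Rightarrow> real) \<Rightarrow> (nat \<Rightarrow> 'a::complex_hilbert_space) \<Rightarrow> (nat \<Rightarrow> 'a) \<Rightarrow> bool" where
  "schmidt_system s e f \<longleftrightarrow> s \<in> c0_star \<and> orth_family e \<and> orth_family f \<and>
     (\<forall>n. s n > 0 \<longrightarrow> norm (e n) = 1 \<and> norm (f n) = 1)"

lemma schmidt_systemD:
  assumes "schmidt_system s e f"
  shows "s \<in> c0_star" "orth_family e" "orth_family f" "\<forall>n. \<bar>s n\<bar> \<le> s 0"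
    "s n \<noteq> 0 \<Longrightarrow> norm (e n) = 1" "s n \<noteq> 0 \<Longrightarrow> norm (f n) = 1" "0 \<le> s n"
  using assms c0_star_abs_le[of s] c0_starD(2)[of s n]
  by (auto simp: schmidt_system_def order_less_le)

lemma adjoint_schmidt:
  assumes "orth_family e" "orth_family f" "\<forall>n. \<bar>s n\<bar> \<le> M"
  shows "adjoint_operator (schmidt s e f) = schmidt s f e"
  unfolding adjoint_operator_def
proof (rule the_equality)
  show "schmidt s f e \<in> bounded_operators \<and>
      (\<forall>x y. cinner (schmidt s e f x) y = cinner x (schmidt s f e y))"
    using schmidt_bounded_operator[OF assms(2,1,3)] cinner_schmidt_swap[OF assms] by simp
  fix Y assume Y: "Y \<in> bounded_operators \<and> (\<forall>x y. cinner (schmidt s e f x) y = cinner x (Y y))"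
  show "Y = schmidt s f e"
  proof
    fix y
    have "cinner x (Y y - schmidt s f e y) = 0" for x
      using Y cinner_schmidt_swap[OF assms, of x y] by (simp add: cinner_diff_right)
    from this[of "Y y - schmidt s f e y"] show "Y y = schmidt s f e y"
      by (simp add: cinner_self_eq_zero)
  qed
qed

lemma positive_schmidt:
  assumes "orth_family e" "\<forall>n. \<bar>s n\<bar> \<le> M" "\<And>n. 0 \<le> s n"
  shows "positive_operator (schmidt s e e)"
proof -
  have "cinner (schmidt s e e x) x \<in> \<real>\<^sub>\<ge>\<^sub>0" for x
  proof -
    have "(\<lambda>n. complex_of_real (s n) * cinner x (e n) * cinner (e n) x)
        = (\<lambda>n. complex_of_real (s n * (cmod (cinner x (e n)))\<^sup>2))"
      using cinner_commute[of "e _" x]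
      by (auto simp: fun_eq_iff complex_norm_square[symmetric] mult.assoc)
    then have S: "(\<lambda>n. complex_of_real (s n * (cmod (cinner x (e n)))\<^sup>2))
        sums cinner (schmidt s e e x) x"
      using cinner_schmidt_sums[OF assms(1,1,2), where x = x and y = x] by simp
    have R: "(\<lambda>n. s n * (cmod (cinner x (e n)))\<^sup>2) sums Re (cinner (schmidt s e e x) x)"
      using sums_Re[OF S] by simp
    have "0 \<le> Re (cinner (schmidt s e e x) x)"
      by (rule sums_le[OF _ sums_zero R]) (simp add: assms(3))
    moreover have "Im (cinner (schmidt s e e x) x) = 0"
      using sums_Im[OF S] sums_unique[OF sums_zero] sums_unique by force
    ultimately show ?thesis by (simp add: complex_nonneg_Reals_iff)
  qed
  then show ?thesis
    using schmidt_bounded_operator[OF assms(1,1,2)] by (simp add: positive_operator_def)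
qed

text \<open>A functional calculus is avoided. For y = A (e n) - s n e n one has A y = - s n y, and
  positivity of A forces y = 0. On vectors orthogonal to these eigenvectors the square of A is 0,
  hence A is 0 by self-adjointness.\<close>

lemma positive_square_root_schmidt_unique:
  assumes A: "positive_operator A"
    and e: "orth_family e" and s: "\<forall>n. \<bar>s n\<bar> \<le> M" "\<And>n. 0 \<le> s n"
      "\<And>n. s n \<noteq> 0 \<Longrightarrow> norm (e n) = 1"
    and sq: "A \<circ> A = schmidt (\<lambda>n. (s n)\<^sup>2) e e"
  shows "A = schmidt s e e"
proof
  fix x
  have bA: "A \<in> bounded_operators" using A by (simp add: positive_operator_def)
  note lin = linear_simps[OF bounded_operatorsD(1)[OF bA]]
  have AA: "A (A z) = schmidt (\<lambda>n. (s n)\<^sup>2) e e z" for z using sq by (metis comp_apply)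
  have eig: "A (e n) = complex_of_real (s n) *\<^sub>C e n" if "s n \<noteq> 0" for n
  proof -
    define y where "y = A (e n) - complex_of_real (s n) *\<^sub>C e n"
    have "A (A (e n)) = complex_of_real ((s n)\<^sup>2) *\<^sub>C e n"
      using s(3)[OF that] by (simp add: AA schmidt_at[OF e])
    then have "A y = - (complex_of_real (s n) *\<^sub>C y)"
      by (simp add: y_def lin bounded_operatorsD(2)[OF bA] complex_vector.scale_right_diff_distrib
          scaleC_scaleC power2_eq_square)
    then have "cinner (A y) y = complex_of_real (- (s n * (norm y)\<^sup>2))"
      by (simp add: cinner_minus_left cinner_scaleC_left cinner_self)
    moreover have "cinner (A y) y \<in> \<real>\<^sub>\<ge>\<^sub>0" using A by (simp add: positive_operator_def)
    ultimately have "s n * (norm y)\<^sup>2 \<le> 0"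
      by (simp only: nonneg_Reals_of_real_iff)
    moreover have "s n > 0" using that s(2)[of n] by simp
    ultimately have "y = 0" by (simp add: mult_le_0_iff)
    then show ?thesis by (simp add: y_def)
  qed
  \<comment> \<open>\<open>schmidt \<theta> e e\<close> is the projection onto the closed span of
    the \<open>e n\<close> with \<open>s n \<noteq> 0\<close>, so \<open>r\<close> below is the
    component on which A must vanish.\<close>
  define \<theta> :: "nat \<Rightarrow> real" where "\<theta> n = (if s n = 0 then 0 else 1)" for n
  have \<theta>: "\<forall>n. \<bar>\<theta> n\<bar> \<le> 1" by (simp add: \<theta>_def)
  define r where "r = x - schmidt \<theta> e e x"
  have "cinner r (e n) = 0" if "s n \<noteq> 0" for n
    using that s(3)[OF that]
    by (simp add: r_def cinner_diff_left cinner_schmidt[OF e e \<theta>]) (simp add: \<theta>_def)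
  then have "(\<lambda>n. (complex_of_real ((s n)\<^sup>2) * cinner r (e n)) *\<^sub>C e n) = (\<lambda>_. 0)"
    by (auto simp: fun_eq_iff)
  then have "A (A r) = 0" by (simp add: AA schmidt_def)
  then have "cinner (A r) (A r) = 0"
    using positive_operator_selfadjoint[OF A, of "A r" r] by simp
  then have "A r = 0" by (simp add: cinner_self_eq_zero)
  then have "A x = A (schmidt \<theta> e e x)"
    by (simp add: r_def lin)
  also have "\<dots> = (\<Sum>n. (complex_of_real (\<theta> n) * cinner x (e n)) *\<^sub>C A (e n))"
    by (rule bounded_operator_schmidt[OF bA e e \<theta>])
  also have "(\<lambda>n. (complex_of_real (\<theta> n) * cinner x (e n)) *\<^sub>C A (e n))
      = (\<lambda>n. (complex_of_real (s n) * cinner x (e n)) *\<^sub>C e n)"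
    by (auto simp: fun_eq_iff \<theta>_def eig scaleC_scaleC mult.commute)
  finally show "A x = schmidt s e e x" by (simp add: schmidt_def)
qed

lemma modulus_schmidt:
  assumes "schmidt_system s e f"
  shows "modulus_operator (schmidt s e f) = schmidt s e e"
proof -
  note D = schmidt_systemD[OF assms]
  have eq: "adjoint_operator (schmidt s e f) \<circ> schmidt s e f = schmidt (\<lambda>n. (s n)\<^sup>2) e e"
    unfolding adjoint_schmidt[OF D(2,3,4)] schmidt_compose[OF D(2,3,4)]
    by (rule arg_cong[of _ _ "\<lambda>s. schmidt s e e"]) (use D(6) in \<open>force simp: power2_eq_square\<close>)
  have eq': "schmidt s e e \<circ> schmidt s e e = schmidt (\<lambda>n. (s n)\<^sup>2) e e"
    unfolding schmidt_compose[OF D(2,2,4)]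
    by (rule arg_cong[of _ _ "\<lambda>s. schmidt s e e"]) (use D(5) in \<open>force simp: power2_eq_square\<close>)
  show ?thesis
    unfolding modulus_operator_def eq
  proof (rule the_equality)
    show "positive_operator (schmidt s e e) \<and>
        schmidt s e e \<circ> schmidt s e e = schmidt (\<lambda>n. (s n)\<^sup>2) e e"
      using positive_schmidt[OF D(2,4,7)] eq' by simp
    fix A assume "positive_operator A \<and> A \<circ> A = schmidt (\<lambda>n. (s n)\<^sup>2) e e"
    then show "A = schmidt s e e"
      using positive_square_root_schmidt_unique[OF _ D(2,4,7,5)] by simp
  qed
qed

definition orthonormal :: "'a::complex_hilbert_space set \<Rightarrow> bool" where
  "orthonormal G \<longleftrightarrow> (\<forall>g\<in>G. norm g = 1) \<and> (\<forall>g\<in>G. \<forall>h\<in>G. g \<noteq> h \<longrightarrow> cinner g h = 0)"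

lemma orthonormalD:
  assumes "orthonormal G" "g \<in> G" "h \<in> G"
  shows "cinner g h = (if g = h then 1 else 0)"
  using assms by (auto simp: orthonormal_def cinner_self)

lemma orthonormal_independent:
  assumes "orthonormal G" "finite G"
  shows "complex_vector.independent G"
proof
  assume "complex_vector.dependent G"
  then obtain u g where g: "g \<in> G" "u g \<noteq> 0" and z: "(\<Sum>h\<in>G. u h *\<^sub>C h) = 0"
    using complex_vector.dependent_finite[OF assms(2)] by blast
  have "0 = cinner (\<Sum>h\<in>G. u h *\<^sub>C h) g" by (simp add: z)
  also have "\<dots> = (\<Sum>h\<in>G. if h = g then u h else 0)"
    unfolding cinner_sum_left cinner_scaleC_left
    using g(1) by (intro sum.cong refl) (simp add: orthonormalD[OF assms(1)])
  also have "\<dots> = u g" using g(1) assms(2) by simp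
  finally show False using g(2) by simp
qed

text \<open>The coefficients of an eigenvector vanish wherever \<open>s n \<noteq> t\<close>, so its
  series collapses to the finitely many n with \<open>s n = t\<close>.\<close>

lemma schmidt_eigenspace:
  assumes "schmidt_system s e f" "t > 0"
  shows "{x. schmidt s e e x = complex_of_real t *\<^sub>C x} = complex_vector.span (e ` {n. s n = t})"
proof (intro set_eqI iffI)
  note D = schmidt_systemD[OF assms(1)]
  fix x assume "x \<in> {x. schmidt s e e x = complex_of_real t *\<^sub>C x}"
  then have x: "schmidt s e e x = complex_of_real t *\<^sub>C x" by simp
  have "cinner x (e n) = 0" if "s n \<noteq> t" for n
  proof (cases "s n = 0")
    case True
    \<comment> \<open>Here \<open>e n\<close> need not have norm 1, but the weight 0 alone makes the
      inner product vanish.\<close>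
    have "complex_of_real t * cinner x (e n) = 0"
      using cinner_schmidt[OF D(2,2,4), where x = x and n = n] True
      by (simp add: x cinner_scaleC_left)
    then show ?thesis using assms(2) by simp
  next
    case False
    have "complex_of_real t * cinner x (e n) = complex_of_real (s n) * cinner x (e n)"
      using cinner_schmidt[OF D(2,2,4), where x = x and n = n] D(5)[OF False]
      by (simp add: x cinner_scaleC_left)
    then show ?thesis using that by simp
  qed
  then have "schmidt s e e x = (\<Sum>n\<in>{n. s n = t}. (complex_of_real (s n) * cinner x (e n)) *\<^sub>C e n)"
    unfolding schmidt_def
    by (intro suminf_finite finite_subset[OF _ finite_ge_of_tendsto_zero[OF c0_starD(3)[OF D(1)] assms(2)]])
      auto
  then have eq: "complex_of_real t *\<^sub>C x
      = (\<Sum>n\<in>{n. s n = t}. (complex_of_real (s n) * cinner x (e n)) *\<^sub>C e n)" by (simp add: x)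
  have "x = complex_of_real (1 / t) *\<^sub>C (\<Sum>n\<in>{n. s n = t}. (complex_of_real (s n) * cinner x (e n)) *\<^sub>C e n)"
    unfolding eq[symmetric] using assms(2) by (simp add: scaleC_scaleC)
  also have "\<dots> \<in> complex_vector.span (e ` {n. s n = t})"
    by (intro complex_vector.span_scale complex_vector.span_sum complex_vector.span_base) auto
  finally show "x \<in> complex_vector.span (e ` {n. s n = t})" .
next
  note D = schmidt_systemD[OF assms(1)]
  have b: "schmidt s e e \<in> bounded_operators"
    by (rule schmidt_bounded_operator[OF D(2,2,4)])
  note lin = linear_simps[OF bounded_operatorsD(1)[OF b]]
  fix x assume "x \<in> complex_vector.span (e ` {n. s n = t})"
  moreover have "complex_vector.span (e ` {n. s n = t})
      \<subseteq> {x. schmidt s e e x = complex_of_real t *\<^sub>C x}"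
  proof (rule complex_vector.span_minimal)
    show "complex_vector.subspace {x. schmidt s e e x = complex_of_real t *\<^sub>C x}"
      by (rule complex_vector.subspaceI)
        (auto simp: lin bounded_operatorsD(2)[OF b] scaleC_add_right scaleC_scaleC mult.commute)
    show "e ` {n. s n = t} \<subseteq> {x. schmidt s e e x = complex_of_real t *\<^sub>C x}"
      using assms(2) D(5) by (auto simp: schmidt_at[OF D(2)])
  qed
  ultimately show "x \<in> {x. schmidt s e e x = complex_of_real t *\<^sub>C x}" by blast
qed

text \<open>For t > 0 the eigenspace of the modulus is spanned by the \<open>e n\<close> with
  \<open>s n = t\<close>. These are orthonormal, hence distinct and independent, so the dimension is
  the multiplicity of t in \<open>s\<close>.\<close>

lemma singular_numbers_schmidt:
  assumes "schmidt_system s e f"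
  shows "singular_numbers (schmidt s e f) = s"
  unfolding singular_numbers_def modulus_schmidt[OF assms]
proof (rule decreasing_list_of_eqI)
  note D = schmidt_systemD[OF assms]
  show "s \<in> c0_star" by (rule D(1))
  fix t :: real assume t: "t > 0"
  let ?N = "{n. s n = t}"
  have fin: "finite ?N"
    by (rule finite_subset[OF _ finite_ge_of_tendsto_zero[OF c0_starD(3)[OF D(1)] t]]) auto
  have unit: "norm (e n) = 1" if "n \<in> ?N" for n using D(5)[of n] that t by auto
  have inj: "inj_on e ?N"
  proof (rule inj_onI, rule ccontr)
    fix m n assume mn: "m \<in> ?N" "n \<in> ?N" "e m = e n" "m \<noteq> n"
    then have "cinner (e m) (e m) = 0" using orth_familyD(1)[OF D(2), of m n] by simp
    then show False using unit[OF mn(1)] by (simp add: cinner_self)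
  qed
  have "orthonormal (e ` ?N)"
    using unit by (auto simp: orthonormal_def intro!: orth_familyD(1)[OF D(2)])
  then have "complex_vector.independent (e ` ?N)" using fin by (intro orthonormal_independent) auto
  then have "complex_vector.dim (complex_vector.span (e ` ?N)) = card (e ` ?N)"
    by (simp add: complex_vector.dim_eq_card_independent)
  also have "\<dots> = card ?N" by (rule card_image[OF inj])
  finally show "card ?N = complex_vector.dim {x. schmidt s e e x = complex_of_real t *\<^sub>C x}"
    by (simp add: schmidt_eigenspace[OF assms t])
qed

subsection \<open>Compact operators\<close>

lemma cinner_span_eq_zero:
  assumes "\<And>g. g \<in> G \<Longrightarrow> cinner r g = 0" "v \<in> complex_vector.span G"
  shows "cinner r v = 0"
proof -
  have "complex_vector.span G \<subseteq> {v. cinner r v = 0}"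
  proof (rule complex_vector.span_minimal)
    show "complex_vector.subspace {v. cinner r v = 0}"
      by (rule complex_vector.subspaceI) (auto simp: cinner_add_right cinner_scaleC_right)
  qed (use assms(1) in auto)
  then show ?thesis using assms(2) by blast
qed

lemma orthonormal_residual:
  assumes "orthonormal G" "finite G" "g \<in> G"
  shows "cinner (x - (\<Sum>h\<in>G. cinner x h *\<^sub>C h)) g = 0"
proof -
  have "cinner (\<Sum>h\<in>G. cinner x h *\<^sub>C h) g = (\<Sum>h\<in>G. if h = g then cinner x h else 0)"
    unfolding cinner_sum_left cinner_scaleC_left
    using assms(3) by (intro sum.cong refl) (simp add: orthonormalD[OF assms(1)])
  also have "\<dots> = cinner x g" using assms by simp
  finally show ?thesis by (simp add: cinner_diff_left)
qed

lemma norm_orthonormal_residual_le: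
  assumes "orthonormal G" "finite G"
  shows "norm (x - (\<Sum>h\<in>G. cinner x h *\<^sub>C h)) \<le> norm x"
proof -
  let ?p = "\<Sum>h\<in>G. cinner x h *\<^sub>C h"
  have "cinner (x - ?p) ?p = 0"
    using orthonormal_residual[OF assms] by (simp add: cinner_sum_right cinner_scaleC_right)
  then have "(norm x)\<^sup>2 = (norm (x - ?p))\<^sup>2 + (norm ?p)\<^sup>2"
    using norm_add_square[of "x - ?p" ?p] by simp
  then have "(norm (x - ?p))\<^sup>2 \<le> (norm x)\<^sup>2" by simp
  then show ?thesis by (rule power2_le_imp_le) simp
qed

lemma orthonormal_extend:
  assumes "orthonormal G" "finite G" "x \<notin> complex_vector.span G"
  obtains u where "norm u = 1" "\<And>g. g \<in> G \<Longrightarrow> cinner u g = 0"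
    "x \<in> complex_vector.span (insert u G)"
proof -
  define p where "p = (\<Sum>h\<in>G. cinner x h *\<^sub>C h)"
  have p: "p \<in> complex_vector.span G"
    unfolding p_def
    by (intro complex_vector.span_sum complex_vector.span_scale complex_vector.span_base)
  define r where "r = x - p"
  have r: "r \<noteq> 0" using assms(3) p by (auto simp: r_def)
  define u where "u = complex_of_real (1 / norm r) *\<^sub>C r"
  have "norm u = 1" using r by (simp add: u_def norm_scaleC norm_divide)
  moreover have "cinner u g = 0" if "g \<in> G" for g
    using orthonormal_residual[OF assms(1,2) that, of x]
    by (simp add: u_def r_def p_def cinner_scaleC_left)
  moreover have "x \<in> complex_vector.span (insert u G)"
  proof -
    have "x = complex_of_real (norm r) *\<^sub>C u + p"
      using r by (simp add: u_def scaleC_scaleC r_def)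
    also have "\<dots> \<in> complex_vector.span (insert u G)"
      by (intro complex_vector.span_add complex_vector.span_scale complex_vector.span_base
          subsetD[OF complex_vector.span_mono p]) auto
    finally show ?thesis .
  qed
  ultimately show ?thesis using that by blast
qed

lemma orthonormal_insert:
  assumes "orthonormal G" "norm u = 1" "\<And>g. g \<in> G \<Longrightarrow> cinner u g = 0"
  shows "orthonormal (insert u G)"
proof -
  have "cinner g u = 0" if "g \<in> G" for g
    using assms(3)[OF that] cinner_eq_zero_commute by blast
  then show ?thesis using assms by (auto simp: orthonormal_def)
qed

lemma gram_schmidt:
  assumes "finite F"
  shows "\<exists>G. finite G \<and> orthonormal G \<and> F \<subseteq> complex_vector.span G"
  using assms
proof (induction F rule: finite_induct)
  case empty
  show ?case by (rule exI[of _ "{}"]) (simp add: orthonormal_def)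
next
  case (insert x F)
  then obtain G where G: "finite G" "orthonormal G" "F \<subseteq> complex_vector.span G" by blast
  show ?case
  proof (cases "x \<in> complex_vector.span G")
    case False
    then obtain u where u: "norm u = 1" "\<And>g. g \<in> G \<Longrightarrow> cinner u g = 0"
      "x \<in> complex_vector.span (insert u G)"
      using orthonormal_extend[OF G(2,1)] by blast
    have "F \<subseteq> complex_vector.span (insert u G)"
      using G(3) complex_vector.span_mono[of G "insert u G"] by blast
    then show ?thesis using G(1) u(3) orthonormal_insert[OF G(2) u(1,2)]
      by (intro exI[of _ "insert u G"]) auto
  qed (use G in blast)
qed

text \<open>Infinite dimension provides a vector outside the span of an orthonormalisation of F; its
  normalised residual is orthogonal to F.\<close>

lemma exists_unit_orthogonal:
  fixes F :: "'a::complex_hilbert_space set"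
  assumes "\<not> (\<exists>B :: 'a set. finite B \<and> complex_vector.span B = UNIV)" "finite F"
  shows "\<exists>x. norm x = 1 \<and> (\<forall>f\<in>F. cinner x f = 0)"
proof -
  obtain G where G: "finite G" "orthonormal G" "F \<subseteq> complex_vector.span G"
    using gram_schmidt[OF assms(2)] by blast
  then obtain x where "x \<notin> complex_vector.span G" using assms(1) by blast
  then obtain u where "norm u = 1" "\<And>g. g \<in> G \<Longrightarrow> cinner u g = 0"
    using orthonormal_extend[OF G(2,1)] by blast
  then show ?thesis using G(3) cinner_span_eq_zero[of G u] by blast
qed

lemma bounded_linear_scaleC_left: "bounded_linear (\<lambda>c. c *\<^sub>C (v::'a::complex_hilbert_space))"
proof (rule bounded_linear_intro[where K = "norm v"])
  show "(r *\<^sub>R c) *\<^sub>C v = r *\<^sub>R (c *\<^sub>C v)" for r c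
    by (simp add: scaleC_of_real[symmetric] scaleC_scaleC scaleR_conv_of_real)
qed (auto simp: scaleC_add_left norm_scaleC)

text \<open>Stands in for the compactness of bounded sets in finite-dimensional complex subspaces.
  The family \<open>h\<close> may be dependent or repeat values, as it will consist of images under
  an operator.\<close>

lemma compact_combinations:
  fixes h :: "'b \<Rightarrow> 'a::complex_hilbert_space"
  assumes "finite G"
  shows "compact {\<Sum>g\<in>G. c g *\<^sub>C h g | c. \<forall>g\<in>G. cmod (c g) \<le> 1}"
  using assms
proof (induction G rule: finite_induct)
  case (insert a G)
  let ?K = "{\<Sum>g\<in>G. c g *\<^sub>C h g | c. \<forall>g\<in>G. cmod (c g) \<le> 1}"
  have "compact ((\<lambda>(z, v). z *\<^sub>C h a + v) ` (cball 0 1 \<times> ?K))"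
    unfolding case_prod_unfold
    by (intro compact_continuous_image compact_Times insert.IH compact_cball continuous_intros
        bounded_linear.continuous_on[OF bounded_linear_scaleC_left])
  moreover have "{\<Sum>g\<in>insert a G. c g *\<^sub>C h g | c. \<forall>g\<in>insert a G. cmod (c g) \<le> 1}
      = (\<lambda>(z, v). z *\<^sub>C h a + v) ` (cball 0 1 \<times> ?K)" (is "?L = ?R")
  proof
    show "?L \<subseteq> ?R"
    proof
      fix y assume "y \<in> ?L"
      then obtain c where "y = (\<Sum>g\<in>insert a G. c g *\<^sub>C h g)" "\<forall>g\<in>insert a G. cmod (c g) \<le> 1"
        by blast
      then show "y \<in> ?R" using insert(1,2)
        by (intro image_eqI[of _ _ "(c a, \<Sum>g\<in>G. c g *\<^sub>C h g)"]) auto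
    qed
    show "?R \<subseteq> ?L"
    proof
      fix y assume "y \<in> ?R"
      then obtain z c where y: "y = z *\<^sub>C h a + (\<Sum>g\<in>G. c g *\<^sub>C h g)" "cmod z \<le> 1"
        "\<forall>g\<in>G. cmod (c g) \<le> 1" by auto
      have "(\<Sum>g\<in>G. c g *\<^sub>C h g) = (\<Sum>g\<in>G. (c(a := z)) g *\<^sub>C h g)"
        using insert(2) by (intro sum.cong) auto
      then have "y = (\<Sum>g\<in>insert a G. (c(a := z)) g *\<^sub>C h g)"
        using insert(1,2) y(1) by simp
      moreover have "\<forall>g\<in>insert a G. cmod ((c(a := z)) g) \<le> 1" using y(2,3) by auto
      ultimately show "y \<in> ?L" by blast
    qed
  qed
  ultimately show ?case by simp
qed simp

text \<open>Up to an error of \<epsilon> / 4 the image of the unit ball consists of combinations,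
  with coefficients in the unit disc, of the images of a finite orthonormal set; this gives total
  boundedness. The contrapositive supplies vectors, orthogonal to any given finite set, on which a
  noncompact operator is bounded below.\<close>

lemma compact_operatorI:
  fixes X :: "'a::complex_hilbert_space \<Rightarrow> 'a"
  assumes X: "X \<in> bounded_operators"
    and small: "\<And>\<epsilon>. \<epsilon> > 0 \<Longrightarrow>
      \<exists>F. finite F \<and> (\<forall>x. (\<forall>f\<in>F. cinner x f = 0) \<longrightarrow> norm (X x) \<le> \<epsilon> * norm x)"
  shows "X \<in> compact_operators"
proof -
  note lin = linear_simps[OF bounded_operatorsD(1)[OF X]]
  have sumX: "X (\<Sum>g\<in>G. c g *\<^sub>C g) = (\<Sum>g\<in>G. c g *\<^sub>C X g)" for G c
    by (induction G rule: infinite_finite_induct) (simp_all add: lin bounded_operatorsD(2)[OF X])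
  have "\<exists>k. finite k \<and> closure (X ` cball 0 1) \<subseteq> (\<Union>y\<in>k. ball y \<epsilon>)" if "\<epsilon> > 0" for \<epsilon>
  proof -
    have e4: "\<epsilon> / 4 > 0" using that by simp
    obtain F where F: "finite F" "\<And>x. (\<forall>f\<in>F. cinner x f = 0) \<Longrightarrow> norm (X x) \<le> \<epsilon> / 4 * norm x"
      using small[OF e4] by blast
    obtain G where G: "finite G" "orthonormal G" "F \<subseteq> complex_vector.span G"
      using gram_schmidt[OF F(1)] by blast
    have "compact {\<Sum>g\<in>G. c g *\<^sub>C X g | c. \<forall>g\<in>G. cmod (c g) \<le> 1}" (is "compact ?K")
      by (rule compact_combinations[OF G(1)])
    then obtain k where k: "finite k" "?K \<subseteq> (\<Union>y\<in>k. ball y (\<epsilon> / 4))"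
      using conjunct2[OF iffD1[OF compact_eq_totally_bounded], rule_format, OF _ e4] by blast
    \<comment> \<open>Closed balls of half the radius are used so that the closure of the image
      still fits into the open \<epsilon>-balls.\<close>
    have "X ` cball 0 1 \<subseteq> (\<Union>y\<in>k. cball y (\<epsilon> / 2))"
    proof
      fix z assume "z \<in> X ` cball 0 1"
      then obtain x where x: "z = X x" "norm x \<le> 1" by auto
      let ?p = "\<Sum>g\<in>G. cinner x g *\<^sub>C g"
      have "norm (X (x - ?p)) \<le> \<epsilon> / 4 * norm (x - ?p)"
        using F(2) G(3) cinner_span_eq_zero[OF orthonormal_residual[OF G(2,1), of _ x]] by blast
      also have "\<dots> \<le> \<epsilon> / 4 * 1"
        using norm_orthonormal_residual_le[OF G(2,1), of x] x(2) that by (intro mult_left_mono) auto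
      finally have 1: "norm (X x - X ?p) \<le> \<epsilon> / 4" by (simp add: lin)
      have "cmod (cinner x g) \<le> 1" if "g \<in> G" for g
        using cinner_cauchy_schwarz[of x g] G(2) that x(2) by (auto simp: orthonormal_def)
      then have "X ?p \<in> ?K" unfolding sumX by blast
      then obtain y where y: "y \<in> k" "dist y (X ?p) < \<epsilon> / 4" using k(2) by auto
      have "dist y (X x) \<le> dist y (X ?p) + dist (X ?p) (X x)" by (rule dist_triangle)
      also have "\<dots> \<le> \<epsilon> / 4 + \<epsilon> / 4" using y(2) 1 by (simp add: dist_norm norm_minus_commute)
      finally show "z \<in> (\<Union>y\<in>k. cball y (\<epsilon> / 2))" using y(1) x(1) by auto
    qed
    then have "closure (X ` cball 0 1) \<subseteq> (\<Union>y\<in>k. cball y (\<epsilon> / 2))"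
      using k(1) by (intro closure_minimal closed_UN) auto
    also have "\<dots> \<subseteq> (\<Union>y\<in>k. ball y \<epsilon>)" using that by auto
    finally show ?thesis using k(1) by blast
  qed
  then have "compact (closure (X ` cball 0 1))"
    by (simp add: compact_eq_totally_bounded complete_eq_closed)
  then show ?thesis using X by (simp add: compact_operators_def)
qed

text \<open>On vectors orthogonal to e 0, ..., e (N - 1) only weights below \<epsilon> act.\<close>

lemma schmidt_compact:
  assumes s: "s \<in> c0_star" and e: "orth_family e" and f: "orth_family f"
  shows "schmidt s e f \<in> compact_operators"
proof (rule compact_operatorI)
  have "\<forall>n. \<bar>s n\<bar> \<le> s 0" using c0_star_abs_le[OF s] by blast
  then show "schmidt s e f \<in> bounded_operators" by (rule schmidt_bounded_operator[OF e f])
  fix \<epsilon> :: real assume "\<epsilon> > 0"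
  then obtain N where N: "s N < \<epsilon>"
    using order_tendstoD(2)[OF c0_starD(3)[OF s]] by (auto simp: eventually_sequentially)
  have "norm (schmidt s e f x) \<le> \<epsilon> * norm x" if x: "\<forall>y\<in>e ` {..<N}. cinner x y = 0" for x
  proof -
    define t where "t n = (if n < N then 0 else s n)" for n
    have "\<forall>n. \<bar>t n\<bar> \<le> \<epsilon>"
      using N c0_starD(2)[OF s] decseqD[OF c0_starD(1)[OF s], of N] \<open>\<epsilon> > 0\<close>
      by (auto simp: t_def) (meson less_imp_le linorder_not_less order_trans)
    then have "norm (schmidt t e f x) \<le> \<epsilon> * norm x" by (rule norm_schmidt_le[OF e f])
    moreover have "(\<lambda>n. (complex_of_real (s n) * cinner x (e n)) *\<^sub>C f n)
        = (\<lambda>n. (complex_of_real (t n) * cinner x (e n)) *\<^sub>C f n)"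
      using x by (auto simp: t_def)
    ultimately show ?thesis by (simp add: schmidt_def)
  qed
  then show "\<exists>F. finite F \<and> (\<forall>x. (\<forall>f\<in>F. cinner x f = 0) \<longrightarrow> norm (schmidt s e f x) \<le> \<epsilon> * norm x)"
    by (intro exI[of _ "e ` {..<N}"]) auto
qed

text \<open>The choice at stage n may depend on n and on the set of earlier values, but not on their
  order. Singular vectors, orthonormal bases, the vectors detecting noncompactness and decreasing
  rearrangements are all chosen this way.\<close>

lemma greedy_sequence:
  assumes "\<And>n F. finite F \<Longrightarrow> \<exists>x. P n F x"
  obtains e :: "nat \<Rightarrow> 'b" where "\<And>n. P n (e ` {..<n}) (e n)"
proof -
  have "\<exists>f. \<forall>n. P n (f ` {..<n}) (f n)"
  proof (rule dependent_wellorder_choice)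
    fix r :: 'b and f g :: "nat \<Rightarrow> 'b" and n :: nat
    assume "\<And>m. m < n \<Longrightarrow> f m = g m"
    then have "f ` {..<n} = g ` {..<n}" by force
    then show "P n (f ` {..<n}) r = P n (g ` {..<n}) r" by simp
  qed (use assms in blast)
  then show ?thesis using that by blast
qed

lemma orth_familyI_less:
  assumes "\<And>n. norm (e n) = 1" "\<And>m n. m < n \<Longrightarrow> cinner (e n) (e m) = 0"
  shows "orth_family e"
proof -
  have "cinner (e m) (e n) = 0" if "m \<noteq> n" for m n
    using that assms(2)[of m n] assms(2)[of n m] cinner_eq_zero_commute[of "e m" "e n"]
    by (cases m n rule: linorder_cases) auto
  then show ?thesis using assms(1) by (simp add: orth_family_def)
qed

text \<open>Maximising sequences converge by the parallelogram law, so no weak compactness is needed.\<close>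

lemma compact_norm_attained:
  fixes X :: "'a::complex_hilbert_space \<Rightarrow> 'a"
  assumes X: "X \<in> compact_operators"
    and M: "closed M" "\<And>x y. x \<in> M \<Longrightarrow> y \<in> M \<Longrightarrow> x + y \<in> M" "\<And>r x. x \<in> M \<Longrightarrow> r *\<^sub>R x \<in> M"
    and unit: "\<exists>x\<in>M. norm x = 1"
  shows "\<exists>e\<in>M. norm e = 1 \<and> (\<forall>x\<in>M. norm (X x) \<le> norm (X e) * norm x)"
proof -
  have bX: "bounded_linear X"
    using X by (simp add: compact_operators_def bounded_operatorsD(1))
  note lin = linear_simps[OF bX]
  define S where "S = {norm (X x) | x. x \<in> M \<and> norm x = 1}"
  define s where "s = Sup S"
  have Sne: "S \<noteq> {}" using unit by (auto simp: S_def)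
  obtain K where K: "\<And>x. norm (X x) \<le> norm x * K" using bounded_linear.bounded[OF bX] by blast
  have bdd: "bdd_above S"
  proof
    fix y assume "y \<in> S"
    then show "y \<le> K" using K by (auto simp: S_def) (metis mult_1)
  qed
  have le: "norm (X x) \<le> s * norm x" if "x \<in> M" for x
  proof (cases "x = 0")
    case False
    have "norm (X ((1 / norm x) *\<^sub>R x)) \<in> S"
      using False M(3)[OF that] by (auto simp: S_def)
    then have "norm (X ((1 / norm x) *\<^sub>R x)) \<le> s" unfolding s_def by (rule cSup_upper[OF _ bdd])
    then show ?thesis using False by (simp add: lin divide_simps)
  qed (simp add: lin)
  have s0: "0 \<le> s"
    using unit le norm_ge_zero by (metis mult.right_neutral order_trans)
  show ?thesis
  proof (cases "s = 0")
    case True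
    then show ?thesis using unit le by (metis mult_zero_left norm_ge_zero order.antisym)
  next
    case False
    then have s: "s > 0" using s0 by simp
    have "\<exists>x. x \<in> M \<and> norm x = 1 \<and> s - 1 / real (Suc n) < norm (X x)" for n
    proof -
      have "s - 1 / real (Suc n) < Sup S" by (simp add: s_def)
      then show ?thesis using less_cSup_iff[OF Sne bdd] by (auto simp: S_def)
    qed
    then obtain x where x: "\<And>n. x n \<in> M" "\<And>n. norm (x n) = 1"
      "\<And>n. s - 1 / real (Suc n) < norm (X (x n))" by metis
    have "seq_compact (closure (X ` cball 0 1))"
      using X by (simp add: compact_operators_def compact_imp_seq_compact)
    moreover have "\<forall>n. X (x n) \<in> closure (X ` cball 0 1)"
      using x(2) by (auto intro!: closure_subset[THEN subsetD])
    ultimately obtain l r where r: "strict_mono r" "((\<lambda>n. X (x n)) \<circ> r) \<longlonglongrightarrow> l"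
      unfolding seq_compact_def by metis
    define z where "z n = x (r n)" for n
    have z: "\<And>n. z n \<in> M" "\<And>n. norm (z n) = 1" "(\<lambda>n. X (z n)) \<longlonglongrightarrow> l"
      using x(1,2) r(2) by (auto simp: z_def o_def)
    have lower: "(\<lambda>n. s - 1 / real (Suc (r n))) \<longlonglongrightarrow> s"
    proof -
      have "(\<lambda>n. 1 / real (Suc n)) \<longlonglongrightarrow> 0" using LIMSEQ_inverse_real_of_nat by (simp add: inverse_eq_divide)
      from LIMSEQ_subseq_LIMSEQ[OF this r(1)] have "(\<lambda>n. 1 / real (Suc (r n))) \<longlonglongrightarrow> 0"
        by (simp add: o_def)
      from tendsto_diff[OF tendsto_const this] show ?thesis by simp
    qed
    have "(\<lambda>n. norm (X (z n))) \<longlonglongrightarrow> s"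
    proof (rule tendsto_sandwich[OF _ _ lower tendsto_const])
      show "\<forall>\<^sub>F n in sequentially. s - 1 / real (Suc (r n)) \<le> norm (X (z n))"
        using x(3) by (auto simp: z_def intro!: always_eventually less_imp_le)
      show "\<forall>\<^sub>F n in sequentially. norm (X (z n)) \<le> s"
        using le z(1,2) by (intro always_eventually allI) (metis mult.right_neutral)
    qed
    then have l: "norm l = s" using tendsto_norm[OF z(3)] LIMSEQ_unique by blast
    have "Cauchy z"
    proof (rule metric_CauchyI)
      fix \<epsilon> :: real assume \<epsilon>: "\<epsilon> > 0"
      \<comment> \<open>Once the norm of z m + z n is at least 2 - 2\<eta>, the parallelogram law
        bounds the squared distance of z m and z n by 8\<eta>; \<eta> \<le> 1 keeps 2 - 2\<eta>
        nonnegative for the squaring.\<close>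
      define \<eta> where "\<eta> = min 1 (\<epsilon>\<^sup>2 / 16)"
      have \<eta>: "\<eta> > 0" "\<eta> \<le> 1" "8 * \<eta> < \<epsilon>\<^sup>2" using \<epsilon> by (auto simp: \<eta>_def min_def)
      then have "s * \<eta> > 0" using s by simp
      then obtain N where N: "\<And>n. n \<ge> N \<Longrightarrow> norm (X (z n) - l) < s * \<eta>"
        using LIMSEQ_D[OF z(3)] by blast
      have "dist (z m) (z n) < \<epsilon>" if "m \<ge> N" "n \<ge> N" for m n
      proof -
        have "2 * s = norm (X (z m + z n) - (X (z m) - l) - (X (z n) - l))"
          using l by (simp add: lin flip: scaleR_2)
        also have "\<dots> \<le> norm (X (z m + z n)) + norm (X (z m) - l) + norm (X (z n) - l)"
          by (meson add_right_mono norm_triangle_ineq4 order_trans)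
        also have "\<dots> \<le> s * norm (z m + z n) + s * \<eta> + s * \<eta>"
          using le[OF M(2)[OF z(1) z(1)], of m n] N[OF that(1)] N[OF that(2)] by linarith
        finally have "s * 2 \<le> s * (norm (z m + z n) + 2 * \<eta>)" by (simp add: algebra_simps)
        then have "2 - 2 * \<eta> \<le> norm (z m + z n)" using s by simp
        then have "(2 - 2 * \<eta>)\<^sup>2 \<le> (norm (z m + z n))\<^sup>2" using \<eta> by (intro power_mono) auto
        moreover have "(2 - 2 * \<eta>)\<^sup>2 \<ge> 4 - 8 * \<eta>" by (simp add: power2_eq_square algebra_simps)
        moreover have "(norm (z m - z n))\<^sup>2 = 4 - (norm (z m + z n))\<^sup>2"
          by (simp add: norm_add_square norm_diff_square z(2))
        ultimately have "(norm (z m - z n))\<^sup>2 < \<epsilon>\<^sup>2" using \<eta>(3) by linarith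
        then show ?thesis using \<epsilon> by (simp add: dist_norm power_less_imp_less_base)
      qed
      then show "\<exists>N. \<forall>m\<ge>N. \<forall>n\<ge>N. dist (z m) (z n) < \<epsilon>" by blast
    qed
    then obtain e where e: "z \<longlonglongrightarrow> e" using Cauchy_convergent_iff convergent_def by blast
    have "e \<in> M" using closed_sequentially[OF M(1) _ e] z(1) by blast
    moreover have "norm e = 1"
      using LIMSEQ_unique[OF tendsto_norm[OF e]] z(2) by simp
    moreover have "X e = l"
      using LIMSEQ_unique[OF bounded_linear.tendsto[OF bX e] z(3)] .
    ultimately show ?thesis using le l by blast
  qed
qed

text \<open>A first variation: moving from e by a small multiple of z, with phase adapted to the
  inner product of X z and X e, would raise the squared norm of the image to first order, whereas
  the squared norm of the vector itself grows only to second order.\<close>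

lemma norm_maximiser_orthogonal_image:
  fixes X :: "'a::complex_hilbert_space \<Rightarrow> 'a"
  assumes X: "X \<in> bounded_operators"
    and e: "norm e = 1" and z: "cinner z e = 0"
    and max: "\<And>c. norm (X (e + c *\<^sub>C z)) \<le> norm (X e) * norm (e + c *\<^sub>C z)"
  shows "cinner (X z) (X e) = 0"
proof (rule ccontr)
  define a where "a = cinner (X z) (X e)"
  assume "cinner (X z) (X e) \<noteq> 0"
  then have a: "cmod a > 0" by (simp add: a_def)
  note lin = linear_simps[OF bounded_operatorsD(1)[OF X]]
  define B where "B = (norm (X e))\<^sup>2 * (norm z)\<^sup>2"
  have ineq: "2 * \<epsilon> * (cmod a)\<^sup>2 \<le> \<epsilon>\<^sup>2 * (cmod a)\<^sup>2 * B" for \<epsilon> :: real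
  proof -
    define c where "c = complex_of_real \<epsilon> * cnj a"
    have ez: "cinner e z = 0" using z cinner_eq_zero_commute by blast
    have "c * a = complex_of_real (\<epsilon> * (cmod a)\<^sup>2)"
      by (simp add: c_def complex_norm_square mult.commute[of "cnj a"] mult.assoc del: of_real_power)
    then have ca: "Re (c * a) = \<epsilon> * (cmod a)\<^sup>2" by (metis Re_complex_of_real)
    have c2: "(cmod c)\<^sup>2 = \<epsilon>\<^sup>2 * (cmod a)\<^sup>2"
      by (simp add: c_def norm_mult power_mult_distrib)
    have "(norm (X (e + c *\<^sub>C z)))\<^sup>2
        = (norm (X e))\<^sup>2 + (cmod c)\<^sup>2 * (norm (X z))\<^sup>2 + 2 * Re (c * a)"
      by (simp add: lin bounded_operatorsD(2)[OF X] norm_add_square norm_scaleC power_mult_distrib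
          Re_cinner_commute[of "X e" "c *\<^sub>C X z"] cinner_scaleC_left a_def del: times_complex.sel)
    moreover have "(norm (X (e + c *\<^sub>C z)))\<^sup>2 \<le> (norm (X e) * norm (e + c *\<^sub>C z))\<^sup>2"
      using max by (intro power_mono) auto
    moreover have "(norm (X e) * norm (e + c *\<^sub>C z))\<^sup>2 = (norm (X e))\<^sup>2 + (cmod c)\<^sup>2 * B"
      by (simp add: norm_add_square e norm_scaleC cinner_scaleC_right ez power_mult_distrib B_def
          algebra_simps)
    moreover have "0 \<le> (cmod c)\<^sup>2 * (norm (X z))\<^sup>2" by simp
    ultimately have "2 * Re (c * a) \<le> (cmod c)\<^sup>2 * B" by linarith
    then show ?thesis unfolding ca c2 by simp
  qed
  have B0: "B \<ge> 0" by (simp add: B_def)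
  \<comment> \<open>This choice keeps \<epsilon> B below 2 for every B \<ge> 0, which contradicts
    \<open>ineq\<close>.\<close>
  define \<epsilon> where "\<epsilon> = 1 / (1 + B)"
  have \<epsilon>: "\<epsilon> > 0" "\<epsilon> * B < 2" using B0 by (simp_all add: \<epsilon>_def field_simps)
  have "\<epsilon> * (cmod a)\<^sup>2 * 2 \<le> \<epsilon> * (cmod a)\<^sup>2 * (\<epsilon> * B)"
    using ineq[of \<epsilon>] by (simp add: power2_eq_square algebra_simps)
  moreover have "\<epsilon> * (cmod a)\<^sup>2 > 0" using \<epsilon> a by simp
  ultimately have "2 \<le> \<epsilon> * B" by (simp only: mult_le_cancel_left_pos)
  then show False using \<epsilon>(2) by simp
qed

subsection \<open>Singular value decomposition and orthonormal bases\<close>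

lemma residual_orthogonal_family:
  assumes "orth_family e" "\<And>n. norm (e n) = 1"
  shows "cinner (x - schmidt (\<lambda>_. 1) e e x) (e n) = 0"
  using cinner_schmidt[OF assms(1,1), of "\<lambda>_. 1" 1 x n] assms(2) by (simp add: cinner_diff_left)

text \<open>Here \<open>e n\<close> maximises the norm of the image among unit vectors orthogonal to
  its predecessors. The first variation makes the images orthogonal, and a residual orthogonal to
  every \<open>e n\<close> is annihilated because the maxima tend to 0.\<close>

theorem singular_value_decomposition:
  fixes X :: "'a::complex_hilbert_space \<Rightarrow> 'a"
  assumes inf: "\<not> (\<exists>B :: 'a set. finite B \<and> complex_vector.span B = UNIV)"
    and X: "X \<in> compact_operators"
  obtains s e f where "schmidt_system s e f" "X = schmidt s e f"
proof -
  have bX: "X \<in> bounded_operators" using X by (simp add: compact_operators_def)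
  note lin = linear_simps[OF bounded_operatorsD(1)[OF bX]]
  let ?P = "\<lambda>(n::nat) F x. norm x = 1 \<and> (\<forall>f\<in>F. cinner x f = 0) \<and>
    (\<forall>y. (\<forall>f\<in>F. cinner y f = 0) \<longrightarrow> norm (X y) \<le> norm (X x) * norm y)"
  have "\<exists>x. ?P n F x" if "finite F" for n F
  proof -
    define M where "M = {x. \<forall>f\<in>F. cinner x f = 0}"
    have "M = (\<Inter>f\<in>F. {x. cinner x f = 0})" by (auto simp: M_def)
    moreover have "closed {x. cinner x f = 0}" for f :: 'a
      by (intro closed_Collect_eq continuous_on_const
          bounded_linear.continuous_on[OF bounded_linear_cinner_left] continuous_on_id)
    ultimately have "closed M" by (simp add: closed_INT)
    moreover have "\<exists>x\<in>M. norm x = 1"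
      using exists_unit_orthogonal[OF inf that] by (auto simp: M_def)
    ultimately have "\<exists>e\<in>M. norm e = 1 \<and> (\<forall>x\<in>M. norm (X x) \<le> norm (X e) * norm x)"
      by (intro compact_norm_attained[OF X])
        (auto simp: M_def cinner_add_left cinner_scaleR_left)
    then show ?thesis by (auto simp: M_def)
  qed
  then obtain e where "\<And>n. ?P n (e ` {..<n}) (e n)"
    using greedy_sequence[of ?P] by blast
  then have unit: "\<And>n. norm (e n) = 1" and orth: "\<And>m n. m < n \<Longrightarrow> cinner (e n) (e m) = 0"
    and max: "\<And>n y. (\<And>m. m < n \<Longrightarrow> cinner y (e m) = 0) \<Longrightarrow> norm (X y) \<le> norm (X (e n)) * norm y"
    by auto
  have e: "orth_family e" by (rule orth_familyI_less[OF unit orth])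
  have image_orth: "cinner (X (e n)) (X (e m)) = 0" if "m < n" for m n
  proof (rule norm_maximiser_orthogonal_image[OF bX unit orth[OF that]])
    fix c
    show "norm (X (e m + c *\<^sub>C e n)) \<le> norm (X (e m)) * norm (e m + c *\<^sub>C e n)"
      using orth that by (intro max) (simp add: cinner_add_left cinner_scaleC_left)
  qed
  define s where "s n = norm (X (e n))" for n
  \<comment> \<open>For \<open>s n = 0\<close> the totalised division gives \<open>f n = 0\<close>,
    as a Schmidt system permits.\<close>
  define f where "f n = complex_of_real (1 / s n) *\<^sub>C X (e n)" for n
  have Xe: "X (e n) = complex_of_real (s n) *\<^sub>C f n" for n
    by (cases "s n = 0") (auto simp: f_def s_def scaleC_scaleC)
  have f1: "norm (f n) = (if s n = 0 then 0 else 1)" for n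
    by (auto simp: f_def norm_scaleC norm_divide) (auto simp: s_def)
  have f: "orth_family f"
  proof -
    have "cinner (f m) (f n) = 0" if "m \<noteq> n" for m n
      using that image_orth[of m n] image_orth[of n m] cinner_eq_zero_commute[of "X (e m)" "X (e n)"]
      by (cases m n rule: linorder_cases) (auto simp: f_def cinner_scaleC_left cinner_scaleC_right)
    then show ?thesis using f1 by (auto simp: orth_family_def)
  qed
  have dec: "decseq s"
  proof (rule decseq_SucI)
    fix n
    show "s (Suc n) \<le> s n"
      using max[of n "e (Suc n)"] orth unit by (simp add: s_def)
  qed
  have "s \<longlonglongrightarrow> 0"
  proof -
    obtain L where L: "s \<longlonglongrightarrow> L"
      using decseq_convergent[OF dec, of 0] by (auto simp: s_def)
    have Ls: "L \<le> s n" for n using decseq_ge[OF dec L] .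
    have "L \<ge> 0" by (rule LIMSEQ_le_const[OF L]) (auto simp: s_def)
    have "seq_compact (closure (X ` cball 0 1))"
      using X by (simp add: compact_operators_def compact_imp_seq_compact)
    moreover have "\<forall>n. X (e n) \<in> closure (X ` cball 0 1)"
      using unit by (auto intro!: closure_subset[THEN subsetD])
    ultimately obtain l r where r: "strict_mono r" "((\<lambda>n. X (e n)) \<circ> r) \<longlonglongrightarrow> l"
      unfolding seq_compact_def by metis
    define z where "z n = X (e (r n))" for n
    have z: "z \<longlonglongrightarrow> l" using r(2) by (simp add: z_def[abs_def] o_def)
    \<comment> \<open>Along a convergent subsequence of images consecutive differences tend to 0,
      but orthogonality keeps their squared norms at least twice the square of the limit L of
      \<open>s\<close>.\<close>
    have "(\<lambda>n. z (Suc n) - z n) \<longlonglongrightarrow> l - l" by (intro tendsto_diff LIMSEQ_Suc z)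
    from tendsto_power[OF tendsto_norm[OF this], of 2]
    have "(\<lambda>n. (norm (z (Suc n) - z n))\<^sup>2) \<longlonglongrightarrow> 0" by simp
    moreover have "2 * L\<^sup>2 \<le> (norm (z (Suc n) - z n))\<^sup>2" for n
    proof -
      have "(norm (z (Suc n) - z n))\<^sup>2 = (s (r (Suc n)))\<^sup>2 + (s (r n))\<^sup>2"
        using image_orth[of "r n" "r (Suc n)"] r(1)
        by (simp add: norm_diff_square z_def s_def strict_mono_def)
      moreover have "L\<^sup>2 \<le> (s k)\<^sup>2" for k using Ls \<open>L \<ge> 0\<close> by (intro power_mono)
      ultimately show ?thesis by (metis add_mono mult_2)
    qed
    ultimately have "2 * L\<^sup>2 \<le> 0" using LIMSEQ_le_const by blast
    then have "L = 0" by simp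
    then show ?thesis using L by simp
  qed
  then have s: "s \<in> c0_star" using dec by (simp add: c0_star_def s_def)
  have sys: "schmidt_system s e f"
    using s e f unit f1 by (auto simp: schmidt_system_def)
  have "X x = schmidt s e f x" for x
  proof -
    define r where "r = x - schmidt (\<lambda>_. 1) e e x"
    have r: "cinner r (e n) = 0" for n unfolding r_def by (rule residual_orthogonal_family[OF e unit])
    have "norm (X r) \<le> s n * norm r" for n using max[of n r] r by (simp add: s_def)
    then have "norm (X r) \<le> 0 * norm r"
      by (intro LIMSEQ_le_const[OF tendsto_mult[OF c0_starD(3)[OF s] tendsto_const]]) auto
    then have "X r = 0" by simp
    then have "X x = X (schmidt (\<lambda>_. 1) e e x)" by (simp add: r_def lin)
    also have "\<dots> = (\<Sum>n. (complex_of_real 1 * cinner x (e n)) *\<^sub>C X (e n))"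
      by (rule bounded_operator_schmidt[OF bX e e, of _ 1]) simp
    finally show ?thesis by (simp add: Xe schmidt_def scaleC_scaleC mult.commute)
  qed
  then show ?thesis using sys that by blast
qed

section \<open>Orthonormal bases and Riesz representation\<close>

definition orthonormal_basis :: "(nat \<Rightarrow> 'a::complex_hilbert_space) \<Rightarrow> bool" where
  "orthonormal_basis b \<longleftrightarrow> orth_family b \<and> (\<forall>n. norm (b n) = 1) \<and>
     (\<forall>x. (\<forall>n. cinner x (b n) = 0) \<longrightarrow> x = 0)"

lemma orthonormal_basisD:
  assumes "orthonormal_basis b"
  shows "orth_family b" "norm (b n) = 1" "(\<And>n. cinner x (b n) = 0) \<Longrightarrow> x = 0"
  using assms by (auto simp: orthonormal_basis_def)

lemma orthonormal_range:
  assumes "orth_family e" "\<And>n. norm (e n) = 1"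
  shows "orthonormal (e ` A)"
  using assms by (auto simp: orthonormal_def intro!: orth_familyD(1))

text \<open>Orthonormalisation along a dense sequence: stage n brings \<open>d n\<close> into the
  span, or picks any new unit vector if it is already there, so that no index stays empty. A vector
  orthogonal to the whole family is then orthogonal to a dense set.\<close>

theorem orthonormal_basis_exists:
  assumes inf: "\<not> (\<exists>B :: 'a::complex_hilbert_space set. finite B \<and> complex_vector.span B = UNIV)"
    and sep: "\<exists>D :: 'a::complex_hilbert_space set. countable D \<and> closure D = UNIV"
  obtains b :: "nat \<Rightarrow> 'a::complex_hilbert_space" where "orthonormal_basis b"
proof -
  obtain D :: "'a set" where D: "countable D" "closure D = UNIV" using sep by blast
  have "D \<noteq> {}" using D(2) by auto
  define d where "d = from_nat_into D"
  have d: "range d = D" unfolding d_def using range_from_nat_into[OF \<open>D \<noteq> {}\<close> D(1)] .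
  \<comment> \<open>The greedy choice must succeed for every finite F, while the extension is
    available for orthonormal F only; hence the implication.\<close>
  let ?P = "\<lambda>n F x. norm x = 1 \<and> (\<forall>f\<in>F. cinner x f = 0) \<and>
    (orthonormal F \<longrightarrow> d n \<in> complex_vector.span (insert x F))"
  have "\<exists>x. ?P n F x" if "finite F" for n F
  proof (cases "orthonormal F \<and> d n \<notin> complex_vector.span F")
    case True
    then show ?thesis using orthonormal_extend[of F "d n"] that by metis
  next
    case False
    obtain x where x: "norm x = 1" "\<forall>f\<in>F. cinner x f = 0"
      using exists_unit_orthogonal[OF inf \<open>finite F\<close>] by blast
    moreover have "complex_vector.span F \<subseteq> complex_vector.span (insert x F)"
      by (rule complex_vector.span_mono) auto
    ultimately show ?thesis using False by blast
  qed
  then obtain b where b: "\<And>n. ?P n (b ` {..<n}) (b n)"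
    using greedy_sequence[of ?P] by blast
  then have unit: "norm (b n) = 1" for n by blast
  have orth: "orth_family b" using b by (intro orth_familyI_less) auto
  have span: "d n \<in> complex_vector.span (insert (b n) (b ` {..<n}))" for n
    using b orthonormal_range[OF orth unit] by blast
  have "x = 0" if x: "\<And>n. cinner x (b n) = 0" for x
  proof -
    have "cinner x (d n) = 0" for n
      using x by (intro cinner_span_eq_zero[OF _ span[of n]]) auto
    then have "D \<subseteq> {y. cinner x y = 0}" using d by auto
    moreover have "closed {y. cinner x y = 0}"
      by (intro closed_Collect_eq continuous_on_const
          bounded_linear.continuous_on[OF bounded_linear_cinner_right] continuous_on_id)
    ultimately have "closure D \<subseteq> {y. cinner x y = 0}" by (rule closure_minimal)
    then have "cinner x x = 0" using D(2) by auto
    then show ?thesis by (simp add: cinner_self_eq_zero)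
  qed
  then show ?thesis using that orth unit by (auto simp: orthonormal_basis_def)
qed

lemma orthonormal_basis_expansion:
  assumes "orthonormal_basis b"
  shows "schmidt (\<lambda>_. 1) b b x = x"
  using orthonormal_basisD(3)[OF assms residual_orthogonal_family[OF orthonormal_basisD(1,2)[OF assms]], of x]
  by simp

lemma orthonormal_basis_sums:
  assumes "orthonormal_basis b"
  shows "(\<lambda>n. cinner x (b n) *\<^sub>C b n) sums x"
  using summable_sums[OF schmidt_summable[OF orthonormal_basisD(1,1)[OF assms], of "\<lambda>_. 1" 1 x]]
    orthonormal_basis_expansion[OF assms, of x]
  by (simp add: schmidt_def)

text \<open>Riesz representation made explicit: z gets the coefficients
  \<open>cinner y (X (b n))\<close>. Testing X on a partial sum v bounds the sum S of their squared
  moduli by a constant times the norm of v, which is at most the square root of S; so S stays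
  bounded. The description \<open>adjoint_operator\<close> by itself offers no existence.\<close>

lemma adjoint_vector_exists:
  fixes X :: "'a::complex_hilbert_space \<Rightarrow> 'a" and b :: "nat \<Rightarrow> 'a"
  assumes b: "orthonormal_basis b" and X: "X \<in> bounded_operators"
  shows "\<exists>z. \<forall>x. cinner (X x) y = cinner x z"
proof -
  have bX: "bounded_linear X" by (rule bounded_operatorsD(1)[OF X])
  obtain K where K: "\<And>x. norm (X x) \<le> norm x * K" using bounded_linear.bounded[OF bX] by blast
  define c where "c n = cinner y (X (b n))" for n
  have bound: "(\<Sum>n<N. (cmod (c n))\<^sup>2) \<le> (norm y * K)\<^sup>2" for N
  proof -
    define v where "v = (\<Sum>n<N. c n *\<^sub>C b n)"
    define S where "S = (\<Sum>n<N. (cmod (c n))\<^sup>2)"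
    have "X v = (\<Sum>n<N. c n *\<^sub>C X (b n))"
      by (simp add: v_def linear_sum[OF bounded_linear.linear[OF bX]] bounded_operatorsD(2)[OF X])
    then have "cinner y (X v) = (\<Sum>n<N. cnj (c n) * c n)"
      by (simp add: cinner_sum_right cinner_scaleC_right c_def)
    also have "\<dots> = complex_of_real S"
      by (simp add: S_def complex_norm_square mult.commute del: of_real_power)
    finally have "S \<le> norm y * norm (X v)"
      using cinner_cauchy_schwarz[of y "X v"] by (simp add: norm_of_real abs_le_iff)
    also have "\<dots> \<le> norm y * (norm v * K)" by (intro mult_left_mono K) simp
    finally have "S \<le> (norm y * K) * norm v" by (simp add: mult_ac)
    moreover have S0: "0 \<le> S" by (simp add: S_def sum_nonneg)
    ultimately have "S\<^sup>2 \<le> ((norm y * K) * norm v)\<^sup>2" by (intro power_mono)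
    also have "\<dots> = (norm y * K)\<^sup>2 * (norm v)\<^sup>2" by (rule power_mult_distrib)
    also have "\<dots> \<le> (norm y * K)\<^sup>2 * S"
      unfolding v_def S_def
      by (intro mult_left_mono orth_family_sum_bound orthonormal_basisD(1)[OF b]) auto
    finally have "S * S \<le> (norm y * K)\<^sup>2 * S" by (simp add: power2_eq_square)
    then have "S \<le> (norm y * K)\<^sup>2"
      using S0 by (cases "S = 0") (auto simp: mult_le_cancel_right)
    then show ?thesis by (simp add: S_def)
  qed
  have "summable (\<lambda>n. (cmod (c n))\<^sup>2)"
    by (rule summableI_nonneg_bounded[OF _ bound]) simp
  then obtain z where z: "(\<lambda>n. c n *\<^sub>C b n) sums z"
    using orth_family_summable[OF orthonormal_basisD(1)[OF b]] summable_sums by blast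
  have "cinner (X x) y = cinner x z" for x
  proof -
    have 1: "(\<lambda>n. cinner (X (cinner x (b n) *\<^sub>C b n)) y) sums cinner (X x) y"
      by (rule bounded_linear.sums[OF bounded_linear_cinner_left
            bounded_linear.sums[OF bX orthonormal_basis_sums[OF b]]])
    have 2: "(\<lambda>n. cinner x (c n *\<^sub>C b n)) sums cinner x z"
      by (rule bounded_linear.sums[OF bounded_linear_cinner_right z])
    have "(\<lambda>n. cinner (X (cinner x (b n) *\<^sub>C b n)) y) = (\<lambda>n. cinner x (c n *\<^sub>C b n))"
    proof
      fix n
      have "cinner (X (b n)) y = cnj (c n)" unfolding c_def by (rule cinner_commute)
      then show "cinner (X (cinner x (b n) *\<^sub>C b n)) y = cinner x (c n *\<^sub>C b n)"
        by (simp add: bounded_operatorsD(2)[OF X] cinner_scaleC_left cinner_scaleC_right mult.commute)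
    qed
    with 1 2 show ?thesis by (simp add: sums_unique2)
  qed
  then show ?thesis by blast
qed

subsection \<open>Ideals and their characteristic sets\<close>

lemma operator_idealD:
  assumes "operator_ideal I"
  shows "X \<in> I \<Longrightarrow> X \<in> bounded_operators" "I \<noteq> bounded_operators" "(\<lambda>_. 0) \<in> I"
    "X \<in> I \<Longrightarrow> Y \<in> I \<Longrightarrow> (\<lambda>x. X x + Y x) \<in> I"
    "X \<in> I \<Longrightarrow> A \<in> bounded_operators \<Longrightarrow> A \<circ> X \<in> I"
    "X \<in> I \<Longrightarrow> A \<in> bounded_operators \<Longrightarrow> X \<circ> A \<in> I"
  using assms by (auto simp: operator_ideal_def)

text \<open>
  A noncompact operator is bounded below on an orthonormal sequence that it maps to an
  orthogonal one, hence the identity factors through it.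
\<close>

theorem operator_ideal_compact:
  fixes I :: "('a::complex_hilbert_space \<Rightarrow> 'a) set" and b :: "nat \<Rightarrow> 'a"
  assumes b: "orthonormal_basis b" and I: "operator_ideal I" and XI: "X \<in> I"
  shows "X \<in> compact_operators"
proof (rule ccontr)
  assume nc: "X \<notin> compact_operators"
  have X: "X \<in> bounded_operators" using operator_idealD(1)[OF I XI] .
  note lin = linear_simps[OF bounded_operatorsD(1)[OF X]]
  obtain K where K: "\<And>x. norm (X x) \<le> norm x * K"
    using bounded_linear.bounded[OF bounded_operatorsD(1)[OF X]] by blast
  obtain \<epsilon> where \<epsilon>: "\<epsilon> > 0"
    "\<And>F. finite F \<Longrightarrow> \<exists>x. (\<forall>f\<in>F. cinner x f = 0) \<and> norm (X x) > \<epsilon> * norm x"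
    using nc compact_operatorI[OF X] by (meson not_le)
  obtain Z where Z: "\<And>x y. cinner (X x) y = cinner x (Z y)"
    using adjoint_vector_exists[OF b X] by metis
  let ?P = "\<lambda>(n::nat) F x. norm x = 1 \<and> norm (X x) > \<epsilon> \<and>
    (\<forall>f\<in>F. cinner x f = 0) \<and> (\<forall>f\<in>F. cinner (X x) (X f) = 0)"
  have "\<exists>x. ?P n F x" if "finite F" for n F
  proof -
    \<comment> \<open>Orthogonality of x to Z (X f) is orthogonality of the images X x and X f,
      since Z represents the adjoint.\<close>
    have "finite (F \<union> (\<lambda>f. Z (X f)) ` F)" using that by simp
    from \<epsilon>(2)[OF this] obtain x where x: "\<forall>f\<in>F. cinner x f = 0" "\<forall>f\<in>F. cinner x (Z (X f)) = 0"
      "norm (X x) > \<epsilon> * norm x" by auto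
    have x0: "norm x > 0" using x(3) by (auto simp: lin)
    define u where "u = (1 / norm x) *\<^sub>R x"
    have "norm u = 1" using x0 by (simp add: u_def)
    moreover have "norm (X u) > \<epsilon>" using x(3) x0 by (simp add: u_def lin divide_simps mult.commute)
    moreover have "\<forall>f\<in>F. cinner u f = 0" using x(1) by (simp add: u_def cinner_scaleR_left)
    moreover have "\<forall>f\<in>F. cinner (X u) (X f) = 0"
      using x(2) by (simp add: Z u_def cinner_scaleR_left)
    ultimately show ?thesis by blast
  qed
  then obtain e where P: "\<And>n. ?P n (e ` {..<n}) (e n)"
    using greedy_sequence[of ?P] by blast
  have e: "orth_family e" using P by (intro orth_familyI_less) auto
  have Xe0: "norm (X (e n)) > 0" for n using P[of n] \<epsilon>(1) by linarith
  define f where "f n = complex_of_real (1 / norm (X (e n))) *\<^sub>C X (e n)" for n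
  have f1: "norm (f n) = 1" for n
    using Xe0[of n] by (simp add: f_def norm_scaleC norm_divide)
  have f: "orth_family f"
    using P f1 by (intro orth_familyI_less)
      (auto simp: f_def cinner_scaleC_left cinner_scaleC_right)
  note bb = orthonormal_basisD(1)[OF b]
  \<comment> \<open>This operator carries the basis to \<open>e\<close>, and the one in
    \<open>B\<close> below carries the normalised images back with weights
    \<open>1 / norm (X (e n))\<close>; with X in between they compose to the identity. The lower
    bound \<epsilon> keeps the weights bounded.\<close>
  have A: "schmidt (\<lambda>_. 1) b e \<in> bounded_operators"
    by (rule schmidt_bounded_operator[OF bb e, of _ 1]) simp
  have inv: "\<forall>n. \<bar>1 / norm (X (e n))\<bar> \<le> 1 / \<epsilon>"
    using P \<epsilon>(1) by (auto simp: frac_le less_imp_le)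
  have B: "schmidt (\<lambda>n. 1 / norm (X (e n))) f b \<in> bounded_operators"
    by (rule schmidt_bounded_operator[OF f bb inv])
  have Kn: "\<forall>n. \<bar>norm (X (e n))\<bar> \<le> K" using K P by (metis abs_norm_cancel mult_1)
  have "X \<circ> schmidt (\<lambda>_. 1) b e = schmidt (\<lambda>n. norm (X (e n))) b f"
  proof
    fix x
    have "X (schmidt (\<lambda>_. 1) b e x) = (\<Sum>n. (complex_of_real 1 * cinner x (b n)) *\<^sub>C X (e n))"
      by (rule bounded_operator_schmidt[OF X bb e, of _ 1]) simp
    also have "X (e n) = complex_of_real (norm (X (e n))) *\<^sub>C f n" for n
      using Xe0[of n] by (simp add: f_def scaleC_scaleC)
    then have "(\<lambda>n. (complex_of_real 1 * cinner x (b n)) *\<^sub>C X (e n))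
        = (\<lambda>n. (complex_of_real (norm (X (e n))) * cinner x (b n)) *\<^sub>C f n)"
      by (metis (no_types, opaque_lifting) scaleC_scaleC mult.commute mult_1 of_real_1)
    finally show "(X \<circ> schmidt (\<lambda>_. 1) b e) x = schmidt (\<lambda>n. norm (X (e n))) b f x"
      by (simp add: schmidt_def)
  qed
  then have "schmidt (\<lambda>n. 1 / norm (X (e n))) f b \<circ> (X \<circ> schmidt (\<lambda>_. 1) b e)
      = schmidt (\<lambda>n. 1 / norm (X (e n)) * norm (X (e n)) * (norm (f n))\<^sup>2) b b"
    using schmidt_compose[OF bb f Kn] by simp
  also have "(\<lambda>n. 1 / norm (X (e n)) * norm (X (e n)) * (norm (f n))\<^sup>2) = (\<lambda>_. 1)"
    using Xe0 by (force simp: f1)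
  finally have "schmidt (\<lambda>n. 1 / norm (X (e n))) f b \<circ> (X \<circ> schmidt (\<lambda>_. 1) b e) = id"
    using orthonormal_basis_expansion[OF b] by (simp only: id_def fun_eq_iff) simp
  then have "id \<in> I"
    using operator_idealD(5)[OF I operator_idealD(6)[OF I XI A] B] by simp
  then have "T \<in> I" if "T \<in> bounded_operators" for T
    using operator_idealD(5)[OF I _ that] by force
  then have "I = bounded_operators" using operator_idealD(1)[OF I] by blast
  then show False using operator_idealD(2)[OF I] by simp
qed

text \<open>The smaller operator factors through the larger one: a contraction takes e to g, the
  larger operator acts, and the weights \<open>s n / t n \<le> 1\<close> take h to f.\<close>

lemma schmidt_in_ideal:
  assumes I: "operator_ideal I" and Y: "schmidt t g h \<in> I"
    and X: "schmidt_system s e f" and sys: "schmidt_system t g h" and le: "\<And>n. s n \<le> t n"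
  shows "schmidt s e f \<in> I"
proof -
  note Dt = schmidt_systemD[OF sys] and Ds = schmidt_systemD[OF X]
  \<comment> \<open>Where \<open>t n = 0\<close> also \<open>s n = 0\<close>, and the quotient is 0
    by convention, so the product with \<open>t n\<close> is always \<open>s n\<close>.\<close>
  define q where "q n = s n / t n" for n
  have q: "\<forall>n. \<bar>q n\<bar> \<le> 1"
    using le Ds(7) Dt(7) by (auto simp: q_def divide_le_eq_1 order_less_le)
  have "schmidt t g h \<circ> schmidt (\<lambda>_. 1) e g = schmidt (\<lambda>n. t n * 1 * (norm (g n))\<^sup>2) e h"
    by (rule schmidt_compose[OF Ds(2) Dt(2), of _ 1]) simp
  also have "(\<lambda>n. t n * 1 * (norm (g n))\<^sup>2) = t"
    using Dt(5) by force
  finally have eq: "schmidt t g h \<circ> schmidt (\<lambda>_. 1) e g = schmidt t e h" .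
  have "schmidt q h f \<circ> (schmidt t g h \<circ> schmidt (\<lambda>_. 1) e g)
      = schmidt (\<lambda>n. q n * t n * (norm (h n))\<^sup>2) e f"
    unfolding eq by (rule schmidt_compose[OF Ds(2) Dt(3,4)])
  also have "(\<lambda>n. q n * t n * (norm (h n))\<^sup>2) = s"
  proof
    fix n show "q n * t n * (norm (h n))\<^sup>2 = s n"
      using le[of n] Ds(7)[of n] Dt(6)[of n] by (cases "t n = 0") (auto simp: q_def)
  qed
  finally have "schmidt s e f = schmidt q h f \<circ> (schmidt t g h \<circ> schmidt (\<lambda>_. 1) e g)" ..
  moreover have "schmidt q h f \<in> bounded_operators"
    by (rule schmidt_bounded_operator[OF Dt(3) Ds(3) q])
  moreover have "schmidt (\<lambda>_. 1) e g \<in> bounded_operators"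
    by (rule schmidt_bounded_operator[OF Ds(2) Dt(2), of _ 1]) simp
  ultimately show ?thesis
    using operator_idealD(5,6)[OF I] Y by simp
qed

text \<open>The sequence side of a nonzero ideal. Nonvanishing is expressed at index 0, where the
  largest entry sits; the ampliation listed is the doubling, because entries are later spread over
  two sequences.\<close>

definition calkin_cone :: "(nat \<Rightarrow> real) set \<Rightarrow> bool" where
  "calkin_cone S \<longleftrightarrow> S \<subseteq> c0_star \<and> (\<exists>\<xi>\<in>S. \<xi> 0 > 0) \<and>
     (\<forall>\<eta>\<in>S. \<forall>\<xi>\<in>c0_star. (\<forall>n. \<xi> n \<le> \<eta> n) \<longrightarrow> \<xi> \<in> S) \<and>
     (\<forall>\<xi>\<in>S. \<forall>\<eta>\<in>S. (\<lambda>n. \<xi> n + \<eta> n) \<in> S) \<and>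
     (\<forall>\<xi>\<in>S. (\<lambda>n. \<xi> (n div 2)) \<in> S)"

lemma calkin_coneD:
  assumes "calkin_cone S"
  shows "\<xi> \<in> S \<Longrightarrow> \<xi> \<in> c0_star"
    and "\<exists>\<xi>\<in>S. \<xi> 0 > 0"
    and "\<eta> \<in> S \<Longrightarrow> \<xi> \<in> c0_star \<Longrightarrow> (\<And>n. \<xi> n \<le> \<eta> n) \<Longrightarrow> \<xi> \<in> S"
    and "\<xi> \<in> S \<Longrightarrow> \<eta> \<in> S \<Longrightarrow> (\<lambda>n. \<xi> n + \<eta> n) \<in> S"
    and "\<xi> \<in> S \<Longrightarrow> (\<lambda>n. \<xi> (n div 2)) \<in> S"
  using assms by (auto simp: calkin_cone_def)

lemma c0_star_add:
  assumes "\<xi> \<in> c0_star" "\<eta> \<in> c0_star"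
  shows "(\<lambda>n. \<xi> n + \<eta> n) \<in> c0_star"
  using c0_starD[OF assms(1)] c0_starD[OF assms(2)] tendsto_add[OF c0_starD(3)[OF assms(1)] c0_starD(3)[OF assms(2)]]
  by (auto simp: c0_star_def decseq_def add_mono)

lemma c0_star_cmult:
  assumes "\<xi> \<in> c0_star" "0 \<le> C"
  shows "(\<lambda>n. C * \<xi> n) \<in> c0_star"
  using c0_starD[OF assms(1)] assms(2) tendsto_mult_right_zero[OF c0_starD(3)[OF assms(1)], of C]
  by (auto simp: c0_star_def decseq_def mult_left_mono)

lemma div2_filterlim: "filterlim (\<lambda>n::nat. n div 2) at_top sequentially"
  unfolding filterlim_at_top eventually_sequentially
proof
  fix Z :: nat
  show "\<exists>N. \<forall>n\<ge>N. Z \<le> n div 2" by (rule exI[of _ "2 * Z"]) auto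
qed

lemma c0_star_ampliation:
  assumes "\<xi> \<in> c0_star"
  shows "(\<lambda>n. \<xi> (n div 2)) \<in> c0_star"
  using c0_starD[OF assms] filterlim_compose[OF c0_starD(3)[OF assms] div2_filterlim]
  by (auto simp: c0_star_def decseq_def div_le_mono)

text \<open>Addition gives integer multiples, and solidity fills in the factors between
  them.\<close>

lemma calkin_cone_cmult:
  assumes "calkin_cone S" "\<xi> \<in> S" "0 \<le> C"
  shows "(\<lambda>n. C * \<xi> n) \<in> S"
proof -
  note D = calkin_coneD[OF assms(1)]
  have nat: "(\<lambda>n. real (Suc k) * \<xi> n) \<in> S" for k
  proof (induction k)
    case (Suc k)
    from D(4)[OF Suc assms(2)] show ?case by (simp add: algebra_simps)
  qed (use assms(2) in simp)
  obtain k where k: "C \<le> real k" using real_arch_simple by blast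
  show ?thesis
  proof (rule D(3)[OF nat[of k] c0_star_cmult[OF D(1)[OF assms(2)] assms(3)]])
    show "C * \<xi> n \<le> real (Suc k) * \<xi> n" for n
      using k c0_starD(2)[OF D(1)[OF assms(2)]] by (intro mult_right_mono) auto
  qed
qed

lemma arith_mean_c0_star:
  assumes "\<xi> \<in> c0_star"
  shows "arith_mean \<xi> \<in> c0_star"
proof -
  note D = c0_starD[OF assms]
  have nonneg: "0 \<le> arith_mean \<xi> n" for n by (simp add: arith_mean_def sum_nonneg D(2))
  have dec: "decseq (arith_mean \<xi>)"
  proof (rule decseq_SucI)
    fix n
    have "real (n + 1) * \<xi> (Suc n) = (\<Sum>j\<le>n. \<xi> (Suc n))" by simp
    also have "\<dots> \<le> (\<Sum>j\<le>n. \<xi> j)" using decseqD[OF D(1)] by (intro sum_mono) auto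
    finally show "arith_mean \<xi> (Suc n) \<le> arith_mean \<xi> n"
      by (simp add: arith_mean_def field_simps)
  qed
  obtain L where L: "arith_mean \<xi> \<longlonglongrightarrow> L"
    using decseq_convergent[OF dec, of 0] nonneg by blast
  have "L \<le> \<xi> N" for N
  proof (rule LIMSEQ_le[OF L])
    have "(\<lambda>n. real N * \<xi> 0 * inverse (real (Suc n)) + \<xi> N) \<longlonglongrightarrow> real N * \<xi> 0 * 0 + \<xi> N"
      by (intro tendsto_intros LIMSEQ_inverse_real_of_nat)
    then show "(\<lambda>n. real N * \<xi> 0 * inverse (real (Suc n)) + \<xi> N) \<longlonglongrightarrow> \<xi> N" by simp
    have "arith_mean \<xi> n \<le> real N * \<xi> 0 * inverse (real (Suc n)) + \<xi> N" if "n \<ge> N" for n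
    proof -
      \<comment> \<open>The sum is split at N: earlier terms are at most \<open>\<xi> 0\<close>, all
        others at most \<open>\<xi> N\<close>. The first contribution disappears in the mean as n
        grows, leaving L \<le> \<open>\<xi> N\<close>.\<close>
      have "(\<Sum>j\<le>n. \<xi> j) \<le> (\<Sum>j\<le>n. (if j < N then \<xi> 0 else 0) + \<xi> N)"
        using decseqD[OF D(1)] D(2) by (intro sum_mono) (auto simp: add_increasing2)
      also have "\<dots> = real N * \<xi> 0 + real (Suc n) * \<xi> N"
      proof -
        have "{..n} \<inter> {j. j < N} = {..<N}" using that by auto
        then show ?thesis by (simp add: sum.distrib sum.If_cases)
      qed
      finally have "(\<Sum>j\<le>n. \<xi> j) / real (Suc n)
          \<le> (real N * \<xi> 0 + real (Suc n) * \<xi> N) / real (Suc n)" by (rule divide_right_mono) simp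
      then show ?thesis by (simp add: arith_mean_def add_divide_distrib inverse_eq_divide del: of_nat_Suc)
    qed
    then show "\<exists>N'. \<forall>n\<ge>N'. arith_mean \<xi> n \<le> real N * \<xi> 0 * inverse (real (Suc n)) + \<xi> N" by blast
  qed
  then have "L \<le> 0" by (intro LIMSEQ_le_const[OF D(3)]) auto
  moreover have "0 \<le> L" using LIMSEQ_le_const[OF L] nonneg by blast
  ultimately show ?thesis using L dec nonneg by (simp add: c0_star_def)
qed

lemma schmidt_system_basis:
  assumes "orthonormal_basis b" "\<xi> \<in> c0_star"
  shows "schmidt_system \<xi> b b"
  using assms by (simp add: schmidt_system_def orthonormal_basis_def)

section \<open>Passage between operators and sequences by diagonal operators\<close>

context
  fixes I :: "('a::complex_hilbert_space \<Rightarrow> 'a) set" and b :: "nat \<Rightarrow> 'a"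
  assumes inf: "\<not> (\<exists>B :: 'a set. finite B \<and> complex_vector.span B = UNIV)"
    and b: "orthonormal_basis b"
begin

lemma singular_numbers_c0_star:
  assumes "X \<in> (compact_operators :: ('a \<Rightarrow> 'a) set)"
  shows "singular_numbers X \<in> c0_star"
proof -
  obtain s e f where sys: "schmidt_system s e f" and X: "X = schmidt s e f"
    using singular_value_decomposition[OF inf assms] by blast
  show ?thesis using singular_numbers_schmidt[OF sys] schmidt_systemD(1)[OF sys] X by simp
qed

text \<open>Each \<xi> in T is realised by the diagonal operator \<open>schmidt \<xi> b b\<close>.
  As T is an arbitrary set of decreasing null sequences, the intermediate sets of the am-closure can
  be handled without first showing that they come from ideals.\<close>

lemma characteristic_set_ideal_of_characteristic_set:
  assumes "T \<subseteq> c0_star"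
  shows "characteristic_set (ideal_of_characteristic_set T :: ('a \<Rightarrow> 'a) set) = T"
proof (intro equalityI subsetI)
  fix \<xi> assume \<xi>: "\<xi> \<in> T"
  then have "\<xi> \<in> c0_star" using assms by blast
  then have "schmidt \<xi> b b \<in> compact_operators" "singular_numbers (schmidt \<xi> b b) = \<xi>"
    using schmidt_compact orthonormal_basisD(1)[OF b]
      singular_numbers_schmidt[OF schmidt_system_basis[OF b]] by blast+
  then show "\<xi> \<in> characteristic_set (ideal_of_characteristic_set T :: ('a \<Rightarrow> 'a) set)"
    using \<xi> unfolding characteristic_set_def ideal_of_characteristic_set_def
    by (intro image_eqI[of _ _ "schmidt \<xi> b b"]) auto
qed (auto simp: characteristic_set_def ideal_of_characteristic_set_def)

context
  assumes I: "operator_ideal I"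
begin

lemma compact_in_ideal:
  assumes "X \<in> compact_operators" "\<eta> \<in> characteristic_set I" "\<And>n. singular_numbers X n \<le> \<eta> n"
  shows "X \<in> I"
proof -
  obtain Y where Y: "Y \<in> I" "\<eta> = singular_numbers Y"
    using assms(2) by (auto simp: characteristic_set_def)
  obtain s e f where X': "schmidt_system s e f" "X = schmidt s e f"
    using singular_value_decomposition[OF inf assms(1)] by blast
  obtain t g h where Y': "schmidt_system t g h" "Y = schmidt t g h"
    using singular_value_decomposition[OF inf operator_ideal_compact[OF b I Y(1)]] by blast
  show ?thesis
    using schmidt_in_ideal[OF I _ X'(1) Y'(1)] assms(3) X' Y Y' by (simp add: singular_numbers_schmidt)
qed

lemma schmidt_in_ideal_iff:
  assumes sys: "schmidt_system \<xi> e f"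
  shows "schmidt \<xi> e f \<in> I \<longleftrightarrow> \<xi> \<in> characteristic_set I"
proof
  note D = schmidt_systemD[OF sys]
  assume "\<xi> \<in> characteristic_set I"
  then show "schmidt \<xi> e f \<in> I"
    by (intro compact_in_ideal[OF schmidt_compact[OF D(1,2,3)]])
      (auto simp: singular_numbers_schmidt[OF sys])
next
  assume "schmidt \<xi> e f \<in> I"
  then have "singular_numbers (schmidt \<xi> e f) \<in> characteristic_set I"
    by (simp add: characteristic_set_def)
  then show "\<xi> \<in> characteristic_set I" by (simp add: singular_numbers_schmidt[OF sys])
qed

lemma ideal_eq_ideal_of_characteristic_set:
  "I = ideal_of_characteristic_set (characteristic_set I)"
  using compact_in_ideal operator_ideal_compact[OF b I]
  by (auto simp: ideal_of_characteristic_set_def characteristic_set_def)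

lemma characteristic_set_c0_star: "characteristic_set I \<subseteq> c0_star"
  using singular_numbers_c0_star operator_ideal_compact[OF b I]
  by (auto simp: characteristic_set_def)

text \<open>Copies of the diagonal operator on the even and on the odd basis vectors add up to the
  ampliated one, by regrouping the series in pairs.\<close>

lemma schmidt_ampliation:
  assumes "\<xi> \<in> c0_star"
  shows "(\<lambda>x. schmidt \<xi> (\<lambda>n. b (2 * n)) (\<lambda>n. b (2 * n)) x
      + schmidt \<xi> (\<lambda>n. b (2 * n + 1)) (\<lambda>n. b (2 * n + 1)) x)
    = schmidt (\<lambda>n. \<xi> (n div 2)) b b"
proof
  fix x
  note bb = orthonormal_basisD(1)[OF b]
  have bound: "\<forall>n. \<bar>\<xi> n\<bar> \<le> \<xi> 0" using c0_star_abs_le[OF assms] by blast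
  have b0: "orth_family (\<lambda>n. b (2 * n))" "orth_family (\<lambda>n. b (2 * n + 1))"
    using bb by (auto simp: orth_family_def)
  define h where "h n = (complex_of_real (\<xi> (n div 2)) * cinner x (b n)) *\<^sub>C b n" for n
  have "\<forall>n. \<bar>\<xi> (n div 2)\<bar> \<le> \<xi> 0" using bound by blast
  then have h: "summable h" unfolding h_def by (rule schmidt_summable[OF bb bb])
  have "(\<lambda>n. sum h {n * 2..<n * 2 + 2}) sums suminf h"
    by (rule sums_group[OF summable_sums[OF h]]) simp
  moreover have "{n * 2..<n * 2 + 2} = {2 * n, 2 * n + 1}" for n :: nat by auto
  ultimately have "(\<lambda>n. h (2 * n) + h (2 * n + 1)) sums suminf h" by (simp add: mult.commute)
  moreover have "(\<lambda>n. h (2 * n) + h (2 * n + 1)) sums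
      (schmidt \<xi> (\<lambda>n. b (2 * n)) (\<lambda>n. b (2 * n)) x
      + schmidt \<xi> (\<lambda>n. b (2 * n + 1)) (\<lambda>n. b (2 * n + 1)) x)"
    using sums_add[OF summable_sums[OF schmidt_summable[OF b0(1) b0(1) bound, of x]]
        summable_sums[OF schmidt_summable[OF b0(2) b0(2) bound, of x]]]
    by (simp add: schmidt_def h_def)
  ultimately show "schmidt \<xi> (\<lambda>n. b (2 * n)) (\<lambda>n. b (2 * n)) x
      + schmidt \<xi> (\<lambda>n. b (2 * n + 1)) (\<lambda>n. b (2 * n + 1)) x
    = schmidt (\<lambda>n. \<xi> (n div 2)) b b x"
    unfolding schmidt_def[of _ b b] h_def by (rule sums_unique2[symmetric])
qed

text \<open>Diagonal operators in the common basis b turn sums of sequences into sums of operators,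
  so singular numbers of general sums need not be estimated.\<close>

theorem calkin_cone_characteristic_set:
  assumes "I \<noteq> {\<lambda>_. 0}"
  shows "calkin_cone (characteristic_set I)"
  unfolding calkin_cone_def
proof (intro conjI ballI impI)
  show "characteristic_set I \<subseteq> c0_star" by (rule characteristic_set_c0_star)
  note iff = schmidt_in_ideal_iff[OF schmidt_system_basis[OF b]]
  note bb = orthonormal_basisD(1)[OF b]
  show "\<exists>\<xi>\<in>characteristic_set I. \<xi> 0 > 0"
  proof -
    obtain X where X: "X \<in> I" "X \<noteq> (\<lambda>_. 0)"
      using assms operator_idealD(3)[OF I] by blast
    obtain s e f where sys: "schmidt_system s e f" and Xs: "X = schmidt s e f"
      using singular_value_decomposition[OF inf operator_ideal_compact[OF b I X(1)]] by blast
    note D = schmidt_systemD[OF sys]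
    have "s 0 \<noteq> 0"
    proof
      assume "s 0 = 0"
      then have "s n = 0" for n using D(4,7) by (metis abs_le_zero_iff)
      then have "X = (\<lambda>_. 0)" by (simp add: Xs schmidt_def fun_eq_iff)
      then show False using X(2) by simp
    qed
    then have "s 0 > 0" using D(7)[of 0] by simp
    moreover have "s \<in> characteristic_set I" using schmidt_in_ideal_iff[OF sys] X(1) Xs by simp
    ultimately show ?thesis by blast
  qed
  fix \<eta> assume \<eta>: "\<eta> \<in> characteristic_set I"
  then have \<eta>0: "\<eta> \<in> c0_star" using characteristic_set_c0_star by blast
  {
    fix \<xi> assume \<xi>: "\<xi> \<in> c0_star" "\<forall>n. \<xi> n \<le> \<eta> n"
    have "schmidt \<xi> b b \<in> I"
      using \<xi> by (intro compact_in_ideal[OF schmidt_compact[OF \<xi>(1) bb bb] \<eta>])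
        (simp add: singular_numbers_schmidt[OF schmidt_system_basis[OF b \<xi>(1)]])
    then show "\<xi> \<in> characteristic_set I" using iff[OF \<xi>(1)] by simp
  }
  {
    fix \<zeta> assume \<zeta>: "\<zeta> \<in> characteristic_set I"
    then have \<zeta>0: "\<zeta> \<in> c0_star" using characteristic_set_c0_star by blast
    have bound: "\<forall>n. \<bar>\<eta> n\<bar> \<le> \<eta> 0" "\<forall>n. \<bar>\<zeta> n\<bar> \<le> \<zeta> 0"
      using c0_star_abs_le \<eta>0 \<zeta>0 by blast+
    have "(\<lambda>x. schmidt \<eta> b b x + schmidt \<zeta> b b x) = schmidt (\<lambda>n. \<eta> n + \<zeta> n) b b"
      unfolding schmidt_def suminf_add[OF schmidt_summable[OF bb bb bound(1)]
          schmidt_summable[OF bb bb bound(2)]]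
      by (simp add: scaleC_add_left distrib_right)
    moreover have "(\<lambda>x. schmidt \<eta> b b x + schmidt \<zeta> b b x) \<in> I"
      using \<eta> \<zeta> iff[OF \<eta>0] iff[OF \<zeta>0] by (intro operator_idealD(4)[OF I]) auto
    ultimately show "(\<lambda>n. \<eta> n + \<zeta> n) \<in> characteristic_set I"
      using iff[OF c0_star_add[OF \<eta>0 \<zeta>0]] by simp
  }
  have "schmidt_system \<eta> (\<lambda>n. b (2 * n)) (\<lambda>n. b (2 * n))"
    "schmidt_system \<eta> (\<lambda>n. b (2 * n + 1)) (\<lambda>n. b (2 * n + 1))"
    using \<eta>0 bb orthonormal_basisD(2)[OF b] by (auto simp: schmidt_system_def orth_family_def)
  then have "(\<lambda>x. schmidt \<eta> (\<lambda>n. b (2 * n)) (\<lambda>n. b (2 * n)) x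
      + schmidt \<eta> (\<lambda>n. b (2 * n + 1)) (\<lambda>n. b (2 * n + 1)) x) \<in> I"
    using \<eta> schmidt_in_ideal_iff by (intro operator_idealD(4)[OF I]) auto
  then show "(\<lambda>n. \<eta> (n div 2)) \<in> characteristic_set I"
    unfolding schmidt_ampliation[OF \<eta>0] using iff[OF c0_star_ampliation[OF \<eta>0]] by simp
qed

lemma trace_class_subset_iff:
  "trace_class \<subseteq> I \<longleftrightarrow> (\<forall>\<xi>\<in>c0_star. summable \<xi> \<longrightarrow> \<xi> \<in> characteristic_set I)"
proof
  assume sub: "trace_class \<subseteq> I"
  show "\<forall>\<xi>\<in>c0_star. summable \<xi> \<longrightarrow> \<xi> \<in> characteristic_set I"
  proof (intro ballI impI)
    fix \<xi> :: "nat \<Rightarrow> real" assume \<xi>: "\<xi> \<in> c0_star" "summable \<xi>"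
    note sys = schmidt_system_basis[OF b \<xi>(1)]
    have "schmidt \<xi> b b \<in> trace_class"
      using schmidt_compact[OF \<xi>(1)] orthonormal_basisD(1)[OF b] \<xi>(2)
      by (simp add: trace_class_def singular_numbers_schmidt[OF sys])
    then show "\<xi> \<in> characteristic_set I" using sub schmidt_in_ideal_iff[OF sys] by blast
  qed
next
  assume "\<forall>\<xi>\<in>c0_star. summable \<xi> \<longrightarrow> \<xi> \<in> characteristic_set I"
  then have "X \<in> I" if "X \<in> trace_class" for X
    using that singular_numbers_c0_star by (intro compact_in_ideal) (auto simp: trace_class_def)
  then show "trace_class \<subseteq> I" by blast
qed

text \<open>Unfolding both mean operations on sequences leaves one inclusion to test, since \<xi>
  itself with C = 1 shows that the closure always contains the ideal.\<close>

theorem am_closed_iff: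
  "am_closed I \<longleftrightarrow> (\<forall>\<xi>\<in>c0_star.
     (\<exists>\<eta>\<in>characteristic_set I. \<exists>C. \<forall>n. arith_mean \<xi> n \<le> C * arith_mean \<eta> n)
       \<longrightarrow> \<xi> \<in> characteristic_set I)"
proof -
  define T1 where "T1 = {\<xi> \<in> c0_star. \<exists>\<eta>\<in>characteristic_set I. \<exists>C. \<forall>n. \<xi> n \<le> C * arith_mean \<eta> n}"
  have "characteristic_set (am_ideal I) = T1"
    unfolding am_ideal_def T1_def
    by (rule characteristic_set_ideal_of_characteristic_set) auto
  define T2 where "T2 = {\<xi> \<in> c0_star. arith_mean \<xi> \<in> T1}"
  have cl: "am_closure I = ideal_of_characteristic_set T2"
    unfolding am_closure_def pre_am_ideal_def T2_def \<open>characteristic_set (am_ideal I) = T1\<close> ..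
  have "am_closed I \<longleftrightarrow> characteristic_set I = T2"
  proof
    assume "am_closed I"
    then have eq: "I = ideal_of_characteristic_set T2" by (simp add: am_closed_def cl)
    have "characteristic_set (ideal_of_characteristic_set T2 :: ('a \<Rightarrow> 'a) set) = T2"
      by (rule characteristic_set_ideal_of_characteristic_set) (auto simp: T2_def)
    then show "characteristic_set I = T2" unfolding eq[symmetric] .
  next
    assume "characteristic_set I = T2"
    then show "am_closed I"
      using ideal_eq_ideal_of_characteristic_set unfolding am_closed_def cl by metis
  qed
  also have "\<dots> \<longleftrightarrow> T2 \<subseteq> characteristic_set I"
  proof -
    have "\<xi> \<in> T2" if "\<xi> \<in> characteristic_set I" for \<xi>
    proof -
      have "\<xi> \<in> c0_star" using characteristic_set_c0_star that by blast
      moreover have "\<forall>n. arith_mean \<xi> n \<le> 1 * arith_mean \<xi> n" by simp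
      ultimately show ?thesis
        using that arith_mean_c0_star unfolding T2_def T1_def by blast
    qed
    then show ?thesis by blast
  qed
  also have "\<dots> \<longleftrightarrow> (\<forall>\<xi>\<in>c0_star.
     (\<exists>\<eta>\<in>characteristic_set I. \<exists>C. \<forall>n. arith_mean \<xi> n \<le> C * arith_mean \<eta> n)
       \<longrightarrow> \<xi> \<in> characteristic_set I)"
    using arith_mean_c0_star by (auto simp: T2_def T1_def)
  finally show ?thesis .
qed

end

end

subsection \<open>Rearrangements\<close>

lemma tendsto_zeroI_finite_ge:
  fixes \<rho> :: "nat \<Rightarrow> real"
  assumes "\<And>n. 0 \<le> \<rho> n" "\<And>t. t > 0 \<Longrightarrow> finite {n. t \<le> \<rho> n}"
  shows "\<rho> \<longlonglongrightarrow> 0"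
proof (rule order_tendstoI)
  fix t :: real assume "t > 0"
  then have "finite {n. \<not> \<rho> n < t}" using assms(2) by (simp add: not_less)
  then show "\<forall>\<^sub>F n in sequentially. \<rho> n < t"
    by (simp add: cofinite_eq_sequentially[symmetric] eventually_cofinite)
next
  fix t :: real assume "t < 0"
  then show "\<forall>\<^sub>F n in sequentially. t < \<rho> n"
    using assms(1) by (intro always_eventually allI) (meson less_le_trans)
qed

text \<open>Each stage takes the index of a largest remaining value. A positive value that was never
  taken would lie below infinitely many entries, which is impossible for a null sequence; indices of
  zeros may be missed, so \<open>i\<close> need not be surjective.\<close>

lemma rearrangementE:
  fixes \<rho> :: "nat \<Rightarrow> real"
  assumes nonneg: "\<And>n. 0 \<le> \<rho> n" and lim: "\<rho> \<longlonglongrightarrow> 0"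
  obtains i where "inj i" "\<And>n. \<rho> n > 0 \<Longrightarrow> n \<in> range i" "rearrangement \<rho> = \<rho> \<circ> i"
    "rearrangement \<rho> \<in> c0_star"
proof -
  let ?P = "\<lambda>(n::nat) F k. k \<notin> F \<and> (\<forall>j. j \<notin> F \<longrightarrow> \<rho> j \<le> \<rho> k)"
  have "\<exists>k. ?P n F k" if F: "finite F" for n F
  proof (cases "\<exists>j. j \<notin> F \<and> \<rho> j > 0")
    case True
    then obtain j where j: "j \<notin> F" "\<rho> j > 0" by blast
    define A where "A = {n. \<rho> j \<le> \<rho> n} - F"
    have A: "finite A" "j \<in> A"
      using finite_ge_of_tendsto_zero[OF lim j(2)] j(1) by (auto simp: A_def)
    then have "Max (\<rho> ` A) \<in> \<rho> ` A" by (intro Max_in) auto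
    then obtain k where k: "k \<in> A" "\<rho> k = Max (\<rho> ` A)" by auto
    have le: "\<rho> n \<le> \<rho> k" if "n \<in> A" for n using k(2) A(1) that by simp
    have "\<rho> n \<le> \<rho> k" if "n \<notin> F" for n
    proof (cases "\<rho> j \<le> \<rho> n")
      case True
      then show ?thesis using that by (intro le) (simp add: A_def)
    next
      case False
      then show ?thesis using le[OF A(2)] by simp
    qed
    moreover have "k \<notin> F" using k(1) by (simp add: A_def)
    ultimately show ?thesis by blast
  next
    case False
    obtain k where "k \<notin> F" using ex_new_if_finite[OF infinite_UNIV_nat F] by blast
    then show ?thesis using False nonneg by (meson not_le order_trans)
  qed
  then obtain i where P: "\<And>n. ?P n (i ` {..<n}) (i n)"
    using greedy_sequence[of ?P] by blast
  have inj: "inj i"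
  proof (rule linorder_injI)
    fix m n :: nat assume "m < n"
    then show "i m \<noteq> i n" using P[of n] by (metis image_eqI lessThan_iff)
  qed
  have fin: "finite {n. t \<le> \<rho> (i n)}" if "t > 0" for t
    using finite_vimageI[OF finite_ge_of_tendsto_zero[OF lim that] inj] by (simp add: vimage_def)
  have cover: "n \<in> range i" if "\<rho> n > 0" for n
  proof (rule ccontr)
    assume "n \<notin> range i"
    then have "\<rho> n \<le> \<rho> (i k)" for k using P[of k] by blast
    then have "{k. \<rho> n \<le> \<rho> (i k)} = UNIV" by blast
    then show False using fin[OF that] by simp
  qed
  have dec: "decseq (\<rho> \<circ> i)"
  proof (rule decseq_SucI)
    fix n
    have "i (Suc n) \<notin> i ` {..<n}" using P[of "Suc n"] by auto
    then show "(\<rho> \<circ> i) (Suc n) \<le> (\<rho> \<circ> i) n" using P[of n] by simp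
  qed
  have "(\<rho> \<circ> i) \<longlonglongrightarrow> 0"
    by (rule tendsto_zeroI_finite_ge) (use nonneg fin in auto)
  then have c0: "\<rho> \<circ> i \<in> c0_star" using dec nonneg by (simp add: c0_star_def)
  have "rearrangement \<rho> = \<rho> \<circ> i"
    unfolding rearrangement_def
  proof (rule decreasing_list_of_eqI[OF c0])
    fix t :: real assume "t > 0"
    then have "i ` {n. (\<rho> \<circ> i) n = t} = {n. \<rho> n = t}" using cover by auto
    moreover have "inj_on i {n. (\<rho> \<circ> i) n = t}" using inj by (rule inj_on_subset) simp
    ultimately show "card {n. (\<rho> \<circ> i) n = t} = card {n. \<rho> n = t}" by (metis card_image)
  qed
  then show ?thesis using that inj cover c0 by simp
qed

lemma rearrangement_c0_star: "\<xi> \<in> c0_star \<Longrightarrow> rearrangement \<xi> = \<xi>"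
  unfolding rearrangement_def by (rule decreasing_list_of_eqI) auto

lemma card_ge_rearrangement_le:
  fixes \<rho> :: "nat \<Rightarrow> real"
  assumes "\<And>n. 0 \<le> \<rho> n" "\<rho> \<longlonglongrightarrow> 0" and t: "t > 0" "rearrangement \<rho> n < t"
  shows "finite {k. t \<le> \<rho> k}" "card {k. t \<le> \<rho> k} \<le> n"
proof -
  obtain i where i: "inj i" "\<And>n. \<rho> n > 0 \<Longrightarrow> n \<in> range i" "rearrangement \<rho> = \<rho> \<circ> i"
    "rearrangement \<rho> \<in> c0_star" using rearrangementE[OF assms(1,2)] by blast
  have sub: "{k. t \<le> \<rho> k} \<subseteq> i ` {..<n}"
  proof
    fix k assume "k \<in> {k. t \<le> \<rho> k}"
    then have k: "t \<le> \<rho> k" by simp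
    then obtain m where m: "k = i m" using i(2)[of k] t(1) by auto
    have "rearrangement \<rho> n < rearrangement \<rho> m" using k m t(2) by (simp add: i(3))
    then have "m < n" using decseqD[OF c0_starD(1)[OF i(4)], of n m] by (cases "n \<le> m") auto
    then show "k \<in> i ` {..<n}" using m by blast
  qed
  then show "finite {k. t \<le> \<rho> k}" by (rule finite_subset) simp
  have "card {k. t \<le> \<rho> k} \<le> card (i ` {..<n})" by (rule card_mono[OF _ sub]) simp
  also have "\<dots> \<le> n" using card_image_le[of "{..<n}" i] by simp
  finally show "card {k. t \<le> \<rho> k} \<le> n" .
qed

text \<open>
  If the entries of \<open>\<xi>\<close> are distributed over two sequences, then
  \<open>\<xi>\<close> is dominated by an ampliation of the sum of their rearrangements.
\<close>

lemma calkin_cone_two_injections: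
  assumes S: "calkin_cone S" and \<xi>: "\<xi> \<in> c0_star"
    and \<rho>: "\<And>n. 0 \<le> \<rho> n" "\<rho> \<longlonglongrightarrow> 0" "rearrangement \<rho> \<in> S"
    and \<sigma>: "\<And>n. 0 \<le> \<sigma> n" "\<sigma> \<longlonglongrightarrow> 0" "rearrangement \<sigma> \<in> S"
    and f: "inj_on f A" "\<And>n. n \<in> A \<Longrightarrow> \<xi> n \<le> \<rho> (f n)"
    and g: "inj_on g B" "\<And>n. n \<in> B \<Longrightarrow> \<xi> n \<le> \<sigma> (g n)"
    and AB: "A \<union> B = UNIV"
  shows "\<xi> \<in> S"
proof -
  note D = calkin_coneD[OF S]
  have "\<xi> m \<le> rearrangement \<rho> (m div 2) + rearrangement \<sigma> (m div 2)" for m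
  proof (rule ccontr)
    assume neg: "\<not> ?thesis"
    have nn: "0 \<le> rearrangement \<rho> (m div 2)" "0 \<le> rearrangement \<sigma> (m div 2)"
      using D(1) \<rho>(3) \<sigma>(3) c0_starD(2) by blast+
    then have t: "\<xi> m > 0" "rearrangement \<rho> (m div 2) < \<xi> m" "rearrangement \<sigma> (m div 2) < \<xi> m"
      using neg by auto
    note r = card_ge_rearrangement_le[OF \<rho>(1,2) t(1,2)] and s = card_ge_rearrangement_le[OF \<sigma>(1,2) t(1,3)]
    have dec: "\<xi> m \<le> \<xi> n" if "n \<le> m" for n using decseqD[OF c0_starD(1)[OF \<xi>] that] .
    \<comment> \<open>Each of the two parts of {..m} gets at most m div 2 elements, too few for m +
      1 indices.\<close>
    have "card ({..m} \<inter> A) \<le> card {k. \<xi> m \<le> \<rho> k}"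
      using f dec by (intro card_inj_on_le[where f = f, OF _ _ r(1)]) (auto intro: inj_on_subset order_trans)
    moreover have "card ({..m} \<inter> B) \<le> card {k. \<xi> m \<le> \<sigma> k}"
      using g dec by (intro card_inj_on_le[where f = g, OF _ _ s(1)]) (auto intro: inj_on_subset order_trans)
    moreover have "{..m} = ({..m} \<inter> A) \<union> ({..m} \<inter> B)" using AB by blast
    then have "card {..m} \<le> card ({..m} \<inter> A) + card ({..m} \<inter> B)" by (metis card_Un_le)
    ultimately show False using r(2) s(2) by simp
  qed
  then show ?thesis
    using D(3)[OF D(5)[OF D(4)[OF \<rho>(3) \<sigma>(3)]] \<xi>] by simp
qed

subsection \<open>Substochastic and orthostochastic matrices\<close>

lemma substochasticD:
  assumes "substochastic P"
  shows "0 \<le> P i j" "summable (P i)" "(\<Sum>j. P i j) \<le> 1"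
    "summable (\<lambda>i. P i j)" "(\<Sum>i. P i j) \<le> 1"
  using assms by (auto simp: substochastic_def)

text \<open>The third bound replaces \<xi> j by \<xi> n plus the excess \<xi> j - \<xi> n, which can
  be positive only for j < n. Only finitely many columns remain, so limits over rows and sums over
  finitely many rows can be taken termwise.\<close>

lemma mat_apply_bound:
  assumes P: "substochastic P" and \<xi>: "\<xi> \<in> c0_star"
  shows "summable (\<lambda>j. P i j * \<xi> j)" "0 \<le> mat_apply P \<xi> i"
    "mat_apply P \<xi> i \<le> \<xi> n + (\<Sum>j<n. P i j * (\<xi> j - \<xi> n))"
proof -
  note D = substochasticD[OF P] and c = c0_starD[OF \<xi>]
  have "norm (P i j * \<xi> j) \<le> P i j * \<xi> 0" for j
    using D(1) c(2) decseqD[OF c(1), of 0 j] by (simp add: mult_left_mono)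
  then show sm: "summable (\<lambda>j. P i j * \<xi> j)"
    by (intro summable_comparison_test'[OF summable_mult2[OF D(2)], of 0]) auto
  show "0 \<le> mat_apply P \<xi> i"
    unfolding mat_apply_def using D(1) c(2) by (intro suminf_nonneg[OF sm]) simp
  define h where "h j = (if j < n then P i j * (\<xi> j - \<xi> n) else 0)" for j
  have h: "h sums (\<Sum>j<n. P i j * (\<xi> j - \<xi> n))"
    using sums_If_finite_set[of "{..<n}" "\<lambda>j. P i j * (\<xi> j - \<xi> n)"] by (simp add: h_def[abs_def])
  have "P i j * \<xi> j \<le> P i j * \<xi> n + h j" for j
    using D(1)[of i j] decseqD[OF c(1), of n j]
    by (auto simp: h_def algebra_simps mult_left_mono mult_right_mono)
  then have "mat_apply P \<xi> i \<le> (\<Sum>j. P i j) * \<xi> n + (\<Sum>j<n. P i j * (\<xi> j - \<xi> n))"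
    unfolding mat_apply_def
    by (rule sums_le[OF _ summable_sums[OF sm] sums_add[OF sums_mult2[OF summable_sums[OF D(2)]] h]])
  also have "\<dots> \<le> 1 * \<xi> n + (\<Sum>j<n. P i j * (\<xi> j - \<xi> n))"
    using D(3) c(2) by (intro add_right_mono mult_right_mono)
  finally show "mat_apply P \<xi> i \<le> \<xi> n + (\<Sum>j<n. P i j * (\<xi> j - \<xi> n))" by simp
qed

text \<open>Each column is summable, hence tends to 0, and the truncated bound involves finitely
  many columns.\<close>

lemma mat_apply_tendsto_zero:
  assumes P: "substochastic P" and \<xi>: "\<xi> \<in> c0_star"
  shows "mat_apply P \<xi> \<longlonglongrightarrow> 0"
proof (rule order_tendstoI)
  fix t :: real assume "t > 0"
  then obtain n where n: "\<xi> n < t"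
    using order_tendstoD(2)[OF c0_starD(3)[OF \<xi>]] by (auto simp: eventually_sequentially)
  have "(\<lambda>i. \<xi> n + (\<Sum>j<n. P i j * (\<xi> j - \<xi> n))) \<longlonglongrightarrow> \<xi> n + (\<Sum>j<n. 0 * (\<xi> j - \<xi> n))"
    by (intro tendsto_intros summable_LIMSEQ_zero substochasticD(4)[OF P])
  then have "\<forall>\<^sub>F i in sequentially. \<xi> n + (\<Sum>j<n. P i j * (\<xi> j - \<xi> n)) < t"
    using n by (intro order_tendstoD(2)) simp_all
  then show "\<forall>\<^sub>F i in sequentially. mat_apply P \<xi> i < t"
    by eventually_elim (use mat_apply_bound(3)[OF P \<xi>] le_less_trans in blast)
next
  fix t :: real assume "t < 0"
  then show "\<forall>\<^sub>F i in sequentially. t < mat_apply P \<xi> i"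
    using mat_apply_bound(2)[OF P \<xi>] by (intro always_eventually allI) (meson less_le_trans)
qed

text \<open>The truncated bound is summed over F: column sums control the excess terms, row sums are
  already built into the constant \<open>\<xi> n\<close>, and the n copies of \<open>\<xi> n\<close>
  cancel.\<close>

lemma sum_mat_apply_le:
  assumes P: "substochastic P" and \<xi>: "\<xi> \<in> c0_star" and F: "finite F" "card F \<le> n"
  shows "(\<Sum>i\<in>F. mat_apply P \<xi> i) \<le> (\<Sum>j<n. \<xi> j)"
proof -
  note D = substochasticD[OF P] and c = c0_starD[OF \<xi>]
  have col: "(\<Sum>i\<in>F. P i j) \<le> 1" for j
    using sum_le_suminf[OF D(4) F(1)] D(1,5) by (meson order_trans)
  have "(\<Sum>i\<in>F. mat_apply P \<xi> i) \<le> (\<Sum>i\<in>F. \<xi> n + (\<Sum>j<n. P i j * (\<xi> j - \<xi> n)))"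
    by (intro sum_mono mat_apply_bound(3)[OF P \<xi>])
  also have "\<dots> = real (card F) * \<xi> n + (\<Sum>i\<in>F. \<Sum>j<n. P i j * (\<xi> j - \<xi> n))"
    by (simp add: sum.distrib)
  also have "(\<Sum>i\<in>F. \<Sum>j<n. P i j * (\<xi> j - \<xi> n)) = (\<Sum>j<n. (\<Sum>i\<in>F. P i j) * (\<xi> j - \<xi> n))"
    by (subst sum.swap) (simp add: sum_distrib_right)
  also have "\<dots> \<le> (\<Sum>j<n. 1 * (\<xi> j - \<xi> n))"
    using col decseqD[OF c(1)] by (intro sum_mono mult_right_mono) auto
  also have "real (card F) * \<xi> n \<le> real n * \<xi> n"
    using F(2) c(2) by (intro mult_right_mono) auto
  finally show ?thesis by (simp add: sum_subtractf)
qed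

lemma arith_mean_rearrangement_mat_apply_le:
  assumes P: "substochastic P" and \<xi>: "\<xi> \<in> c0_star"
  shows "rearrangement (mat_apply P \<xi>) \<in> c0_star"
    "arith_mean (rearrangement (mat_apply P \<xi>)) n \<le> arith_mean \<xi> n"
proof -
  obtain i where i: "inj i" "rearrangement (mat_apply P \<xi>) = mat_apply P \<xi> \<circ> i"
    "rearrangement (mat_apply P \<xi>) \<in> c0_star"
    using rearrangementE[OF mat_apply_bound(2)[OF P \<xi>] mat_apply_tendsto_zero[OF P \<xi>]] by blast
  show "rearrangement (mat_apply P \<xi>) \<in> c0_star" by (rule i(3))
  have "inj_on i {..n}" using i(1) by (rule inj_on_subset) simp
  then have "(\<Sum>j\<le>n. rearrangement (mat_apply P \<xi>) j) = (\<Sum>k\<in>i ` {..n}. mat_apply P \<xi> k)"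
    by (simp add: i(2) sum.reindex)
  also have "\<dots> \<le> (\<Sum>j<Suc n. \<xi> j)"
    using card_image_le[of "{..n}" i] by (intro sum_mat_apply_le[OF P \<xi>]) auto
  finally show "arith_mean (rearrangement (mat_apply P \<xi>)) n \<le> arith_mean \<xi> n"
    by (simp add: arith_mean_def divide_right_mono lessThan_Suc_atMost)
qed

section \<open>Orthogonal matrices and their squared entries\<close>

lemma orthogonal_on_iff:
  "orthogonal_on A U \<longleftrightarrow> (\<forall>i\<in>A. \<forall>j\<in>A.
     ((\<lambda>k. U i k * U j k) has_sum (if i = j then 1 else 0)) A \<and>
     ((\<lambda>k. U k i * U k j) has_sum (if i = j then 1 else 0)) A)"
proof -
  have *: "((\<lambda>k. complex_of_real (g k)) has_sum (if i = j then 1 else 0)) A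
      \<longleftrightarrow> (g has_sum (if i = j then 1 else 0)) A" for g and i j :: nat
    using has_sum_Re[of "\<lambda>k. complex_of_real (g k)" A "if i = j then 1 else 0"]
      has_sum_bounded_linear[OF bounded_linear_of_real[where 'a = complex],
        where f = g and S = "if i = j then 1 else 0" and A = A]
    by (auto split: if_splits)
  show ?thesis
    unfolding orthogonal_on_def unitary_on_def complex_cnj_complex_of_real of_real_mult[symmetric] * ..
qed

lemma orthostochastic_imp_substochastic:
  assumes "orthostochastic Q"
  shows "substochastic Q"
proof -
  obtain U where U: "orthogonal_on UNIV U" "\<And>i j. Q i j = (U i j)\<^sup>2"
    using assms by (auto simp: orthostochastic_def)
  have "(\<lambda>k. Q i k) sums 1" "(\<lambda>k. Q k i) sums 1" for i
    using U(1)[unfolded orthogonal_on_iff, rule_format, of i i]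
    by (auto intro!: has_sum_imp_sums simp: U(2) power2_eq_square)
  then show ?thesis
    unfolding substochastic_def using sums_unique sums_summable
    by (metis U(2) order_refl zero_le_power2)
qed

lemma strict_mono_block_exists:
  fixes b :: "nat \<Rightarrow> nat"
  assumes "strict_mono b" "b 0 = 0"
  shows "\<exists>k. b k \<le> i \<and> i < b (Suc k)"
proof (induction i)
  case 0
  show ?case using assms(2) strict_monoD[OF assms(1), of 0 1] by (intro exI[of _ 0]) auto
next
  case (Suc i)
  then obtain k where k: "b k \<le> i" "i < b (Suc k)" by blast
  show ?case
  proof (cases "Suc i < b (Suc k)")
    case True then show ?thesis using k by (intro exI[of _ k]) auto
  next
    case False
    then show ?thesis using k strict_monoD[OF assms(1), of "Suc k" "Suc (Suc k)"]
      by (intro exI[of _ "Suc k"]) auto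
  qed
qed

lemma strict_mono_block_unique:
  fixes b :: "nat \<Rightarrow> nat"
  assumes "strict_mono b" "b k \<le> i" "i < b (Suc k)" "b l \<le> i" "i < b (Suc l)"
  shows "k = l"
proof (rule ccontr)
  have *: "b (Suc m) \<le> b n" if "m < n" for m n
    using that strict_mono_mono[OF assms(1)] by (auto simp: mono_def)
  assume "k \<noteq> l"
  then show False using *[of k l] *[of l k] assms by linarith
qed

text \<open>For two indices in one block the infinite sums reduce to that block; for indices in
  different blocks every product has a zero factor.\<close>

lemma block_orthostochastic_imp_orthostochastic:
  assumes "block_orthostochastic Q"
  shows "orthostochastic Q"
proof -
  obtain U where U: "direct_sum_of_finite_orthogonal U" "\<And>i j. Q i j = (U i j)\<^sup>2"
    using assms by (auto simp: block_orthostochastic_def)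
  obtain b where b: "b 0 = 0" "strict_mono b" "\<And>k. orthogonal_on {b k..<b (Suc k)} U"
    "\<And>k l i j. k \<noteq> l \<Longrightarrow> i \<in> {b k..<b (Suc k)} \<Longrightarrow> j \<in> {b l..<b (Suc l)} \<Longrightarrow> U i j = 0"
    using U(1) unfolding direct_sum_of_finite_orthogonal_def by metis
  obtain \<beta> where \<beta>: "\<And>i. i \<in> {b (\<beta> i)..<b (Suc (\<beta> i))}"
    using strict_mono_block_exists[OF b(2,1)] by (metis atLeastLessThan_iff)
  have zero: "U i j = 0" if "\<beta> i \<noteq> \<beta> j" for i j
    using b(4)[OF that \<beta> \<beta>] .
  have block: "k \<in> {b (\<beta> i)..<b (Suc (\<beta> i))} \<longleftrightarrow> \<beta> k = \<beta> i" for i k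
  proof
    assume "k \<in> {b (\<beta> i)..<b (Suc (\<beta> i))}"
    then show "\<beta> k = \<beta> i" using strict_mono_block_unique[OF b(2), of "\<beta> k" k "\<beta> i"] \<beta>[of k] by auto
  next
    assume "\<beta> k = \<beta> i"
    then show "k \<in> {b (\<beta> i)..<b (Suc (\<beta> i))}" using \<beta>[of k] by simp
  qed
  have "((\<lambda>k. U i k * U j k) has_sum (if i = j then 1 else 0)) UNIV \<and>
     ((\<lambda>k. U k i * U k j) has_sum (if i = j then 1 else 0)) UNIV" for i j
  proof (cases "\<beta> i = \<beta> j")
    case True
    let ?B = "{b (\<beta> i)..<b (Suc (\<beta> i))}"
    have "j \<in> ?B" "i \<in> ?B" using \<beta>[of i] \<beta>[of j] True by auto
    then have "((\<lambda>k. U i k * U j k) has_sum (if i = j then 1 else 0)) ?B"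
      "((\<lambda>k. U k i * U k j) has_sum (if i = j then 1 else 0)) ?B"
      using b(3)[of "\<beta> i", unfolded orthogonal_on_iff] by blast+
    moreover have "U i k = 0" "U k i = 0" if "k \<notin> ?B" for k
      using zero[of i k] zero[of k i] block[of k i] that by auto
    ultimately show ?thesis
      by (auto intro: has_sum_cong_neutral[THEN iffD1, rotated -1])
  next
    case False
    then have "U i k * U j k = 0" "U k i * U k j = 0" for k
      using zero[of i k] zero[of j k] zero[of k i] zero[of k j] by (metis mult_eq_0_iff)+
    then show ?thesis using False by (auto intro: has_sum_0)
  qed
  then have "orthogonal_on UNIV U" by (simp add: orthogonal_on_iff)
  then show ?thesis using U(2) by (auto simp: orthostochastic_def)
qed

text \<open>
  The Householder reflection in the hyperplane orthogonal to \<open>u - e\<^sub>0\<close> maps \<open>e\<^sub>0\<close> to \<open>u\<close>.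
  For \<open>u = e\<^sub>0\<close> the division by \<open>w = 0\<close> yields the identity matrix, as it should.
\<close>

lemma orthogonal_with_first_column:
  fixes u :: "nat \<Rightarrow> real"
  assumes "(\<lambda>n. (u n)\<^sup>2) sums 1"
  obtains U where "orthogonal_on UNIV U" "\<And>i. U i 0 = u i"
proof -
  define v where "v n = u n - (if n = 0 then 1 else 0)" for n
  \<comment> \<open>This is the squared distance of u from the first unit vector, expanded using
    that u has norm 1.\<close>
  define w where "w = 2 - 2 * u 0"
  have "(\<lambda>n. (u n)\<^sup>2 + (if n = 0 then 1 - 2 * u 0 else 0)) sums (1 + (1 - 2 * u 0))"
    by (rule sums_add[OF assms sums_single])
  also have "(\<lambda>n. (u n)\<^sup>2 + (if n = 0 then 1 - 2 * u 0 else 0)) = (\<lambda>n. (v n)\<^sup>2)"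
    by (auto simp: v_def power2_eq_square algebra_simps)
  finally have v: "(\<lambda>n. (v n)\<^sup>2) sums w" by (simp add: w_def)
  then have vs: "((\<lambda>n. (v n)\<^sup>2) has_sum w) UNIV" by (rule sums_nonneg_imp_has_sum) simp
  define U where "U i k = (if i = k then 1 else 0) - 2 / w * (v i * v k)" for i k
  have sym: "U k i = U i k" for i k by (simp add: U_def mult.commute)
  have single: "((\<lambda>k. if k = i then a else 0) has_sum a) UNIV" for i :: nat and a :: real
    using has_sum_cong_neutral[of UNIV "{i}" "\<lambda>k. if k = i then a else 0" "\<lambda>_. a" a]
      has_sum_finite[of "{i}" "\<lambda>_. a"] by auto
  have "((\<lambda>k. U i k * U j k) has_sum (if i = j then 1 else 0)) UNIV" for i j
  proof -
    define c where "c = 2 / w * (v i * v j)"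
    \<comment> \<open>The product of two rows splits into two point masses and a multiple of the
      squares of v. Besides the Kronecker term the totals are - c, - c and 2 c, which
      cancel.\<close>
    have "((\<lambda>k. (if k = i then (if i = j then 1 else 0) - c else 0) + (if k = j then - c else 0)
        + (2 / w)\<^sup>2 * (v i * v j) * (v k)\<^sup>2)
        has_sum (((if i = j then 1 else 0) - c) + (- c) + (2 / w)\<^sup>2 * (v i * v j) * w)) UNIV"
      by (intro has_sum_add has_sum_cmult_right single vs)
    moreover have "(2 / w)\<^sup>2 * (v i * v j) * w = 2 * c"
      by (simp add: c_def power2_eq_square)
    moreover have "(\<lambda>k. (if k = i then (if i = j then 1 else 0) - c else 0) + (if k = j then - c else 0)
        + (2 / w)\<^sup>2 * (v i * v j) * (v k)\<^sup>2) = (\<lambda>k. U i k * U j k)"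
      by (auto simp: fun_eq_iff U_def c_def power2_eq_square algebra_simps)
    ultimately show ?thesis by simp
  qed
  then have "orthogonal_on UNIV U" by (simp add: orthogonal_on_iff sym)
  moreover have "U i 0 = u i" for i
  proof (cases "w = 0")
    case True
    then have "(v i)\<^sup>2 = 0"
      using sum_le_suminf[OF sums_summable[OF v], of "{i}"] sums_unique[OF v] by simp
    then show ?thesis using True by (auto simp: U_def v_def)
  next
    case False
    then have "2 / w * v 0 = - 1" by (simp add: v_def w_def field_simps)
    then have "2 / w * (v i * v 0) = - v i" by (metis mult.left_commute mult_minus1_right)
    then show ?thesis by (simp add: U_def v_def)
  qed
  ultimately show ?thesis using that by blast
qed

lemma summable_in_calkin_cone:
  assumes S: "calkin_cone S"
    and inv: "\<And>Q \<xi>. orthostochastic Q \<Longrightarrow> \<xi> \<in> S \<Longrightarrow> rearrangement (mat_apply Q \<xi>) \<in> S"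
    and \<xi>: "\<xi> \<in> c0_star" "summable \<xi>"
  shows "\<xi> \<in> S"
proof -
  note D = calkin_coneD[OF S] and c = c0_starD[OF \<xi>(1)]
  obtain \<eta> where \<eta>: "\<eta> \<in> S" "\<eta> 0 > 0" using D(2) by blast
  show ?thesis
  proof (cases "suminf \<xi> = 0")
    case True
    then have "\<xi> n = 0" for n using suminf_eq_zero_iff[OF \<xi>(2)] c(2) by blast
    then show ?thesis using D(3)[OF \<eta>(1) \<xi>(1)] c0_starD(2)[OF D(1)[OF \<eta>(1)]] by simp
  next
    case False
    define T where "T = suminf \<xi>"
    have T: "T > 0" using False suminf_nonneg[OF \<xi>(2)] c(2) by (auto simp: T_def order_less_le)
    \<comment> \<open>Square roots are taken because the entries of Q are the squares of those of
      U.\<close>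
    have "(\<lambda>n. (sqrt (\<xi> n / T))\<^sup>2) sums 1"
      using sums_divide[OF summable_sums[OF \<xi>(2)], of T] c(2) T by (simp add: T_def)
    then obtain U where U: "orthogonal_on UNIV U" "\<And>i. U i 0 = sqrt (\<xi> i / T)"
      using orthogonal_with_first_column[of "\<lambda>n. sqrt (\<xi> n / T)"] by blast
    define Q where "Q i j = (U i j)\<^sup>2" for i j
    \<comment> \<open>The sequence of a rank one projection: Q maps it to its own first column. It
      lies in S because S has a member with positive first entry.\<close>
    define e :: "nat \<Rightarrow> real" where "e n = (if n = 0 then 1 else 0)" for n
    have "e \<longlonglongrightarrow> 0"
      by (rule tendsto_eventually) (auto simp: e_def eventually_sequentially intro!: exI[of _ 1])
    then have e: "e \<in> c0_star" by (auto simp: c0_star_def decseq_def e_def)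
    have "e \<in> S"
    proof (rule D(3)[OF calkin_cone_cmult[OF S \<eta>(1), of "1 / \<eta> 0"] e])
      show "e n \<le> 1 / \<eta> 0 * \<eta> n" for n
        using \<eta>(2) c0_starD(2)[OF D(1)[OF \<eta>(1)]] by (simp add: e_def)
    qed (use \<eta>(2) in simp)
    have "mat_apply Q e = (\<lambda>i. 1 / T * \<xi> i)"
    proof
      fix i
      have "(\<lambda>j. Q i j * e j) = (\<lambda>j. if j = 0 then Q i 0 else 0)" by (auto simp: e_def)
      then have "mat_apply Q e i = Q i 0"
        using sums_unique[OF sums_single[of 0 "\<lambda>_. Q i 0"]] by (simp add: mat_apply_def)
      then show "mat_apply Q e i = 1 / T * \<xi> i" using T c(2) by (simp add: Q_def U(2))
    qed
    moreover have "orthostochastic Q" using U(1) by (auto simp: orthostochastic_def Q_def)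
    moreover have "(\<lambda>i. 1 / T * \<xi> i) \<in> c0_star" using T by (intro c0_star_cmult \<xi>(1)) simp
    ultimately have "(\<lambda>i. 1 / T * \<xi> i) \<in> S"
      using inv[OF _ \<open>e \<in> S\<close>, of Q] by (simp only: rearrangement_c0_star)
    from calkin_cone_cmult[OF S this, of T] T show ?thesis by simp
  qed
qed

subsection \<open>Horn's theorem for finite matrices\<close>

text \<open>Rows and columns carry separate index sets because the induction deletes a row and an
  unrelated column.\<close>

definition orthogonal_matrix_on :: "nat set \<Rightarrow> nat set \<Rightarrow> real inf_matrix \<Rightarrow> bool" where
  "orthogonal_matrix_on R C U \<longleftrightarrow>
     (\<forall>i\<in>R. \<forall>j\<in>R. (\<Sum>k\<in>C. U i k * U j k) = (if i = j then 1 else 0)) \<and>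
     (\<forall>i\<in>C. \<forall>j\<in>C. (\<Sum>k\<in>R. U k i * U k j) = (if i = j then 1 else 0))"

text \<open>Weak majorization without sorting: the best B of the given size collects the largest
  values of \<open>y\<close>.\<close>

definition submajorized :: "nat set \<Rightarrow> nat set \<Rightarrow> (nat \<Rightarrow> real) \<Rightarrow> (nat \<Rightarrow> real) \<Rightarrow> bool" where
  "submajorized R C x y \<longleftrightarrow> (\<forall>S\<subseteq>R. \<exists>B\<subseteq>C. card B = card S \<and> sum x S \<le> sum y B)"

lemma submajorizedD:
  assumes "submajorized R C x y" "S \<subseteq> R"
  obtains B where "B \<subseteq> C" "card B = card S" "sum x S \<le> sum y B"
  using assms unfolding submajorized_def by blast

lemma orthogonal_matrix_on_permutation:
  assumes h: "bij_betw h R C" and fin: "finite R" "finite C"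
  shows "orthogonal_matrix_on R C (\<lambda>i k. if k = h i then 1 else 0)"
  unfolding orthogonal_matrix_on_def
proof (intro conjI ballI)
  fix i j assume ij: "i \<in> R" "j \<in> R"
  have "h i \<in> C" "h i = h j \<longleftrightarrow> i = j"
    using ij h by (auto simp: bij_betw_def inj_on_def)
  then show "(\<Sum>k\<in>C. (if k = h i then 1 else 0) * (if k = h j then 1 else (0::real)))
      = (if i = j then 1 else 0)"
    using fin(2) by (simp add: if_distrib[of "\<lambda>z. z * _"] cong: if_cong)
next
  fix i j assume ij: "i \<in> C" "j \<in> C"
  then obtain r where r: "r \<in> R" "i = h r" using h by (auto simp: bij_betw_def)
  have "(\<Sum>k\<in>R. (if i = h k then 1 else 0) * (if j = h k then 1 else (0::real)))
      = (\<Sum>k\<in>R. if k = r then (if i = j then 1 else 0) else 0)"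
    using r h by (intro sum.cong refl) (auto simp: bij_betw_def inj_on_def)
  then show "(\<Sum>k\<in>R. (if i = h k then 1 else 0) * (if j = h k then 1 else (0::real)))
      = (if i = j then 1 else 0)" using fin(1) r(1) by simp
qed

lemma sum_exchange_le:
  fixes y :: "nat \<Rightarrow> real"
  assumes "finite B" "b \<in> B" "l \<notin> B" "y b \<le> y l"
  shows "card (insert l (B - {b})) = card B" "sum y B \<le> sum y (insert l (B - {b}))"
proof -
  have "card (B - {b}) = card B - 1" "card B \<ge> 1"
    using assms by (simp_all add: Suc_le_eq card_gt_0_iff, blast)
  then show "card (insert l (B - {b})) = card B" using assms by simp
  show "sum y B \<le> sum y (insert l (B - {b}))"
    using assms by (simp add: sum.remove[OF assms(1,2)])
qed

text \<open>
  Chan and Li's induction: a plane rotation of the coordinates of two neighbouring values of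
  \<open>y\<close> produces the largest value of \<open>x\<close>, and the compression to the complement is again
  diagonal.
\<close>

lemma submajorized_reduce:
  assumes fin: "finite R" "finite C" "card R = card C"
    and maj: "submajorized R C x y"
    and i0: "i0 \<in> R" "\<And>i. i \<in> R \<Longrightarrow> x i \<le> x i0"
    and j: "j \<in> C" "x i0 \<le> y j" "\<And>k. k \<in> C \<Longrightarrow> x i0 \<le> y k \<Longrightarrow> y j \<le> y k"
    and l: "l \<in> C" "y l < x i0" "\<And>k. k \<in> C \<Longrightarrow> y k < x i0 \<Longrightarrow> y k \<le> y l"
  shows "submajorized (R - {i0}) (C - {j}) x (y(l := y j + y l - x i0))"
  unfolding submajorized_def
proof (intro allI impI)
  let ?y = "y(l := y j + y l - x i0)"
  fix S assume S: "S \<subseteq> R - {i0}"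
  have finS: "finite S" using S fin(1) finite_subset by blast
  define H where "H = {k \<in> C. x i0 \<le> y k}"
  have H: "finite H" "j \<in> H" "l \<notin> H" "H \<subseteq> C" using fin(2) j l by (auto simp: H_def)
  have jl: "j \<noteq> l" using H by blast
  show "\<exists>B\<subseteq>C - {j}. card B = card S \<and> sum x S \<le> sum ?y B"
  \<comment> \<open>A small S is served by members of H other than j, all of value at least
    \<open>x i0\<close>. For a larger S every set of size card S + 1 leaves H, and so has an element
    of value below \<open>x i0\<close> to exchange.\<close>
  proof (cases "card S < card H")
    case True
    then have "card S \<le> card (H - {j})" using H by simp
    then obtain B where B: "B \<subseteq> H - {j}" "card B = card S"
      using obtain_subset_with_card_n by metis
    have "sum x S \<le> (\<Sum>i\<in>S. x i0)" using i0(2) S by (intro sum_mono) auto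
    also have "\<dots> = (\<Sum>k\<in>B. x i0)" using B(2) by simp
    also have "\<dots> \<le> sum ?y B" using B(1) H(3) by (intro sum_mono) (auto simp: H_def)
    finally show ?thesis using B H(4) by (intro exI[of _ B]) auto
  next
    case False
    have "i0 \<notin> S" using S by blast
    then have Si: "insert i0 S \<subseteq> R" "card (insert i0 S) = Suc (card S)" "sum x (insert i0 S) = x i0 + sum x S"
      using S i0(1) finS by auto
    obtain B0 where B0: "B0 \<subseteq> C" "card B0 = Suc (card S)" "x i0 + sum x S \<le> sum y B0"
      using submajorizedD[OF maj Si(1)] Si(2,3) by metis
    have fB: "finite B" if "B \<subseteq> C" for B using that fin(2) finite_subset by blast
    have ex: "\<exists>b\<in>B. y b < x i0" if "B \<subseteq> C" "card B = Suc (card S)" for B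
    proof (rule ccontr)
      assume "\<not> ?thesis"
      then have "B \<subseteq> H" using that(1) by (auto simp: H_def)
      then have "card B \<le> card H" using H(1) by (simp add: card_mono)
      then show False using that(2) False by simp
    qed
    obtain B1 where B1: "B1 \<subseteq> C" "card B1 = Suc (card S)" "x i0 + sum x S \<le> sum y B1" "j \<in> B1"
    proof (cases "j \<in> B0")
      case True then show ?thesis using that B0 by blast
    next
      case False
      obtain b where b: "b \<in> B0" "y b < x i0" using ex[OF B0(1,2)] by blast
      then have "y b \<le> y j" using j(2) by simp
      note E = sum_exchange_le[where y = y, OF fB[OF B0(1)] b(1) False this]
      show ?thesis by (rule that[of "insert j (B0 - {b})"]) (use E B0 j(1) in auto)
    qed
    obtain B2 where B2: "B2 \<subseteq> C" "card B2 = Suc (card S)" "x i0 + sum x S \<le> sum y B2" "j \<in> B2" "l \<in> B2"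
    proof (cases "l \<in> B1")
      case True then show ?thesis using that B1 by blast
    next
      case False
      obtain b where b: "b \<in> B1" "y b < x i0" using ex[OF B1(1,2)] by blast
      then have "y b \<le> y l" "b \<noteq> j" using l(3) B1(1) j(2) by auto
      note E = sum_exchange_le[where y = y, OF fB[OF B1(1)] b(1) False this(1)]
      show ?thesis by (rule that[of "insert l (B1 - {b})"]) (use E B1 l(1) \<open>b \<noteq> j\<close> in auto)
    qed
    have f2: "finite B2" using fB[OF B2(1)] .
    \<comment> \<open>With j and l both in B2, deleting j and adding \<open>y j - x i0\<close> to
      the value at l lowers the total by exactly \<open>x i0\<close>.\<close>
    have "sum y B2 = y j + (y l + sum y (B2 - {j} - {l}))"
      using sum.remove[OF f2 B2(4), of y] sum.remove[of "B2 - {j}" l y] f2 B2(5) jl by simp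
    moreover have "sum ?y (B2 - {j}) = ?y l + sum ?y (B2 - {j} - {l})"
      using sum.remove[of "B2 - {j}" l ?y] f2 B2(5) jl by simp
    moreover have "sum ?y (B2 - {j} - {l}) = sum y (B2 - {j} - {l})" by (intro sum.cong) auto
    ultimately have "sum x S \<le> sum ?y (B2 - {j})" using B2(3) by simp
    moreover have "card (B2 - {j}) = card S" using B2(2,4) f2 by simp
    ultimately show ?thesis using B2(1) by (intro exI[of _ "B2 - {j}"]) auto
  qed
qed

text \<open>U is W bordered by a row for i0 and then rotated in the plane of the columns j and l,
  with rows (c, s) and (-s, c). The rows of W meet this plane only in column l, so the weighted
  squares have no cross terms.\<close>

lemma orthogonal_matrix_on_rotate:
  assumes fin: "finite R" "finite C" and i0: "i0 \<in> R" and j: "j \<in> C" and l: "l \<in> C" and jl: "j \<noteq> l"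
    and W: "orthogonal_matrix_on (R - {i0}) (C - {j}) W" and cs: "c\<^sup>2 + s\<^sup>2 = (1::real)"
  defines "U \<equiv> \<lambda>i k. if i = i0 then (if k = j then c else if k = l then s else 0)
      else if k = j then - s * W i l else if k = l then c * W i l else W i k"
  shows "orthogonal_matrix_on R C U"
    and "(\<Sum>k\<in>C. (U i0 k)\<^sup>2 * y k) = c\<^sup>2 * y j + s\<^sup>2 * y l"
    and "i \<noteq> i0 \<Longrightarrow> (\<Sum>k\<in>C. (U i k)\<^sup>2 * y k)
      = (\<Sum>k\<in>C - {j}. (W i k)\<^sup>2 * (y(l := s\<^sup>2 * y j + c\<^sup>2 * y l)) k)"
proof -
  let ?D = "C - {j} - {l}"
  have cs': "c * c + s * s = 1" using cs by (simp add: power2_eq_square)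
  have split: "sum g C = g j + g l + sum g ?D" for g :: "nat \<Rightarrow> real"
    using sum.remove[OF fin(2) j, of g] sum.remove[of "C - {j}" l g] fin(2) l jl by simp
  have split': "sum g (C - {j}) = g l + sum g ?D" for g :: "nat \<Rightarrow> real"
    using sum.remove[of "C - {j}" l g] fin(2) l jl by simp
  have rows: "(\<Sum>k\<in>C - {j}. W a k * W b k) = (if a = b then 1 else 0)"
    if "a \<in> R - {i0}" "b \<in> R - {i0}" for a b
    using W that unfolding orthogonal_matrix_on_def by blast
  have cols: "(\<Sum>k\<in>R - {i0}. W k a * W k b) = (if a = b then 1 else 0)"
    if "a \<in> C - {j}" "b \<in> C - {j}" for a b
    using W that unfolding orthogonal_matrix_on_def by blast
  have U0: "U i0 j = c" "U i0 l = s" "\<And>k. k \<in> ?D \<Longrightarrow> U i0 k = 0" using jl by (auto simp: U_def)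
  have Ui: "U i j = - s * W i l" "U i l = c * W i l" "\<And>k. k \<in> ?D \<Longrightarrow> U i k = W i k"
    if "i \<noteq> i0" for i using that jl by (auto simp: U_def)
  have z0: "(\<Sum>k\<in>?D. U i0 k * g k) = 0" "(\<Sum>k\<in>?D. (U i0 k)\<^sup>2 * g k) = 0" for g
    by (rule sum.neutral, simp add: U0(3))+
  show "orthogonal_matrix_on R C U"
    unfolding orthogonal_matrix_on_def
  proof (intro conjI ballI)
    fix a b assume ab: "a \<in> R" "b \<in> R"
    have half: "(\<Sum>k\<in>C. U i0 k * U b k) = (if i0 = b then 1 else 0)" if "b \<in> R" for b
    proof (cases "b = i0")
      case True
      then show ?thesis using cs' by (simp add: split z0 U0)
    next
      case False
      then show ?thesis by (simp add: split z0 U0 Ui)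
    qed
    consider "a = i0" | "b = i0" | "a \<noteq> i0" "b \<noteq> i0" by blast
    then show "(\<Sum>k\<in>C. U a k * U b k) = (if a = b then 1 else 0)"
    proof cases
      case 1
      then show ?thesis using half[OF ab(2)] by simp
    next
      case 2
      then show ?thesis using half[OF ab(1)] by (simp add: mult.commute eq_commute)
    next
      case 3
      have "(\<Sum>k\<in>C. U a k * U b k)
          = (c * c + s * s) * (W a l * W b l) + (\<Sum>k\<in>?D. W a k * W b k)"
        using 3 by (simp add: split Ui algebra_simps)
      also have "\<dots> = (\<Sum>k\<in>C - {j}. W a k * W b k)" by (simp add: cs' split')
      also have "\<dots> = (if a = b then 1 else 0)" using rows[of a b] 3 ab by simp
      finally show ?thesis .
    qed
  next
    fix a b assume ab: "a \<in> C" "b \<in> C"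
    have rem: "(\<Sum>k\<in>R. U k a * U k b) = U i0 a * U i0 b + (\<Sum>k\<in>R - {i0}. U k a * U k b)"
      by (rule sum.remove[OF fin(1) i0])
    \<comment> \<open>Outside row i0 each column of U is a multiple of a column of W; columns j and
      l both come from column l of W, with factors -s and c.\<close>
    have coef: "\<exists>\<alpha> p. p \<in> C - {j} \<and> (\<forall>k\<in>R - {i0}. U k a = \<alpha> * W k p)
        \<and> \<alpha> = (if a = j then - s else if a = l then c else 1) \<and> p = (if a = j then l else a)"
      if "a \<in> C" for a
      using that l jl by (auto simp: U_def)
    obtain \<alpha> p where p: "p \<in> C - {j}" "\<And>k. k \<in> R - {i0} \<Longrightarrow> U k a = \<alpha> * W k p"
      "\<alpha> = (if a = j then - s else if a = l then c else 1)" "p = (if a = j then l else a)"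
      using coef[OF ab(1)] by blast
    obtain \<beta> q where q: "q \<in> C - {j}" "\<And>k. k \<in> R - {i0} \<Longrightarrow> U k b = \<beta> * W k q"
      "\<beta> = (if b = j then - s else if b = l then c else 1)" "q = (if b = j then l else b)"
      using coef[OF ab(2)] by blast
    have "(\<Sum>k\<in>R - {i0}. U k a * U k b) = (\<Sum>k\<in>R - {i0}. \<alpha> * \<beta> * (W k p * W k q))"
      by (rule sum.cong[OF refl]) (simp add: p(2) q(2))
    also have "\<dots> = \<alpha> * \<beta> * (\<Sum>k\<in>R - {i0}. W k p * W k q)" by (rule sum_distrib_left[symmetric])
    also have "(\<Sum>k\<in>R - {i0}. W k p * W k q) = (if p = q then 1 else 0)" by (rule cols[OF p(1) q(1)])
    finally have "(\<Sum>k\<in>R. U k a * U k b) = U i0 a * U i0 b + \<alpha> * \<beta> * (if p = q then 1 else 0)"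
      unfolding rem by simp
    then show "(\<Sum>k\<in>R. U k a * U k b) = (if a = b then 1 else 0)"
      using jl cs' by (auto simp: p(3,4) q(3,4) U_def split: if_splits)
  qed
  show "(\<Sum>k\<in>C. (U i0 k)\<^sup>2 * y k) = c\<^sup>2 * y j + s\<^sup>2 * y l"
    by (simp add: split z0 U0)
  show "(\<Sum>k\<in>C. (U i k)\<^sup>2 * y k)
      = (\<Sum>k\<in>C - {j}. (W i k)\<^sup>2 * (y(l := s\<^sup>2 * y j + c\<^sup>2 * y l)) k)" if "i \<noteq> i0"
    using that by (simp add: split split' Ui power_mult_distrib algebra_simps)
qed

text \<open>A one-sided form of Horn's theorem: the diagonal has to dominate \<open>x\<close> rather
  than equal it, which matches weak majorization. The induction peels off the row with the largest
  value of \<open>x\<close>.\<close>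

theorem horn_submajorization:
  assumes "finite R" "finite C" "card R = card C" "submajorized R C x y"
  shows "\<exists>U. orthogonal_matrix_on R C U \<and> (\<forall>i\<in>R. x i \<le> (\<Sum>k\<in>C. (U i k)\<^sup>2 * y k))"
  using assms
proof (induction "card R" arbitrary: R C y)
  case 0
  then show ?case by (simp add: orthogonal_matrix_on_def)
next
  case (Suc n)
  then have ne: "R \<noteq> {}" by auto
  then have "Max (x ` R) \<in> x ` R" using Suc.prems(1) by (intro Max_in) auto
  then obtain i0 where i0: "i0 \<in> R" "x i0 = Max (x ` R)" by auto
  have i0_max: "x i \<le> x i0" if "i \<in> R" for i using i0(2) Suc.prems(1) that by simp
  show ?case
  \<comment> \<open>If every value of \<open>y\<close> is at least the largest value of
    \<open>x\<close>, any permutation matrix will do; otherwise \<open>x i0\<close> has neighbours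
    in \<open>y\<close> on both sides.\<close>
  proof (cases "\<forall>k\<in>C. x i0 \<le> y k")
    case True
    obtain h where h: "bij_betw h R C"
      using finite_same_card_bij[OF Suc.prems(1,2,3)] by blast
    have "x i \<le> (\<Sum>k\<in>C. (if k = h i then 1 else 0)\<^sup>2 * y k)" if "i \<in> R" for i
    proof -
      have hi: "h i \<in> C" using h that by (auto simp: bij_betw_def)
      have "(\<Sum>k\<in>C. (if k = h i then 1 else 0)\<^sup>2 * y k) = (\<Sum>k\<in>C. if k = h i then y k else 0)"
        by (intro sum.cong) auto
      also have "\<dots> = y (h i)" using hi Suc.prems(2) by simp
      finally show ?thesis using True hi i0_max[OF that] by force
    qed
    then show ?thesis
      using orthogonal_matrix_on_permutation[OF h Suc.prems(1,2)]
      by (intro exI[of _ "\<lambda>i k. if k = h i then 1 else 0"]) simp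
  next
    case False
    define L where "L = {k \<in> C. y k < x i0}"
    have L: "finite L" "L \<noteq> {}" using False Suc.prems(2) by (auto simp: L_def not_le)
    then have "Max (y ` L) \<in> y ` L" by (intro Max_in) auto
    then obtain l where l0: "l \<in> L" "y l = Max (y ` L)" by auto
    have l: "l \<in> C" "y l < x i0" "\<And>k. k \<in> C \<Longrightarrow> y k < x i0 \<Longrightarrow> y k \<le> y l"
      using l0 L(1) by (auto simp: L_def)
    define H where "H = {k \<in> C. x i0 \<le> y k}"
    have "H \<noteq> {}"
    proof -
      obtain B where B: "B \<subseteq> C" "card B = card {i0}" "sum x {i0} \<le> sum y B"
        using submajorizedD[OF Suc.prems(4), of "{i0}"] i0(1) by blast
      then obtain k where "B = {k}" by (auto simp: card_1_singleton_iff)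
      then show ?thesis using B by (auto simp: H_def)
    qed
    moreover have "finite H" using Suc.prems(2) by (simp add: H_def)
    ultimately have "Min (y ` H) \<in> y ` H" by (intro Min_in) auto
    then obtain j where j0: "j \<in> H" "y j = Min (y ` H)" by auto
    have j: "j \<in> C" "x i0 \<le> y j" "\<And>k. k \<in> C \<Longrightarrow> x i0 \<le> y k \<Longrightarrow> y j \<le> y k"
      using j0 \<open>finite H\<close> by (auto simp: H_def)
    have jl: "j \<noteq> l" using j(2) l(2) by auto
    have gap: "y j - y l > 0" using j(2) l(2) by simp
    \<comment> \<open>The squares of c and s are the weights that express \<open>x i0\<close> as a
      convex combination of \<open>y j\<close> and \<open>y l\<close>.\<close>
    define c where "c = sqrt ((x i0 - y l) / (y j - y l))"
    define s where "s = sqrt ((y j - x i0) / (y j - y l))"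
    have c2: "c\<^sup>2 = (x i0 - y l) / (y j - y l)" and s2: "s\<^sup>2 = (y j - x i0) / (y j - y l)"
      using gap j(2) l(2) by (simp_all add: c_def s_def)
    have cs: "c\<^sup>2 + s\<^sup>2 = 1" unfolding c2 s2 add_divide_distrib[symmetric] using gap by simp
    have v1: "c\<^sup>2 * y j + s\<^sup>2 * y l = x i0"
    proof -
      have "c\<^sup>2 * y j + s\<^sup>2 * y l = ((x i0 - y l) * y j + (y j - x i0) * y l) / (y j - y l)"
        unfolding c2 s2 by (simp add: add_divide_distrib)
      also have "(x i0 - y l) * y j + (y j - x i0) * y l = x i0 * (y j - y l)"
        by (simp add: algebra_simps)
      finally show ?thesis using gap by simp
    qed
    have "s\<^sup>2 * y j + c\<^sup>2 * y l = (c\<^sup>2 + s\<^sup>2) * (y j + y l) - (c\<^sup>2 * y j + s\<^sup>2 * y l)"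
      by (simp add: algebra_simps)
    then have v2: "s\<^sup>2 * y j + c\<^sup>2 * y l = y j + y l - x i0" by (simp add: cs v1)
    have "submajorized (R - {i0}) (C - {j}) x (y(l := y j + y l - x i0))"
      by (rule submajorized_reduce[OF Suc.prems i0(1) i0_max j l])
    moreover have "n = card (R - {i0})" "card (R - {i0}) = card (C - {j})"
      using Suc.hyps(2) Suc.prems(1-3) i0(1) j(1) by simp_all
    ultimately obtain W where W: "orthogonal_matrix_on (R - {i0}) (C - {j}) W"
      "\<And>i. i \<in> R - {i0} \<Longrightarrow> x i \<le> (\<Sum>k\<in>C - {j}. (W i k)\<^sup>2 * (y(l := y j + y l - x i0)) k)"
      using Suc.hyps(1)[of "R - {i0}" "C - {j}" "y(l := y j + y l - x i0)"] Suc.prems(1,2) by auto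
    note rot = orthogonal_matrix_on_rotate[OF Suc.prems(1,2) i0(1) j(1) l(1) jl W(1) cs]
    let ?U = "\<lambda>i k. if i = i0 then (if k = j then c else if k = l then s else 0)
      else if k = j then - s * W i l else if k = l then c * W i l else W i k"
    have "x i \<le> (\<Sum>k\<in>C. (?U i k)\<^sup>2 * y k)" if "i \<in> R" for i
    proof (cases "i = i0")
      case True
      show ?thesis unfolding True rot(2) v1 by simp
    next
      case False
      show ?thesis unfolding rot(3)[OF False] v2 using W(2)[of i] False that by simp
    qed
    then show ?thesis using rot(1) by blast
  qed
qed

text \<open>Horn's theorem is applied on each block; entries joining different blocks are set to 0,
  so each infinite row sum is finite.\<close>

lemma block_orthostochastic_submajorization:
  fixes c :: "nat \<Rightarrow> nat"
  assumes c: "strict_mono c" "c 0 = 0"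
    and maj: "\<And>k. submajorized {c k..<c (Suc k)} {c k..<c (Suc k)} x y"
  obtains Q where "block_orthostochastic Q" "\<And>i. x i \<le> mat_apply Q y i"
proof -
  let ?B = "\<lambda>k. {c k..<c (Suc k)}"
  have "\<exists>U. orthogonal_matrix_on (?B k) (?B k) U \<and> (\<forall>i\<in>?B k. x i \<le> (\<Sum>j\<in>?B k. (U i j)\<^sup>2 * y j))" for k
    by (rule horn_submajorization[OF _ _ _ maj]) auto
  then obtain V where V: "\<And>k. orthogonal_matrix_on (?B k) (?B k) (V k)"
    "\<And>k i. i \<in> ?B k \<Longrightarrow> x i \<le> (\<Sum>j\<in>?B k. (V k i j)\<^sup>2 * y j)" by metis
  obtain \<beta> where \<beta>: "\<And>i. i \<in> ?B (\<beta> i)"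
    using strict_mono_block_exists[OF c] by (metis atLeastLessThan_iff)
  have \<beta>_eq: "\<beta> i = k" if "i \<in> ?B k" for i k
    using strict_mono_block_unique[OF c(1), of "\<beta> i" i k] \<beta>[of i] that by auto
  define U where "U i j = (if \<beta> i = \<beta> j then V (\<beta> i) i j else 0)" for i j
  have UV: "U i j = V k i j" if "i \<in> ?B k" "j \<in> ?B k" for i j k
    using that by (simp add: U_def \<beta>_eq)
  have "orthogonal_on (?B k) U" for k
    unfolding orthogonal_on_iff
  proof (intro ballI conjI)
    fix i j assume ij: "i \<in> ?B k" "j \<in> ?B k"
    have "(\<Sum>m\<in>?B k. U i m * U j m) = (\<Sum>m\<in>?B k. V k i m * V k j m)"
      using ij by (intro sum.cong refl) (simp add: UV)
    then show "((\<lambda>m. U i m * U j m) has_sum (if i = j then 1 else 0)) (?B k)"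
      using V(1)[of k] ij by (intro has_sum_finiteI) (auto simp: orthogonal_matrix_on_def)
    have "(\<Sum>m\<in>?B k. U m i * U m j) = (\<Sum>m\<in>?B k. V k m i * V k m j)"
      using ij by (intro sum.cong refl) (simp add: UV)
    then show "((\<lambda>m. U m i * U m j) has_sum (if i = j then 1 else 0)) (?B k)"
      using V(1)[of k] ij by (intro has_sum_finiteI) (auto simp: orthogonal_matrix_on_def)
  qed
  moreover have "U i j = 0" if "k \<noteq> l" "i \<in> ?B k" "j \<in> ?B l" for i j k l
    using that by (simp add: U_def \<beta>_eq)
  ultimately have "direct_sum_of_finite_orthogonal U"
    unfolding direct_sum_of_finite_orthogonal_def using c by (intro exI[of _ c]) auto
  then have Q: "block_orthostochastic (\<lambda>i j. (U i j)\<^sup>2)" by (auto simp: block_orthostochastic_def)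
  have "x i \<le> mat_apply (\<lambda>i j. (U i j)\<^sup>2) y i" for i
  proof -
    have zero: "U i j = 0" if "j \<notin> ?B (\<beta> i)" for j
      using that \<beta>[of j] by (auto simp: U_def)
    have "mat_apply (\<lambda>i j. (U i j)\<^sup>2) y i = (\<Sum>j\<in>?B (\<beta> i). (U i j)\<^sup>2 * y j)"
      unfolding mat_apply_def by (rule suminf_finite) (auto simp: zero)
    also have "\<dots> = (\<Sum>j\<in>?B (\<beta> i). (V (\<beta> i) i j)\<^sup>2 * y j)"
      using \<beta>[of i] by (intro sum.cong refl) (simp add: UV)
    finally show ?thesis using V(2)[OF \<beta>[of i]] by simp
  qed
  then show ?thesis using that Q by blast
qed

subsection \<open>Weak majorization and block orthostochastic matrices\<close>

lemma sum_decseq_le_initial: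
  fixes \<xi> :: "nat \<Rightarrow> real"
  assumes "decseq \<xi>" "finite A" "A \<subseteq> {p..}"
  shows "sum \<xi> A \<le> sum \<xi> {p..<p + card A}"
  using assms(2,3)
proof (induction A rule: finite_linorder_max_induct)
  case (insert b A)
  have "A \<subseteq> {p..<b}" using insert.hyps(2) insert.prems by auto
  then have "card A \<le> card {p..<b}" by (intro card_mono) auto
  moreover have "p \<le> b" using insert.prems by auto
  ultimately have "p + card A \<le> b" by simp
  then have "\<xi> b \<le> \<xi> (p + card A)" by (rule decseqD[OF assms(1)])
  moreover have "b \<notin> A" using insert.hyps(2) by blast
  ultimately show ?case using insert by simp
qed simp

lemma sum_window:
  fixes g :: "nat \<Rightarrow> real"
  shows "sum g {p..<p + m} = sum g {..<p + m} - sum g {..<p}"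
  using sum.atLeastLessThan_concat[of 0 p "p + m" g] by (simp add: atLeast0LessThan)

text \<open>Let E be the mass of \<eta> on [p, q) and D that on the window of length m from p;
  doubling makes the mass before p at most E. Short windows compare m times \<xi> q with means of
  \<eta> and cost a factor 2. For long ones the mass of \<eta> up to q + m exceeds D by the part
  before p and a tail, each at most E \<le> D; this is the origin of the 3.\<close>

lemma window_estimate:
  fixes \<xi> \<eta> :: "nat \<Rightarrow> real"
  assumes \<xi>: "\<xi> \<in> c0_star" and \<eta>: "\<eta> \<in> c0_star"
    and maj: "\<And>n. sum \<xi> {..<n} \<le> sum \<eta> {..<n}"
    and pq: "p < q" and double: "2 * sum \<eta> {..<p} \<le> sum \<eta> {..<q}"
  shows "sum \<xi> {q..<q + m} \<le> 3 * sum \<eta> {p..<p + m}"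
proof -
  note cx = c0_starD[OF \<xi>] and cy = c0_starD[OF \<eta>]
  define L where "L = q - p"
  have q: "q = p + L" "L > 0" using pq by (simp_all add: L_def)
  define E where "E = sum \<eta> {p..<q}"
  define D where "D = sum \<eta> {p..<p + m}"
  have D0: "D \<ge> 0" by (simp add: D_def sum_nonneg cy(2))
  have Eq: "sum \<eta> {..<q} = sum \<eta> {..<p} + E" by (simp add: E_def q sum_window)
  have Ep: "sum \<eta> {..<p} \<le> E" using double Eq by simp
  show ?thesis
  proof (cases "m \<le> L")
    case True
    have "sum \<xi> {q..<q + m} \<le> (\<Sum>j\<in>{q..<q + m}. \<xi> q)"
      using decseqD[OF cx(1)] by (intro sum_mono) auto
    then have 1: "sum \<xi> {q..<q + m} \<le> real m * \<xi> q" by simp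
    \<comment> \<open>The first q terms of \<xi> are all at least \<open>\<xi> q\<close>, and their
      sum is at most the mass of \<eta> before q, hence at most 2 E.\<close>
    have "(\<Sum>j<q. \<xi> q) \<le> sum \<xi> {..<q}" using decseqD[OF cx(1)] by (intro sum_mono) auto
    then have 2: "real q * \<xi> q \<le> 2 * E" using maj[of q] Eq Ep by simp
    \<comment> \<open>As \<eta> decreases, its mean over the first m terms of [p, q) is at least its
      mean over all L terms; comparing both parts with \<eta> (p + m) avoids division.\<close>
    have "(\<Sum>j\<in>{p..<p + m}. \<eta> (p + m)) \<le> D"
      unfolding D_def using decseqD[OF cy(1)] by (intro sum_mono) auto
    then have 3: "real m * \<eta> (p + m) \<le> D" by simp
    have "sum \<eta> {p + m..<q} \<le> (\<Sum>j\<in>{p + m..<q}. \<eta> (p + m))"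
      using decseqD[OF cy(1)] by (intro sum_mono) auto
    also have "\<dots> = (real L - real m) * \<eta> (p + m)" using True q by (simp add: of_nat_diff)
    finally have 4: "E - D \<le> (real L - real m) * \<eta> (p + m)"
      using sum.atLeastLessThan_concat[of p "p + m" q \<eta>] True q by (simp add: E_def D_def)
    have "real m * (E - D) \<le> real m * ((real L - real m) * \<eta> (p + m))"
      by (intro mult_left_mono 4) simp
    also have "\<dots> = (real L - real m) * (real m * \<eta> (p + m))" by (simp only: mult_ac)
    also have "\<dots> \<le> (real L - real m) * D" using True by (intro mult_left_mono 3) simp
    finally have 5: "real m * E \<le> real L * D" by (simp add: algebra_simps)
    have "real q * (real m * \<xi> q) = real m * (real q * \<xi> q)" by (simp only: mult_ac)
    also have "\<dots> \<le> real m * (2 * E)" by (intro mult_left_mono 2) simp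
    also have "\<dots> \<le> 2 * (real L * D)" using 5 by simp
    also have "\<dots> \<le> 2 * (real q * D)" using q D0 by (intro mult_left_mono mult_right_mono) auto
    finally have "real q * (real m * \<xi> q) \<le> real q * (2 * D)" by simp
    then have "real m * \<xi> q \<le> 2 * D" using q by simp
    then show ?thesis using 1 D0 by (simp add: D_def)
  next
    case False
    have "E \<le> D"
      unfolding E_def D_def using False q cy(2) by (intro sum_mono2) auto
    have "sum \<eta> {p + m..<q + m} = (\<Sum>i\<in>{p..<q}. \<eta> (i + m))"
      by (rule sum.shift_bounds_nat_ivl)
    also have "\<dots> \<le> E" unfolding E_def using decseqD[OF cy(1)] by (intro sum_mono) auto
    finally have "sum \<eta> {..<q + m} \<le> sum \<eta> {..<p + m} + E"
      using sum_window[of \<eta> "p + m" L] q by (simp add: add_ac)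
    moreover have "sum \<eta> {..<p + m} = sum \<eta> {..<p} + D" by (simp add: D_def sum_window)
    moreover have "sum \<xi> {q..<q + m} \<le> sum \<xi> {..<q + m}"
      using cx(2) by (intro sum_mono2) auto
    ultimately show ?thesis using maj[of "q + m"] Ep \<open>E \<le> D\<close> by (simp add: D_def)
  qed
qed

text \<open>In block k the part of \<xi> from c k + L k on is moved left by L k, so that it competes
  with the window of \<eta> starting at c k. The map \<open>f\<close> performs the move; it stays in
  the block, which makes the shift recoverable and \<open>f\<close> injective.\<close>

lemma block_shift_domination:
  fixes \<xi> \<eta> :: "nat \<Rightarrow> real" and c L :: "nat \<Rightarrow> nat"
  assumes dec: "decseq \<xi>" and c: "strict_mono c" "c 0 = 0"
    and win: "\<And>k m. sum \<xi> {c k + L k..<c k + L k + m} \<le> 3 * sum \<eta> {c k..<c k + m}"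
  obtains Q f where "block_orthostochastic Q"
    "inj_on f {n. \<exists>k. c k + L k \<le> n \<and> n < c (Suc k)}"
    "\<And>n. n \<in> {n. \<exists>k. c k + L k \<le> n \<and> n < c (Suc k)} \<Longrightarrow> \<xi> n / 3 \<le> mat_apply Q \<eta> (f n)"
proof -
  obtain \<beta> where \<beta>: "\<And>i. c (\<beta> i) \<le> i \<and> i < c (Suc (\<beta> i))"
    using strict_mono_block_exists[OF c] by metis
  have \<beta>_eq: "\<beta> i = k" if "c k \<le> i" "i < c (Suc k)" for i k
    using strict_mono_block_unique[OF c(1), of "\<beta> i" i k] \<beta>[of i] that by auto
  \<comment> \<open>Division by 3 absorbs the constant of the window estimate and turns it into
    submajorization.\<close>
  define x where "x i = \<xi> (i + L (\<beta> i)) / 3" for i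
  have "submajorized {c k..<c (Suc k)} {c k..<c (Suc k)} x \<eta>" for k
    unfolding submajorized_def
  proof (intro allI impI)
    fix S assume S: "S \<subseteq> {c k..<c (Suc k)}"
    then have finS: "finite S" using finite_subset by blast
    have inj: "inj_on (\<lambda>i. i + L k) S" by simp
    have "card S \<le> card {c k..<c (Suc k)}" using S by (intro card_mono) auto
    moreover have "c k < c (Suc k)" using strict_monoD[OF c(1), of k "Suc k"] by simp
    ultimately have sub: "{c k..<c k + card S} \<subseteq> {c k..<c (Suc k)}" by auto
    have "\<beta> i = k" if "i \<in> S" for i using S that by (intro \<beta>_eq) auto
    then have "sum x S = (\<Sum>i\<in>S. \<xi> (i + L k)) / 3"
      unfolding sum_divide_distrib by (intro sum.cong) (simp_all add: x_def)
    also have "(\<Sum>i\<in>S. \<xi> (i + L k)) = sum \<xi> ((\<lambda>i. i + L k) ` S)"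
      using inj by (simp add: sum.reindex)
    also have "\<dots> \<le> sum \<xi> {c k + L k..<c k + L k + card ((\<lambda>i. i + L k) ` S)}"
      using S by (intro sum_decseq_le_initial[OF dec] finite_imageI finS) auto
    also have "\<dots> \<le> 3 * sum \<eta> {c k..<c k + card S}"
      using win[of k "card S"] card_image[OF inj] by simp
    finally have "sum x S \<le> sum \<eta> {c k..<c k + card S}" by simp
    then show "\<exists>B\<subseteq>{c k..<c (Suc k)}. card B = card S \<and> sum x S \<le> sum \<eta> B"
      using sub by (intro exI[of _ "{c k..<c k + card S}"]) simp
  qed
  then obtain Q where Q: "block_orthostochastic Q" "\<And>i. x i \<le> mat_apply Q \<eta> i"
    using block_orthostochastic_submajorization[OF c, of x \<eta>] by blast
  define f where "f n = n - L (\<beta> n)" for n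
  let ?G = "{n. \<exists>k. c k + L k \<le> n \<and> n < c (Suc k)}"
  have G: "f n + L (\<beta> n) = n" "\<beta> (f n) = \<beta> n" if "n \<in> ?G" for n
  proof -
    obtain k where k: "c k + L k \<le> n" "n < c (Suc k)" using \<open>n \<in> ?G\<close> by blast
    then have "\<beta> n = k" by (intro \<beta>_eq) auto
    then show "f n + L (\<beta> n) = n" using k by (simp add: f_def)
    have "\<beta> (n - L k) = k" using k by (intro \<beta>_eq) auto
    then show "\<beta> (f n) = \<beta> n" using \<open>\<beta> n = k\<close> by (simp add: f_def)
  qed
  have "inj_on f ?G" using G by (metis (no_types, lifting) inj_onI)
  moreover have "\<xi> n / 3 \<le> mat_apply Q \<eta> (f n)" if "n \<in> ?G" for n
    using Q(2)[of "f n"] G[OF that] by (simp add: x_def)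
  ultimately show ?thesis using that Q(1) by blast
qed

text \<open>A nonsummable nonnegative sequence has unbounded partial sums, so every partial sum is
  eventually doubled.\<close>

lemma doubling_blocks:
  fixes \<eta> :: "nat \<Rightarrow> real"
  assumes nonneg: "\<And>n. 0 \<le> \<eta> n" and ns: "\<not> summable \<eta>"
  obtains b :: "nat \<Rightarrow> nat" where "strict_mono b" "b 0 = 0"
    "\<And>k. 2 * sum \<eta> {..<b k} \<le> sum \<eta> {..<b (Suc k)}"
proof -
  have "\<exists>n>m. 2 * sum \<eta> {..<m} \<le> sum \<eta> {..<n}" for m
  proof (rule ccontr)
    assume neg: "\<not> ?thesis"
    have "sum \<eta> {..<n} \<le> 2 * sum \<eta> {..<m}" for n
    proof (cases "n > m")
      case False
      then have "sum \<eta> {..<n} \<le> sum \<eta> {..<m}" using nonneg by (intro sum_mono2) auto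
      moreover have "0 \<le> sum \<eta> {..<m}" using nonneg by (simp add: sum_nonneg)
      ultimately show ?thesis by simp
    qed (use neg in force)
    then have "summable \<eta>" by (rule summableI_nonneg_bounded[OF nonneg])
    then show False using ns by simp
  qed
  then obtain b where b: "b 0 = 0" "\<And>k. b k < b (Suc k)"
    "\<And>k. 2 * sum \<eta> {..<b k} \<le> sum \<eta> {..<b (Suc k)}"
    using dependent_nat_choice[of "\<lambda>n x. n = 0 \<longrightarrow> x = (0::nat)"
        "\<lambda>_ x y. x < y \<and> 2 * sum \<eta> {..<x} \<le> sum \<eta> {..<y}"] by (metis nat.distinct(1))
  moreover have "strict_mono b" using b(2) by (simp add: strict_mono_Suc_iff)
  ultimately show ?thesis using that by blast
qed

text \<open>
  Every block \<open>[b k, b (k + 1))\<close> of \<open>\<xi>\<close> is controlled by the window \<open>[b (k - 1), b (k + 1))\<close> of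
  \<open>\<eta>\<close>. Windows belonging to indices of equal parity are disjoint, so two block matrices suffice.
\<close>

lemma calkin_cone_closed_under_majorization:
  assumes S: "calkin_cone S"
    and summ: "\<And>\<xi>. \<xi> \<in> c0_star \<Longrightarrow> summable \<xi> \<Longrightarrow> \<xi> \<in> S"
    and inv: "\<And>Q \<xi>. block_orthostochastic Q \<Longrightarrow> \<xi> \<in> S \<Longrightarrow> rearrangement (mat_apply Q \<xi>) \<in> S"
    and \<eta>: "\<eta> \<in> S" and \<xi>: "\<xi> \<in> c0_star"
    and maj: "\<And>n. sum \<xi> {..<n} \<le> sum \<eta> {..<n}"
  shows "\<xi> \<in> S"
proof (cases "summable \<eta>")
  case True
  have "\<eta> \<in> c0_star" using calkin_coneD(1)[OF S \<eta>] .
  then have "sum \<eta> {..<n} \<le> suminf \<eta>" for n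
    using c0_starD(2) by (intro sum_le_suminf[OF True]) auto
  then have "sum \<xi> {..<n} \<le> suminf \<eta>" for n using maj[of n] by (meson order_trans)
  then have "summable \<xi>" by (rule summableI_nonneg_bounded[OF c0_starD(2)[OF \<xi>]])
  then show ?thesis by (rule summ[OF \<xi>])
next
  case False
  have \<eta>0: "\<eta> \<in> c0_star" using calkin_coneD(1)[OF S \<eta>] .
  obtain b where b: "strict_mono b" "b 0 = 0" "\<And>k. 2 * sum \<eta> {..<b k} \<le> sum \<eta> {..<b (Suc k)}"
    using doubling_blocks[OF c0_starD(2)[OF \<eta>0] False] by blast
  have lt: "b k < b (Suc k)" for k using strict_monoD[OF b(1), of k "Suc k"] by simp
  note win = window_estimate[OF \<xi> \<eta>0 maj lt b(3)]
  \<comment> \<open>Each window consists of an even block and the odd block after it; the shift L k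
    makes the odd block the one that is dominated.\<close>
  define c where "c k = b (2 * k)" for k
  define L where "L k = b (2 * k + 1) - b (2 * k)" for k
  have c: "strict_mono c" "c 0 = 0"
    using b(2) strict_monoD[OF b(1)] by (simp_all add: c_def strict_mono_def)
  have "sum \<xi> {c k + L k..<c k + L k + m} \<le> 3 * sum \<eta> {c k..<c k + m}" for k m
    using win[of "2 * k" m] lt[of "2 * k"] by (simp add: c_def L_def)
  then obtain Q f where Q: "block_orthostochastic Q"
    "inj_on f {n. \<exists>k. c k + L k \<le> n \<and> n < c (Suc k)}"
    "\<And>n. n \<in> {n. \<exists>k. c k + L k \<le> n \<and> n < c (Suc k)} \<Longrightarrow> \<xi> n / 3 \<le> mat_apply Q \<eta> (f n)"
    using block_shift_domination[OF c0_starD(1)[OF \<xi>] c, of L \<eta>] by blast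
  \<comment> \<open>These windows dominate the even blocks. Block 0 has no predecessor, so its
    window starts at 0 with shift 0.\<close>
  define d where "d k = (if k = 0 then 0 else b (2 * k - 1))" for k
  define M where "M k = (if k = 0 then 0 else b (2 * k) - b (2 * k - 1))" for k
  have d: "strict_mono d" "d 0 = 0"
    using strict_monoD[OF b(1)] b(2) by (auto simp: d_def strict_mono_Suc_iff) (metis lt le_less_trans le0)
  have "sum \<xi> {d k + M k..<d k + M k + m} \<le> 3 * sum \<eta> {d k..<d k + m}" for k m
  proof (cases k)
    case 0
    \<comment> \<open>For the initial block the majorization from the start is itself the window
      estimate.\<close>
    have "sum \<xi> {..<m} \<le> 3 * sum \<eta> {..<m}"
      using maj[of m] sum_nonneg[of "{..<m}" \<eta>] c0_starD(2)[OF \<eta>0] by simp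
    then show ?thesis using 0 by (simp add: d_def M_def atLeast0LessThan)
  next
    case (Suc j)
    then show ?thesis
      using win[of "2 * j + 1" m] lt[of "2 * j + 1"] by (simp add: d_def M_def)
  qed
  then obtain R g where R: "block_orthostochastic R"
    "inj_on g {n. \<exists>k. d k + M k \<le> n \<and> n < d (Suc k)}"
    "\<And>n. n \<in> {n. \<exists>k. d k + M k \<le> n \<and> n < d (Suc k)} \<Longrightarrow> \<xi> n / 3 \<le> mat_apply R \<eta> (g n)"
    using block_shift_domination[OF c0_starD(1)[OF \<xi>] d, of M \<eta>] by blast
  have cover: "{n. \<exists>k. c k + L k \<le> n \<and> n < c (Suc k)} \<union> {n. \<exists>k. d k + M k \<le> n \<and> n < d (Suc k)} = UNIV"
  proof -
    have "(\<exists>k. c k + L k \<le> n \<and> n < c (Suc k)) \<or> (\<exists>k. d k + M k \<le> n \<and> n < d (Suc k))" for n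
    proof -
      obtain k where k: "b k \<le> n" "n < b (Suc k)" using strict_mono_block_exists[OF b(1,2)] by blast
      show ?thesis
      proof (cases "even k")
        case True
        then obtain j where j: "k = 2 * j" by blast
        have "d j + M j \<le> n \<and> n < d (Suc j)"
          using k j lt[of "2 * j - 1"] b(2) by (cases j) (simp_all add: d_def M_def)
        then show ?thesis by blast
      next
        case False
        then obtain j where j: "k = 2 * j + 1" using oddE by blast
        have "c j + L j \<le> n \<and> n < c (Suc j)"
          using k j lt[of "2 * j"] by (simp add: c_def L_def)
        then show ?thesis by blast
      qed
    qed
    then show ?thesis by blast
  qed
  have P: "0 \<le> mat_apply Q' \<eta> n" "mat_apply Q' \<eta> \<longlonglongrightarrow> 0" if "block_orthostochastic Q'" for Q' n
  proof -
    have sub: "substochastic Q'"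
      using that block_orthostochastic_imp_orthostochastic orthostochastic_imp_substochastic by blast
    show "0 \<le> mat_apply Q' \<eta> n" by (rule mat_apply_bound(2)[OF sub \<eta>0])
    show "mat_apply Q' \<eta> \<longlonglongrightarrow> 0" by (rule mat_apply_tendsto_zero[OF sub \<eta>0])
  qed
  have "(\<lambda>n. \<xi> n / 3) \<in> c0_star"
    using c0_star_cmult[OF \<xi>, of "1 / 3"] by simp
  then have "(\<lambda>n. \<xi> n / 3) \<in> S"
    by (rule calkin_cone_two_injections[OF S _ P(1)[OF Q(1)] P(2)[OF Q(1)] inv[OF Q(1) \<eta>]
          P(1)[OF R(1)] P(2)[OF R(1)] inv[OF R(1) \<eta>] Q(2,3) R(2,3) cover])
  from calkin_cone_cmult[OF S this, of 3] show ?thesis by simp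
qed

section \<open>Equivalence of the four conditions\<close>

lemma arith_mean_le_imp_sum_le:
  assumes "arith_mean \<xi> n \<le> C * arith_mean \<eta> n"
  shows "sum \<xi> {..<Suc n} \<le> C * sum \<eta> {..<Suc n}"
  using assms by (simp add: arith_mean_def lessThan_Suc_atMost divide_le_cancel)

theorem theorem4p7:
  fixes I :: "('a::complex_hilbert_space \<Rightarrow> 'a) set"
  assumes separable: "\<exists>D :: 'a set. countable D \<and> closure D = UNIV"
    and infinite_dimensional:
      "\<not> (\<exists>B :: 'a set. finite B \<and> complex_vector.span B = UNIV)"
    and ideal: "operator_ideal I"
    and nonzero: "I \<noteq> {\<lambda>_. 0}"
  shows "(am_closed I \<longleftrightarrow> invariant_under I {P. substochastic P})
       \<and> (invariant_under I {P. substochastic P} \<longleftrightarrow> invariant_under I {Q. orthostochastic Q})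
       \<and> (invariant_under I {Q. orthostochastic Q}
           \<longleftrightarrow> trace_class \<subseteq> I \<and> invariant_under I {Q. block_orthostochastic Q})"
proof -
  obtain b :: "nat \<Rightarrow> 'a" where b: "orthonormal_basis b"
    using orthonormal_basis_exists[OF infinite_dimensional separable] by blast
  define S where "S = characteristic_set I"
  have S: "calkin_cone S"
    unfolding S_def by (rule calkin_cone_characteristic_set[OF infinite_dimensional b ideal nonzero])
  note am_closed = am_closed_iff[OF infinite_dimensional b ideal, folded S_def]
  note trace_class = trace_class_subset_iff[OF infinite_dimensional b ideal, folded S_def]
  have invariant: "invariant_under I {P. p P} \<longleftrightarrow>
      (\<forall>P \<xi>. p P \<longrightarrow> \<xi> \<in> S \<longrightarrow> rearrangement (mat_apply P \<xi>) \<in> S)" for p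
    by (auto simp: invariant_under_def S_def)
  have 1: "invariant_under I {P. substochastic P}" if "am_closed I"
    unfolding invariant
  proof (intro allI impI)
    fix P \<xi> assume P: "substochastic P" and \<xi>: "\<xi> \<in> S"
    have \<xi>0: "\<xi> \<in> c0_star" using calkin_coneD(1)[OF S \<xi>] .
    have "\<forall>n. arith_mean (rearrangement (mat_apply P \<xi>)) n \<le> 1 * arith_mean \<xi> n"
      using arith_mean_rearrangement_mat_apply_le(2)[OF P \<xi>0] by simp
    then show "rearrangement (mat_apply P \<xi>) \<in> S"
      using that arith_mean_rearrangement_mat_apply_le(1)[OF P \<xi>0] \<xi> unfolding am_closed by blast
  qed
  have 2: "invariant_under I {Q. orthostochastic Q}" if "invariant_under I {P. substochastic P}"
    using that orthostochastic_imp_substochastic unfolding invariant by blast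
  have 3: "trace_class \<subseteq> I \<and> invariant_under I {Q. block_orthostochastic Q}"
    if inv: "invariant_under I {Q. orthostochastic Q}"
  proof
    show "trace_class \<subseteq> I"
      unfolding trace_class using inv summable_in_calkin_cone[OF S] unfolding invariant by blast
    show "invariant_under I {Q. block_orthostochastic Q}"
      using inv block_orthostochastic_imp_orthostochastic unfolding invariant by blast
  qed
  have 4: "am_closed I"
    if "trace_class \<subseteq> I" and inv: "invariant_under I {Q. block_orthostochastic Q}"
    unfolding am_closed
  proof (intro ballI impI)
    fix \<xi> assume \<xi>: "\<xi> \<in> c0_star"
      and "\<exists>\<eta>\<in>S. \<exists>C. \<forall>n. arith_mean \<xi> n \<le> C * arith_mean \<eta> n"
    then obtain \<eta> C where \<eta>: "\<eta> \<in> S" "\<And>n. arith_mean \<xi> n \<le> C * arith_mean \<eta> n" by blast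
    have \<eta>0: "\<eta> \<in> c0_star" using calkin_coneD(1)[OF S \<eta>(1)] .
    \<comment> \<open>The constant C is not known to be nonnegative, while scaling in the cone asks
      for this; hence \<open>max C 0\<close>. The mean with index m covers m + 1 terms, so the empty
      sum is treated apart.\<close>
    have "sum \<xi> {..<n} \<le> sum (\<lambda>j. max C 0 * \<eta> j) {..<n}" for n
    proof (cases n)
      case (Suc m)
      have "sum \<xi> {..<n} \<le> C * sum \<eta> {..<n}"
        unfolding Suc by (rule arith_mean_le_imp_sum_le[OF \<eta>(2)])
      also have "\<dots> \<le> max C 0 * sum \<eta> {..<n}"
        using c0_starD(2)[OF \<eta>0] by (intro mult_right_mono sum_nonneg) auto
      finally show ?thesis by (simp add: sum_distrib_left)
    qed simp
    moreover have "(\<lambda>j. max C 0 * \<eta> j) \<in> S" by (rule calkin_cone_cmult[OF S \<eta>(1)]) simp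
    ultimately show "\<xi> \<in> S"
      using calkin_cone_closed_under_majorization[OF S _ _ _ \<xi>] that(1) inv
      unfolding trace_class invariant by blast
  qed
  \<comment> \<open>The four implications close a cycle.\<close>
  show ?thesis using 1 2 3 4 by blast
qed

end
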